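(* For $\rho>0$ and a measurable function $f$ with compact support, it holds a.s. that $$\lim_{\delta\downarrow\rho}\frac{\mathbf E_0\left(f(M_{\theta_\delta})\mid\mathcal F_{\theta_\rho}\right)-f(M_{\theta_\rho})}{\delta-\rho}=\mathcal A_\rho f(M_{\theta_\rho}),$$ where $\mathcal A_\rho$ is given by $$\mathcal A_\rho f(y):=\frac{S'(y-\rho)}{S(y)-S(y-\rho)}\int_y^{r}\frac{f(z)-f(y)}{S(z)-S(z-\rho)}\exp\left(-\int_y^z\frac{S(dt)}{S(t)-S(t-\rho)}\right)dS(z).$$
   Context: $X=(X_t)_{t\ge 0}$ is a regular one-dimensional diffusion in the sense of Itô and McKean (strong Markov, continuous paths) on an interval with left endpoint $l=-\infty$ and right endpoint $r=+\infty$, not killed inside it, started at $X_0=0$ under $\mathbf P_0$; $\mathbf P_x,\mathbf E_x$ denote probability and expectation when $X_0=x$. $\mathcal F_t$ is the $\sigma$-algebra generated by $X$ up to time $t$, and $\mathcal F_{\theta_\rho}$ is the corresponding $\sigma$-algebra at the stopping time $\theta_\rho$ defined below. The scale function $S$ is in $C^1$ and the speed measure has a continuous derivative with respect to Lebesgue measure. $X$ is either recurrent with $S(+\infty)=+\infty$, $S(-\infty)=-\infty$, or transient with $S(+\infty)<\infty$, $S(-\infty)=-\infty$. The notation $S(dt)$ means $dS(t)$. $M_t:=\max_{0\le s\le t}X_s$, $\theta_\delta:=\inf\{t\ge0:M_t-X_t>\delta\}$, $H_y:=\inf\{t\ge0:X_t=y\}$. It is assumed that $\theta_\delta$ is a.s.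 finite for all $\delta$. For $\delta>\rho$ the conditional expectation $\mathbf E_0(f(M_{\theta_\delta})\mid\mathcal F_{\theta_\rho})$ is taken in its version $Q_{\rho,\delta}(M_{\theta_\rho};f)$, where $Q_{\rho,\delta}(y;f):=f(y)\mathbf P_{y-\rho}(H_{y-\delta}<H_y)+\mathbf E_y(f(M_{\theta_\delta}))\mathbf P_{y-\rho}(H_y<H_{y-\delta})$. *)

theory Defs
  imports "HOL-Probability.Probability"
begin

text \<open>
  A diffusion is a family \<open>P x\<close> of laws on one measurable space \<open>N\<close> together with a process
  \<open>X\<close> with continuous paths.  The state space is the real line.  It is killed nowhere inside it, but
  an end point may be reached in finite time, which happens for instance when the process explodes.
  Paths are therefore extended-real valued, and they stay at an infinite end point once they have
  reached it; a process that never reaches an end point is the special case of real-valued \<open>X\<close>.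
\<close>

definition history :: "'w measure \<Rightarrow> (real \<Rightarrow> 'w \<Rightarrow> ereal) \<Rightarrow> real set \<Rightarrow> 'w measure" where
  "history N X T = sigma (space N) {X s -` B \<inter> space N | s B. s \<in> T \<and> B \<in> sets borel}"

text \<open>
  As in It\^o and McKean, a Markov time satisfies \<open>{\<tau> < t} \<in> F\<^sub>t\<close> with \<open>F\<^sub>t\<close> generated by
  \<open>X\<close> up to time \<open>t\<close> and not augmented.  The strict inequality matters:
  \<open>drawdown_time\<close> below is the entrance time of an open set, and \<open>{\<tau> \<le> t}\<close> is in general
  not in \<open>F\<^sub>t\<close> for it.
\<close>

definition markov_time :: "'w measure \<Rightarrow> (real \<Rightarrow> 'w \<Rightarrow> ereal) \<Rightarrow> ('w \<Rightarrow> ennreal) \<Rightarrow> bool" where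
  "markov_time N X \<tau> \<longleftrightarrow>
     (\<forall>t\<ge>0. {\<omega> \<in> space N. \<tau> \<omega> < ennreal t} \<in> sets (history N X {0..t}))"

definition sigma_at :: "'w measure \<Rightarrow> (real \<Rightarrow> 'w \<Rightarrow> ereal) \<Rightarrow> ('w \<Rightarrow> ennreal) \<Rightarrow> 'w measure" where
  "sigma_at N X \<tau> = sigma (space N)
     {A \<in> sets (history N X {0..}).
        \<forall>t\<ge>0. {\<omega> \<in> A. \<tau> \<omega> < ennreal t} \<in> sets (history N X {0..t})}"

definition path_from :: "(real \<Rightarrow> 'w \<Rightarrow> ereal) \<Rightarrow> real \<Rightarrow> 'w \<Rightarrow> real \<Rightarrow> ereal" where
  "path_from X s \<omega> = (\<lambda>t\<in>{0..}. X (s + t) \<omega>)"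

definition hitting_time :: "(real \<Rightarrow> 'w \<Rightarrow> ereal) \<Rightarrow> real \<Rightarrow> 'w \<Rightarrow> ennreal" where
  "hitting_time X y \<omega> = Inf (ennreal ` {t. 0 \<le> t \<and> X t \<omega> = ereal y})"

locale regular_diffusion =
  fixes N :: "'w measure" and X :: "real \<Rightarrow> 'w \<Rightarrow> ereal" and P :: "real \<Rightarrow> 'w measure"
  assumes measurable_X: "\<And>t. 0 \<le> t \<Longrightarrow> X t \<in> borel_measurable N"
    and kernel: "P \<in> borel \<rightarrow>\<^sub>M prob_algebra N"
    and start: "\<And>x. AE \<omega> in P x. X 0 \<omega> = ereal x"
    and continuous_paths: "\<And>\<omega>. \<omega> \<in> space N \<Longrightarrow> continuous_on {0..} (\<lambda>t. X t \<omega>)"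
    and trapped: "\<And>\<omega> s t. \<omega> \<in> space N \<Longrightarrow> 0 \<le> s \<Longrightarrow> s \<le> t \<Longrightarrow> \<bar>X s \<omega>\<bar> = \<infinity> \<Longrightarrow> X t \<omega> = X s \<omega>"
    and strong_markov: "\<And>x \<tau> A B.
      markov_time N X \<tau> \<Longrightarrow> A \<in> sets (sigma_at N X \<tau>) \<Longrightarrow> B \<in> sets (Pi\<^sub>M {0..} (\<lambda>_. borel)) \<Longrightarrow>
      emeasure (P x) {\<omega> \<in> A. \<tau> \<omega> < \<infinity> \<and> \<bar>X (enn2real (\<tau> \<omega>)) \<omega>\<bar> \<noteq> \<infinity> \<and>
                             path_from X (enn2real (\<tau> \<omega>)) \<omega> \<in> B} =
      (\<integral>\<^sup>+\<omega>. indicator {\<omega> \<in> A. \<tau> \<omega> < \<infinity> \<and> \<bar>X (enn2real (\<tau> \<omega>)) \<omega>\<bar> \<noteq> \<infinity>} \<omega> *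
           emeasure (P (real_of_ereal (X (enn2real (\<tau> \<omega>)) \<omega>)))
             {\<omega>' \<in> space N. path_from X 0 \<omega>' \<in> B} \<partial>P x)"
    and regular: "\<And>x y. \<P>(\<omega> in P x. hitting_time X y \<omega> < \<infinity>) > 0"

definition recurrent :: "(real \<Rightarrow> 'w measure) \<Rightarrow> (real \<Rightarrow> 'w \<Rightarrow> ereal) \<Rightarrow> bool" where
  "recurrent P X \<longleftrightarrow> (\<forall>x y. \<P>(\<omega> in P x. hitting_time X y \<omega> < \<infinity>) = 1)"

definition transient :: "(real \<Rightarrow> 'w measure) \<Rightarrow> (real \<Rightarrow> 'w \<Rightarrow> ereal) \<Rightarrow> bool" where
  "transient P X \<longleftrightarrow> \<not> recurrent P X"

definition scale_function ::
  "(real \<Rightarrow> 'w measure) \<Rightarrow> (real \<Rightarrow> 'w \<Rightarrow> ereal) \<Rightarrow> (real \<Rightarrow> real) \<Rightarrow> bool" where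
  "scale_function P X S \<longleftrightarrow> strict_mono S \<and> continuous_on UNIV S \<and>
     (\<forall>a x b. a < x \<longrightarrow> x < b \<longrightarrow>
        \<P>(\<omega> in P x. hitting_time X a \<omega> < hitting_time X b \<omega>) = (S b - S x) / (S b - S a) \<and>
        \<P>(\<omega> in P x. hitting_time X b \<omega> < hitting_time X a \<omega>) = (S x - S a) / (S b - S a))"

text \<open>
  The speed measure is characterised by the mean exit times from bounded intervals: \<open>m\<close>
  integrates the Green function.  The normalisation is that of It\^o and McKean, where the generator
  is \<open>d/dm d/dS\<close>, so Brownian motion has \<open>S x = x\<close> and \<open>m(dx) = 2 dx\<close>.
\<close>

definition speed_measure ::
  "(real \<Rightarrow> 'w measure) \<Rightarrow> (real \<Rightarrow> 'w \<Rightarrow> ereal) \<Rightarrow> (real \<Rightarrow> real) \<Rightarrow> real measure \<Rightarrow> bool" where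
  "speed_measure P X S m \<longleftrightarrow> sets m = sets borel \<and>
     (\<forall>a x b. a < x \<longrightarrow> x < b \<longrightarrow>
        (\<integral>\<^sup>+\<omega>. min (hitting_time X a \<omega>) (hitting_time X b \<omega>) \<partial>P x) =
        (\<integral>\<^sup>+y\<in>{a<..<b}. ennreal ((S (min x y) - S a) * (S b - S (max x y)) / (S b - S a)) \<partial>m))"

definition running_max :: "(real \<Rightarrow> 'w \<Rightarrow> ereal) \<Rightarrow> real \<Rightarrow> 'w \<Rightarrow> ereal" where
  "running_max X t \<omega> = (SUP s\<in>{0..t}. X s \<omega>)"

text \<open>The sum form avoids \<open>\<infinity> - \<infinity> = \<infinity>\<close> in \<open>ereal\<close>.\<close>

definition drawdown_time :: "(real \<Rightarrow> 'w \<Rightarrow> ereal) \<Rightarrow> real \<Rightarrow> 'w \<Rightarrow> ennreal" where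
  "drawdown_time X \<delta> \<omega> = Inf (ennreal ` {t. 0 \<le> t \<and> X t \<omega> + ereal \<delta> < running_max X t \<omega>})"

text \<open>\<open>M\<close> at the time \<open>\<theta>\<^sub>\<delta>\<close>; meaningful where \<open>drawdown_time X \<delta> \<omega> < \<infinity>\<close>.\<close>

definition max_at_drawdown :: "(real \<Rightarrow> 'w \<Rightarrow> ereal) \<Rightarrow> real \<Rightarrow> 'w \<Rightarrow> real" where
  "max_at_drawdown X \<delta> \<omega> = real_of_ereal (running_max X (enn2real (drawdown_time X \<delta> \<omega>)) \<omega>)"

definition Q :: "(real \<Rightarrow> 'w measure) \<Rightarrow> (real \<Rightarrow> 'w \<Rightarrow> ereal) \<Rightarrow> real \<Rightarrow> real \<Rightarrow> real \<Rightarrow>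
    (real \<Rightarrow> real) \<Rightarrow> real" where
  "Q P X \<rho> \<delta> y f =
     f y * \<P>(\<omega> in P (y - \<rho>). hitting_time X (y - \<delta>) \<omega> < hitting_time X y \<omega>) +
     (\<integral>\<omega>. f (max_at_drawdown X \<delta> \<omega>) \<partial>P y) *
       \<P>(\<omega> in P (y - \<rho>). hitting_time X y \<omega> < hitting_time X (y - \<delta>) \<omega>)"

definition gen :: "(real \<Rightarrow> real) \<Rightarrow> real \<Rightarrow> (real \<Rightarrow> real) \<Rightarrow> real \<Rightarrow> real" where
  "gen S \<rho> f y = deriv S (y - \<rho>) / (S y - S (y - \<rho>)) *
     (LINT z:{y<..}|interval_measure S.
        (f z - f y) / (S z - S (z - \<rho>)) *
        exp (- (LINT t:{y<..z}|interval_measure S. 1 / (S t - S (t - \<rho>)))))"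

end

theory Submission
  imports Defs
begin

text \<open>
  At the time \<open>\<theta>\<^sub>\<rho>\<close> the process sits exactly \<open>\<rho>\<close> below its maximum \<open>y = M\<^bsub>\<theta>\<^sub>\<rho>\<^esub>\<close>.
  Before the drawdown can reach \<open>\<delta> > \<rho>\<close> one of two things happens.  Either the path falls from
  \<open>y - \<rho>\<close> to \<open>y - \<delta>\<close> before it regains \<open>y\<close>; then \<open>M\<^bsub>\<theta>\<^sub>\<delta>\<^esub> = y\<close>.  Or it regains \<open>y\<close>, and
  from there the search for a drawdown of size \<open>\<delta>\<close> starts afresh.  The strong Markov property at
  \<open>\<theta>\<^sub>\<rho>\<close> and then at the return to \<open>y\<close> turns this into the formula \<open>Q\<close>
  (\<open>exit_kernel_tail\<close>, \<open>markov_at_drawdown\<close>, \<open>cond_exp_max_at_drawdown\<close>).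

  Consequently \<open>Q - f y\<close> is the product of the recovery probability
  \<open>(S (y - \<rho>) - S (y - \<delta>)) / (S y - S (y - \<delta>))\<close>, which is of first order in \<open>\<delta> - \<rho>\<close> and supplies the
  factor \<open>S' (y - \<rho>) / (S y - S (y - \<rho>))\<close>, and of \<open>E\<^sub>y (f (M\<^bsub>\<theta>\<^sub>\<delta>\<^esub>)) - f y\<close>, which only has to be
  shown to be continuous in \<open>\<delta>\<close> from the right.  For the latter the law of \<open>M\<^bsub>\<theta>\<^sub>\<delta>\<^esub>\<close> is needed.

  That law is exponential in a changed clock: while the maximum rises from \<open>x\<close> to \<open>x + \<epsilon>\<close>, a drawdown
  of size \<open>\<delta>\<close> interrupts it with probability about \<open>\<epsilon> S' x / (S x - S (x - \<delta>))\<close>.  Precisely, the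
  probability \<open>h x\<close> of climbing from \<open>x\<close> beyond \<open>z\<close> without such a drawdown satisfies two-sided
  estimates for \<open>h x / h y\<close> (\<open>climb_prob_ratio\<close>) that force a linear differential equation
  (\<open>climb_prob_deriv\<close>), hence \<open>h x = exp (- \<integral> rate)\<close> (\<open>climb_prob_eq\<close>).  Finiteness of the
  drawdown times says that this law has full mass, which gives a density (\<open>distr_max_at_drawdown\<close>), and
  dominated convergence on the compact support of \<open>f\<close> gives the limit (\<open>Q_derivative\<close>).  The limit
  holds at every level \<open>y \<ge> 0\<close>, and \<open>M\<^bsub>\<theta>\<^sub>\<rho>\<^esub> \<ge> 0\<close> almost surely.

  Two technical points shape the development.  The strong Markov property speaks of measurable sets of
  the full product space of paths, where continuity is not available, so every path event is described by
  rational times only; for continuous paths the rational and the real description agree.  And the event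
  for the future path has to be a fixed set, while the maximum so far is random; but at \<open>\<theta>\<^sub>\<rho>\<close> the
  maximum is the current position plus \<open>\<rho>\<close>, so it can be read off the future path
  (\<open>continuation_set\<close>).
\<close>

section \<open>Path events and rational times\<close>

text \<open>
The time set \<open>D\<close> is a parameter because pathwise arguments use all times and measurability uses the
rational ones.  The floor \<open>c\<close> stands for a maximum that was attained before time 0; with
\<open>c = - \<infinity>\<close> only the path itself counts.
\<close>

definition climbs :: "real set \<Rightarrow> real \<Rightarrow> ereal \<Rightarrow> real \<Rightarrow> (real \<Rightarrow> ereal) \<Rightarrow> bool" where
  "climbs D \<delta> c z w \<longleftrightarrow>
     (\<exists>t\<in>D. ereal z < w t \<and> (\<forall>s\<in>D. \<forall>r\<in>D. r \<le> s \<longrightarrow> s \<le> t \<longrightarrow> max c (w r) \<le> w s + ereal \<delta>))"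

definition drops :: "real set \<Rightarrow> real \<Rightarrow> (real \<Rightarrow> ereal) \<Rightarrow> bool" where
  "drops D \<delta> w \<longleftrightarrow> (\<exists>s\<in>D. \<exists>r\<in>D. r \<le> s \<and> w s + ereal \<delta> < w r)"

definition rises :: "real set \<Rightarrow> real \<Rightarrow> real \<Rightarrow> (real \<Rightarrow> ereal) \<Rightarrow> bool" where
  "rises D y a w \<longleftrightarrow> (\<exists>t\<in>D. ereal y < w t \<and> (\<forall>s\<in>D. s \<le> t \<longrightarrow> ereal a \<le> w s))"

lemma open_at_near_times:
  fixes w :: "real \<Rightarrow> ereal"
  assumes w: "continuous_on {0..} w" and U: "open U" "w t \<in> U" and t: "0 \<le> t"
  shows "\<exists>e>0. \<forall>s\<ge>0. \<bar>s - t\<bar> < e \<longrightarrow> w s \<in> U"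
proof -
  have "(w \<longlongrightarrow> w t) (at t within {0..})"
    using w t by (auto simp: continuous_on_def)
  then have "eventually (\<lambda>s. w s \<in> U) (at t within {0..})"
    using U by (auto dest: topological_tendstoD)
  then obtain e where e: "e > 0" "\<And>s. 0 \<le> s \<Longrightarrow> s \<noteq> t \<Longrightarrow> dist s t < e \<Longrightarrow> w s \<in> U"
    unfolding eventually_at by auto
  show ?thesis
  proof (intro exI[of _ e] conjI allI impI)
    fix s assume s: "0 \<le> s" "\<bar>s - t\<bar> < e"
    show "w s \<in> U"
      using e(2)[of s] U(2) s by (cases "s = t") (auto simp: dist_real_def)
  qed (rule e(1))
qed

text \<open>
Path properties are transferred to rational times by approaching a given time from the left: this keeps
the rational time inside any time interval that contains the given one and starts at 0.
\<close>

lemma rational_time_after: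
  fixes w :: "real \<Rightarrow> ereal"
  assumes w: "continuous_on {0..} w" and U: "open U" "w t \<in> U" and a: "0 \<le> a" "a < t"
  shows "\<exists>q\<in>\<rat>. a < q \<and> q < t \<and> w q \<in> U"
proof -
  have "0 \<le> t" using a by simp
  then obtain e where e: "e > 0" "\<And>s. 0 \<le> s \<Longrightarrow> \<bar>s - t\<bar> < e \<Longrightarrow> w s \<in> U"
    using open_at_near_times[OF w U] by auto
  have "max a (t - e) < t" using a e by auto
  then obtain q where q: "q \<in> \<rat>" "max a (t - e) < q" "q < t"
    using Rats_dense_in_real by blast
  then have "w q \<in> U" using e(2)[of q] a by auto
  with q show ?thesis by (intro bexI[of _ q]) auto
qed

lemma rational_time_before:
  fixes w :: "real \<Rightarrow> ereal"
  assumes w: "continuous_on {0..} w" and U: "open U" "w t \<in> U" and t: "0 \<le> t"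
  shows "\<exists>q\<in>\<rat>. 0 \<le> q \<and> q \<le> t \<and> w q \<in> U"
proof (cases "t = 0")
  case True
  then show ?thesis using U by (intro bexI[of _ 0]) auto
next
  case False
  then obtain q where "q \<in> \<rat>" "0 < q" "q < t" "w q \<in> U"
    using rational_time_after[OF w U, of 0] t by auto
  then show ?thesis by (intro bexI[of _ q]) auto
qed

lemma persists_after:
  fixes w :: "real \<Rightarrow> ereal"
  assumes w: "continuous_on {0..} w" and U: "open U" "w t \<in> U" and t: "0 \<le> t"
  shows "\<exists>e>0. \<forall>s. t \<le> s \<longrightarrow> s < t + e \<longrightarrow> w s \<in> U"
proof -
  obtain e where e: "e > 0" "\<And>s. 0 \<le> s \<Longrightarrow> \<bar>s - t\<bar> < e \<Longrightarrow> w s \<in> U"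
    using open_at_near_times[OF w U t] by auto
  then show ?thesis using t by (intro exI[of _ e] conjI allI impI e(2)) auto
qed

lemma open_add_less: "open {x::ereal. x + ereal d < c}"
proof -
  have "continuous_on UNIV (\<lambda>x::ereal. x + ereal d)"
    by (auto simp: continuous_on_def intro!: tendsto_cadd_ereal tendsto_ident_at)
  from open_vimage[OF open_lessThan[of c] this] show ?thesis by (simp add: vimage_def)
qed

lemma ereal_le_add_nonneg: "0 \<le> d \<Longrightarrow> (x::ereal) \<le> x + ereal d"
  by (cases x) auto

context
  fixes I :: "real set" and w :: "real \<Rightarrow> ereal"
  assumes w: "continuous_on {0..} w"
    and I: "I \<subseteq> {0..}" "\<And>s t. t \<in> I \<Longrightarrow> 0 \<le> s \<Longrightarrow> s \<le> t \<Longrightarrow> s \<in> I"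
begin

lemma time_nonneg: "s \<in> I \<Longrightarrow> 0 \<le> s"
  using I(1) by auto

text \<open>
A level \<open>c\<close> strictly between \<open>w s + \<delta>\<close> and \<open>w r\<close> separates the two conditions, so that the two times can
be moved independently; the second one stays to the right of \<open>r\<close>.
\<close>

lemma drop_at_rational_times:
  assumes d: "0 \<le> d" and s: "s \<in> I" "r \<in> I" "r \<le> s" "w s + ereal d < w r"
  shows "\<exists>s'\<in>\<rat> \<inter> I. \<exists>r'\<in>\<rat> \<inter> I. r' \<le> s' \<and> s' \<le> s \<and> w s' + ereal d < w r'"
proof -
  have "r \<noteq> s" using s ereal_le_add_nonneg[OF d, of "w s"] by auto
  with s have rs: "r < s" by simp
  obtain c where c: "w s + ereal d < c" "c < w r" using dense[OF s(4)] by blast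
  have r0: "0 \<le> r" using s I by auto
  obtain r' where r': "r' \<in> \<rat>" "0 \<le> r'" "r' \<le> r" "c < w r'"
    using rational_time_before[OF w open_greaterThan, of r c] c r0 by auto
  obtain s' where s': "s' \<in> \<rat>" "r < s'" "s' < s" "w s' + ereal d < c"
    using rational_time_after[OF w open_add_less[of d c], of s r] c r0 rs by auto
  have "w s' + ereal d < w r'" using s'(4) r'(4) by (rule less_trans)
  moreover have "s' \<in> I" using r0 s'(2,3) by (intro I(2)[OF s(1)]) auto
  moreover have "r' \<in> I" using r'(2,3) by (rule I(2)[OF s(2)])
  moreover have "r' \<le> s'" using r'(3) s'(2) by simp
  ultimately show ?thesis
    using r'(1) s'(1,3) by (intro bexI[of _ s'] bexI[of _ r'] conjI IntI) auto
qed

lemma drops_rational: "0 \<le> d \<Longrightarrow> drops (\<rat> \<inter> I) d w \<longleftrightarrow> drops I d w"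
  unfolding drops_def by (meson IntD2 drop_at_rational_times)

lemma rises_rational: "rises (\<rat> \<inter> I) y a w \<longleftrightarrow> rises I y a w"
proof
  assume "rises (\<rat> \<inter> I) y a w"
  then obtain t where t: "t \<in> \<rat>" "t \<in> I" "ereal y < w t"
      "\<And>s. s \<in> \<rat> \<Longrightarrow> s \<in> I \<Longrightarrow> s \<le> t \<Longrightarrow> ereal a \<le> w s"
    unfolding rises_def by blast
  have "ereal a \<le> w s" if s: "s \<in> I" "s \<le> t" for s
  proof (rule ccontr)
    assume "\<not> ereal a \<le> w s"
    then obtain q where "q \<in> \<rat>" "0 \<le> q" "q \<le> s" "w q < ereal a"
      using rational_time_before[OF w open_lessThan, of s "ereal a"] time_nonneg[OF s(1)] by (auto simp: not_le)
    then show False using t(4)[of q] I(2)[OF s(1), of q] s(2) by auto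
  qed
  with t show "rises I y a w" unfolding rises_def by blast
next
  assume "rises I y a w"
  then obtain t where t: "t \<in> I" "ereal y < w t" "\<And>s. s \<in> I \<Longrightarrow> s \<le> t \<Longrightarrow> ereal a \<le> w s"
    unfolding rises_def by blast
  then obtain q where "q \<in> \<rat>" "0 \<le> q" "q \<le> t" "ereal y < w q"
    using rational_time_before[OF w open_greaterThan, of t "ereal y"] I by auto
  then show "rises (\<rat> \<inter> I) y a w"
    unfolding rises_def using t I(2)[OF t(1), of q] by (intro bexI[of _ q]) auto
qed

text \<open>
Rational times suffice, since exceeding a level is an open condition and a violation of
\<open>max c (w r) \<le> w s + \<delta>\<close> is one too.
\<close>

lemma climbs_rational:
  assumes d: "0 \<le> d"
  shows "climbs (\<rat> \<inter> I) d c z w \<longleftrightarrow> climbs I d c z w"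
proof
  assume "climbs (\<rat> \<inter> I) d c z w"
  then obtain t where t: "t \<in> \<rat>" "t \<in> I" "ereal z < w t"
      "\<And>s r. s \<in> \<rat> \<inter> I \<Longrightarrow> r \<in> \<rat> \<inter> I \<Longrightarrow> r \<le> s \<Longrightarrow> s \<le> t \<Longrightarrow> max c (w r) \<le> w s + ereal d"
    unfolding climbs_def by blast
  have "max c (w r) \<le> w s + ereal d" if s: "s \<in> I" "r \<in> I" "r \<le> s" "s \<le> t" for s r
  proof (rule max.boundedI; rule ccontr)
    assume "\<not> c \<le> w s + ereal d"
    then obtain q where "q \<in> \<rat>" "0 \<le> q" "q \<le> s" "w q + ereal d < c"
      using rational_time_before[OF w open_add_less[of d c], of s] time_nonneg[OF s(1)] by (auto simp: not_le)
    then show False using t(4)[of q q] I(2)[OF s(1), of q] s(4) by auto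
  next
    assume "\<not> w r \<le> w s + ereal d"
    then obtain s' r' where "s' \<in> \<rat> \<inter> I" "r' \<in> \<rat> \<inter> I" "r' \<le> s'" "s' \<le> s" "w s' + ereal d < w r'"
      using drop_at_rational_times[OF d s(1,2,3)] unfolding not_le by blast
    then show False using t(4)[of s' r'] s(4) by auto
  qed
  with t show "climbs I d c z w" unfolding climbs_def by blast
next
  assume "climbs I d c z w"
  then obtain t where t: "t \<in> I" "ereal z < w t"
      "\<And>s r. s \<in> I \<Longrightarrow> r \<in> I \<Longrightarrow> r \<le> s \<Longrightarrow> s \<le> t \<Longrightarrow> max c (w r) \<le> w s + ereal d"
    unfolding climbs_def by blast
  then obtain q where "q \<in> \<rat>" "0 \<le> q" "q \<le> t" "ereal z < w q"
    using rational_time_before[OF w open_greaterThan, of t "ereal z"] I by auto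
  then show "climbs (\<rat> \<inter> I) d c z w"
    unfolding climbs_def using t I(2)[OF t(1), of q] by (intro bexI[of _ q]) auto
qed

end

lemmas sets_Collect_countable_times =
  sets.sets_Collect_countable_Ex' sets.sets_Collect_countable_All' sets.sets_Collect_conj
  sets.sets_Collect_imp sets.sets_Collect_const

lemma measurable_climbs:
  assumes Y: "\<And>t. t \<in> D \<Longrightarrow> Y t \<in> borel_measurable M" and c: "c \<in> borel_measurable M"
    and D: "countable D"
  shows "{x \<in> space M. climbs D d (c x) z (\<lambda>t. Y t x)} \<in> sets M"
proof -
  have "{x \<in> space M. ereal z < Y t x} \<in> sets M" if "t \<in> D" for t
    using borel_measurable_less[OF borel_measurable_const Y[OF that]] .
  moreover have "{x \<in> space M. max (c x) (Y r x) \<le> Y s x + ereal d} \<in> sets M"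
    if "r \<in> D" "s \<in> D" for r s
    by (intro borel_measurable_le borel_measurable_max borel_measurable_ereal_add c Y that
        borel_measurable_const)
  ultimately show ?thesis
    unfolding climbs_def by (intro sets_Collect_countable_times D) assumption+
qed

lemma measurable_drops:
  assumes Y: "\<And>t. t \<in> D \<Longrightarrow> Y t \<in> borel_measurable M" and D: "countable D"
  shows "{x \<in> space M. drops D d (\<lambda>t. Y t x)} \<in> sets M"
proof -
  have "{x \<in> space M. Y s x + ereal d < Y r x} \<in> sets M" if "r \<in> D" "s \<in> D" for r s
    by (intro borel_measurable_less borel_measurable_ereal_add Y that borel_measurable_const)
  then show ?thesis
    unfolding drops_def by (intro sets_Collect_countable_times D) assumption+
qed

lemma measurable_rises:
  assumes Y: "\<And>t. t \<in> D \<Longrightarrow> Y t \<in> borel_measurable M" and D: "countable D"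
  shows "{x \<in> space M. rises D y a (\<lambda>t. Y t x)} \<in> sets M"
proof -
  have "{x \<in> space M. ereal y < Y t x} \<in> sets M" "{x \<in> space M. ereal a \<le> Y t x} \<in> sets M"
    if "t \<in> D" for t
    by (intro borel_measurable_less borel_measurable_le Y that borel_measurable_const)+
  then show ?thesis
    unfolding rises_def by (intro sets_Collect_countable_times D) assumption+
qed

section \<open>The drawdown time of a single path\<close>

context regular_diffusion
begin

abbreviation path :: "'w \<Rightarrow> real \<Rightarrow> ereal" where "path \<omega> \<equiv> (\<lambda>t. X t \<omega>)"

text \<open>
A value below the supremum of the past is below a single past value, so a drawdown is witnessed by two
times, and these can be taken rational.
\<close>

lemma drawdown_time_less_iff:
  assumes t: "0 \<le> t"
  shows "drawdown_time X \<delta> \<omega> < ennreal t \<longleftrightarrow> drops {0..<t} \<delta> (path \<omega>)"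
proof -
  have "drawdown_time X \<delta> \<omega> < ennreal t \<longleftrightarrow>
      (\<exists>s. 0 \<le> s \<and> s < t \<and> X s \<omega> + ereal \<delta> < running_max X s \<omega>)"
    unfolding drawdown_time_def Inf_less_iff by (auto simp: ennreal_less_iff)
  also have "\<dots> \<longleftrightarrow> drops {0..<t} \<delta> (path \<omega>)"
    unfolding drops_def running_max_def less_SUP_iff by (force simp: Bex_def)
  finally show ?thesis .
qed

lemma drawdown_time_finite_iff: "drawdown_time X \<delta> \<omega> < \<infinity> \<longleftrightarrow> drops {0..} \<delta> (path \<omega>)"
proof -
  have "drawdown_time X \<delta> \<omega> < \<infinity> \<longleftrightarrow>
      (\<exists>s. 0 \<le> s \<and> X s \<omega> + ereal \<delta> < running_max X s \<omega>)"
    unfolding drawdown_time_def Inf_less_iff by auto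
  also have "\<dots> \<longleftrightarrow> drops {0..} \<delta> (path \<omega>)"
    unfolding drops_def running_max_def less_SUP_iff by (force simp: Bex_def)
  finally show ?thesis .
qed

context
  fixes \<omega> :: 'w and \<delta> T M :: real
  assumes \<omega>: "\<omega> \<in> space N" and \<delta>: "0 < \<delta>" and finite: "drawdown_time X \<delta> \<omega> < \<infinity>"
  defines "T \<equiv> enn2real (drawdown_time X \<delta> \<omega>)" and "M \<equiv> max_at_drawdown X \<delta> \<omega>"
begin

lemma drawdown_time_eq: "drawdown_time X \<delta> \<omega> = ennreal T" "0 \<le> T"
  using finite by (auto simp: T_def less_top)

lemma no_drop_until_drawdown_time:
  assumes "0 \<le> r" "r \<le> s" "s \<le> T"
  shows "X r \<omega> \<le> X s \<omega> + ereal \<delta>"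
proof (rule ccontr)
  assume "\<not> X r \<omega> \<le> X s \<omega> + ereal \<delta>"
  then have drop: "X s \<omega> + ereal \<delta> < X r \<omega>" by simp
  then have "r \<noteq> s" using ereal_le_add_nonneg[of \<delta> "X s \<omega>"] \<delta> by auto
  then have "r < s" using assms by simp
  then obtain q where q: "r < q" "q < s" "X q \<omega> + ereal \<delta> < X r \<omega>"
    using rational_time_after[OF continuous_paths[OF \<omega>] open_add_less, of s \<delta> "X r \<omega>" r] drop assms(1)
    by auto
  then have "drops {0..<T} \<delta> (path \<omega>)"
    unfolding drops_def using assms by (intro bexI[of _ q] bexI[of _ r]) auto
  then show False
    using drawdown_time_less_iff[OF drawdown_time_eq(2), of \<delta> \<omega>] drawdown_time_eq(1) by simp
qed

lemma drop_soon_after_drawdown_time: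
  assumes "0 < e"
  shows "\<exists>s r. T \<le> s \<and> s < T + e \<and> 0 \<le> r \<and> r \<le> s \<and> X s \<omega> + ereal \<delta> < X r \<omega>"
proof -
  have "drawdown_time X \<delta> \<omega> < ennreal (T + e)"
    unfolding drawdown_time_eq(1) by (intro ennreal_lessI) (use assms drawdown_time_eq(2) in auto)
  then have "drops {0..<T + e} \<delta> (path \<omega>)"
    by (rule iffD1[OF drawdown_time_less_iff, rotated]) (use assms drawdown_time_eq(2) in auto)
  then obtain s r where s: "0 \<le> s" "s < T + e" "0 \<le> r" "r \<le> s" "X s \<omega> + ereal \<delta> < X r \<omega>"
    unfolding drops_def by auto
  moreover have "T \<le> s"
    using no_drop_until_drawdown_time[of r s] s by force
  ultimately show ?thesis by auto
qed

text \<open>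
Both values are finite: a path at an infinite end point stays there and shows no drawdown later, but
there are drawdowns at times arbitrarily close to \<open>T\<close>.  The drawdown at \<open>T\<close> is at most \<open>\<delta>\<close>
because none exceeding \<open>\<delta>\<close> occurred before, and it is not smaller because then, by continuity, none
could occur shortly after \<open>T\<close>.
\<close>

lemma at_drawdown_time: "running_max X T \<omega> = ereal M" "X T \<omega> = ereal (M - \<delta>)"
proof -
  note w = continuous_paths[OF \<omega>]
  have T: "0 \<le> T" by (rule drawdown_time_eq)
  obtain s r where s: "T \<le> s" "0 \<le> r" "r \<le> s" "X s \<omega> + ereal \<delta> < X r \<omega>"
    using drop_soon_after_drawdown_time[of 1] by auto
  have le: "running_max X T \<omega> \<le> X T \<omega> + ereal \<delta>"
    unfolding running_max_def using no_drop_until_drawdown_time by (intro SUP_least) auto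
  have ge: "X q \<omega> \<le> running_max X T \<omega>" if "0 \<le> q" "q \<le> T" for q
    unfolding running_max_def using that by (intro SUP_upper) auto
  have "X T \<omega> \<noteq> \<infinity>"
  proof
    assume "X T \<omega> = \<infinity>"
    then have "X s \<omega> = \<infinity>" using trapped[OF \<omega> T s(1)] by simp
    with s show False by auto
  qed
  moreover have "X T \<omega> \<noteq> - \<infinity>"
  proof
    assume inf: "X T \<omega> = - \<infinity>"
    have early: "X q \<omega> = - \<infinity>" if "0 \<le> q" "q \<le> T" for q
      using ge[OF that] le inf by simp
    have "X q \<omega> = - \<infinity>" if "0 \<le> q" for q
      using early[of 0] trapped[OF \<omega> _ that] T by force
    with s show False by auto
  qed
  ultimately obtain x where x: "X T \<omega> = ereal x" by (cases "X T \<omega>") auto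
  have "running_max X T \<omega> \<noteq> \<infinity>" "running_max X T \<omega> \<noteq> - \<infinity>"
    using le ge[of T] T x by auto
  then obtain y where y: "running_max X T \<omega> = ereal y" by (cases "running_max X T \<omega>") auto
  have M: "M = y" unfolding M_def max_at_drawdown_def T_def[symmetric] y by simp
  have "\<not> y < x + \<delta>"
  proof
    assume "y < x + \<delta>"
    \<comment> \<open>The level c separates the maximum from x + \<delta>; shortly after T the path stays below c and
      above c - \<delta>, which leaves no room for a drawdown larger than \<delta>.\<close>
    define c where "c = (y + x + \<delta>) / 2"
    have c: "y < c" "c < x + \<delta>" using \<open>y < x + \<delta>\<close> by (auto simp: c_def)
    have near: "X T \<omega> \<in> {..<ereal c} \<inter> {ereal (c - \<delta>)<..}"
      using c x ge[of T] y T by (auto simp: less_diff_eq diff_less_eq)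
    then obtain e where e: "e > 0" "\<And>s. T \<le> s \<Longrightarrow> s < T + e \<Longrightarrow> X s \<omega> < ereal c \<and> ereal (c - \<delta>) < X s \<omega>"
      using persists_after[OF w open_Int[OF open_lessThan open_greaterThan] near T] by auto
    obtain s r where s: "T \<le> s" "s < T + e" "0 \<le> r" "r \<le> s" "X s \<omega> + ereal \<delta> < X r \<omega>"
      using drop_soon_after_drawdown_time[OF e(1)] by auto
    have "X r \<omega> < ereal c"
    proof (cases "r \<le> T")
      case True
      then have "X r \<omega> \<le> ereal y" using ge[of r] s y by simp
      then show ?thesis using c by (simp add: le_less_trans)
    next
      case False
      then show ?thesis using e(2)[of r] s by auto
    qed
    moreover have "ereal (c - \<delta>) < X s \<omega>" using e(2)[of s] s by auto
    ultimately show False using s(5) by (cases "X s \<omega>"; cases "X r \<omega>") auto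
  qed
  then have "y = x + \<delta>" using le x y by auto
  then show "running_max X T \<omega> = ereal M" "X T \<omega> = ereal (M - \<delta>)" using x y M by auto
qed

lemma le_max_at_drawdown: "0 \<le> s \<Longrightarrow> s \<le> T \<Longrightarrow> X s \<omega> \<le> ereal M"
  unfolding at_drawdown_time(1)[symmetric] running_max_def by (intro SUP_upper) auto

lemma less_max_at_drawdownD:
  assumes "z < M"
  shows "\<exists>t. 0 \<le> t \<and> t \<le> T \<and> ereal z < X t \<omega>"
proof -
  have "ereal z < running_max X T \<omega>" using assms at_drawdown_time(1) by simp
  then show ?thesis unfolding running_max_def less_SUP_iff by auto
qed

text \<open>
A path that exceeds \<open>z\<close> before any drawdown does so before \<open>T\<close>, hence its maximum at \<open>T\<close> is
larger than \<open>z\<close>.  The right-hand side no longer mentions the random time.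
\<close>

lemma less_max_at_drawdown_iff: "z < M \<longleftrightarrow> climbs {0..} \<delta> (- \<infinity>) z (path \<omega>)"
proof
  assume "z < M"
  then obtain t where "0 \<le> t" "t \<le> T" "ereal z < X t \<omega>" using less_max_at_drawdownD by blast
  then show "climbs {0..} \<delta> (- \<infinity>) z (path \<omega>)"
    unfolding climbs_def using no_drop_until_drawdown_time
    by (intro bexI[of _ t] conjI ballI impI) auto
next
  assume "climbs {0..} \<delta> (- \<infinity>) z (path \<omega>)"
  then obtain t where t: "0 \<le> t" "ereal z < X t \<omega>"
      "\<And>s r. 0 \<le> r \<Longrightarrow> r \<le> s \<Longrightarrow> s \<le> t \<Longrightarrow> X r \<omega> \<le> X s \<omega> + ereal \<delta>"
    unfolding climbs_def by (auto simp: max_def)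
  have "t \<le> T"
  proof (rule ccontr)
    assume "\<not> t \<le> T"
    then obtain s r where s: "T \<le> s" "s < T + (t - T)" "0 \<le> r" "r \<le> s" "X s \<omega> + ereal \<delta> < X r \<omega>"
      using drop_soon_after_drawdown_time[of "t - T"] by auto
    have "X r \<omega> \<le> X s \<omega> + ereal \<delta>" using s by (intro t) auto
    with s(5) show False by simp
  qed
  then have "ereal z < ereal M" using le_max_at_drawdown[of t] t by (metis less_le_trans)
  then show "z < M" by simp
qed

end

lemma path_from_apply [simp]: "0 \<le> t \<Longrightarrow> path_from X s \<omega> t = X (s + t) \<omega>"
  by (simp add: path_from_def)

lemma continuous_path_from:
  assumes "\<omega> \<in> space N" "0 \<le> s"
  shows "continuous_on {0..} (path_from X s \<omega>)"
proof -
  have "continuous_on {0..} (path \<omega> \<circ> (\<lambda>t. s + t))"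
    using assms by (intro continuous_on_compose continuous_on_subset[OF continuous_paths] continuous_intros) auto
  then show ?thesis by (rule continuous_on_eq) auto
qed

text \<open>
The maximum \<open>y\<close> at the earlier drawdown time is carried into the later path as the floor.  If
\<open>z < y\<close> nothing remains to be climbed.
\<close>

lemma less_later_max_iff:
  assumes \<omega>: "\<omega> \<in> space N" and \<rho>: "0 < \<rho>" "\<rho> \<le> \<delta>"
    and fin: "drawdown_time X \<rho> \<omega> < \<infinity>" "drawdown_time X \<delta> \<omega> < \<infinity>"
  defines "T \<equiv> enn2real (drawdown_time X \<rho> \<omega>)" and "y \<equiv> max_at_drawdown X \<rho> \<omega>"
  shows "z < max_at_drawdown X \<delta> \<omega> \<longleftrightarrow>
    z < y \<or> climbs {0..} \<delta> (ereal y) z (path_from X T \<omega>)"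
proof -
  have \<delta>: "0 < \<delta>" using \<rho> by simp
  note no_drop = no_drop_until_drawdown_time[OF \<omega> \<rho>(1) fin(1), folded T_def]
  note below = le_max_at_drawdown[OF \<omega> \<rho>(1) fin(1), folded T_def y_def]
  have T: "0 \<le> T" unfolding T_def by simp
  have no_drop': "X r \<omega> \<le> X s \<omega> + ereal \<delta>" if "0 \<le> r" "r \<le> s" "s \<le> T" for r s
    using no_drop[OF that] \<rho>(2) by (meson add_left_mono ereal_less_eq(3) order_trans)
  show ?thesis
    unfolding less_max_at_drawdown_iff[OF \<omega> \<delta> fin(2)]
  proof
    assume "climbs {0..} \<delta> (- \<infinity>) z (path \<omega>)"
    then obtain t where t: "0 \<le> t" "ereal z < X t \<omega>"
        "\<And>s r. 0 \<le> r \<Longrightarrow> r \<le> s \<Longrightarrow> s \<le> t \<Longrightarrow> X r \<omega> \<le> X s \<omega> + ereal \<delta>"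
      unfolding climbs_def by (auto simp: max_def)
    show "z < y \<or> climbs {0..} \<delta> (ereal y) z (path_from X T \<omega>)"
    proof (cases "z < y")
      case False
      have "T < t"
      proof (rule ccontr)
        assume "\<not> T < t"
        then have "X t \<omega> \<le> ereal y" using below[of t] t by auto
        with t(2) have "ereal z < ereal y" by (rule less_le_trans)
        with False show False by simp
      qed
      have "ereal y \<le> X (T + s) \<omega> + ereal \<delta>" if "0 \<le> s" "s \<le> t - T" for s
        unfolding y_def at_drawdown_time(1)[OF \<omega> \<rho>(1) fin(1), symmetric] running_max_def
        using that T by (intro SUP_least t) (auto simp: T_def)
      then have "climbs {0..} \<delta> (ereal y) z (path_from X T \<omega>)"
        unfolding climbs_def using \<open>T < t\<close> T t
        by (intro bexI[of _ "t - T"] conjI ballI impI max.boundedI) auto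
      then show ?thesis by simp
    qed simp
  next
    assume "z < y \<or> climbs {0..} \<delta> (ereal y) z (path_from X T \<omega>)"
    then show "climbs {0..} \<delta> (- \<infinity>) z (path \<omega>)"
    proof (cases "z < y")
      case True
      then obtain t where "0 \<le> t" "t \<le> T" "ereal z < X t \<omega>"
        using less_max_at_drawdownD[OF \<omega> \<rho>(1) fin(1)] unfolding y_def T_def by blast
      then show ?thesis
        unfolding climbs_def using no_drop' by (intro bexI[of _ t] conjI ballI impI) auto
    next
      case False
      assume "z < y \<or> climbs {0..} \<delta> (ereal y) z (path_from X T \<omega>)"
      with False obtain t where t: "0 \<le> t" "ereal z < path_from X T \<omega> t"
          and c: "\<And>s r. 0 \<le> r \<Longrightarrow> r \<le> s \<Longrightarrow> s \<le> t \<Longrightarrow>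
            max (ereal y) (path_from X T \<omega> r) \<le> path_from X T \<omega> s + ereal \<delta>"
        unfolding climbs_def by auto
      have "X r \<omega> \<le> X s \<omega> + ereal \<delta>" if rs: "0 \<le> r" "r \<le> s" "s \<le> T + t" for s r
      proof (cases "s \<le> T")
        case True
        then show ?thesis using no_drop' rs by simp
      next
        case s: False
        show ?thesis
        proof (cases "r \<le> T")
          case True
          have "X r \<omega> \<le> ereal y" using True rs below by simp
          also have "ereal y \<le> X s \<omega> + ereal \<delta>" using c[of "s - T" "s - T"] s rs by simp
          finally show ?thesis .
        next
          case False
          then show ?thesis using c[of "r - T" "s - T"] s rs by simp
        qed
      qed
      then show ?thesis
        unfolding climbs_def using t T by (intro bexI[of _ "T + t"] conjI ballI impI) auto
    qed
  qed
qed

end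

section \<open>Passage above a level and hitting probabilities\<close>

context regular_diffusion
begin

lemma prob_space_P: "prob_space (P x)"
  and sets_P [simp, measurable_cong]: "sets (P x) = sets N"
  and space_P [simp]: "space (P x) = space N"
proof -
  have "P x \<in> space (prob_algebra N)" using measurable_space[OF kernel] by simp
  then show "prob_space (P x)" "sets (P x) = sets N"
    by (auto simp: space_prob_algebra)
  then show "space (P x) = space N" by (auto dest: sets_eq_imp_space_eq)
qed

lemma AE_P_I: "(\<And>\<omega>. \<omega> \<in> space N \<Longrightarrow> X 0 \<omega> = ereal x \<Longrightarrow> Pr \<omega>) \<Longrightarrow> AE \<omega> in P x. Pr \<omega>"
  using start[of x] AE_space[of "P x"] by eventually_elim auto

lemma sets_history: "sets (history N X T) = sigma_sets (space N) {X s -` B \<inter> space N | s B. s \<in> T \<and> B \<in> sets borel}"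
  unfolding history_def by (rule sets_measure_of) auto

lemma space_history [simp]: "space (history N X T) = space N"
  unfolding history_def by (rule space_measure_of) auto

lemma measurable_history: "s \<in> T \<Longrightarrow> X s \<in> borel_measurable (history N X T)"
  by (rule measurableI) (auto simp: sets_history)

lemma sets_history_subset:
  assumes T: "T \<subseteq> {0..}" shows "sets (history N X T) \<subseteq> sets N"
  unfolding sets_history
proof (intro sets.sigma_sets_subset subsetI)
  fix A assume "A \<in> {X s -` B \<inter> space N | s B. s \<in> T \<and> B \<in> sets borel}"
  then obtain s B where A: "A = X s -` B \<inter> space N" "s \<in> T" "B \<in> sets borel" by blast
  then have "0 \<le> s" using T by auto
  then show "A \<in> sets N" unfolding A(1) by (rule measurable_sets[OF measurable_X A(3)])
qed

lemma sigma_at_generator: "{A \<in> sets (history N X {0..}). R A} \<subseteq> Pow (space N)"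
proof
  fix A assume "A \<in> {A \<in> sets (history N X {0..}). R A}"
  then have "A \<in> sets (history N X {0..})" by simp
  then show "A \<in> Pow (space N)" using sets.sets_into_space[of A "history N X {0..}"] by simp
qed

lemma sets_sigma_at: "sets (sigma_at N X \<tau>) = sigma_sets (space N)
     {A \<in> sets (history N X {0..}).
        \<forall>t\<ge>0. {\<omega> \<in> A. \<tau> \<omega> < ennreal t} \<in> sets (history N X {0..t})}"
  unfolding sigma_at_def by (rule sets_measure_of) (rule sigma_at_generator)

lemma space_sigma_at [simp]: "space (sigma_at N X \<tau>) = space N"
  unfolding sigma_at_def by (rule space_measure_of) (rule sigma_at_generator)

text \<open>
The conditions on \<open>A\<close> are those on the generating sets of the \<open>\<sigma>\<close>-algebra at \<open>\<tau>\<close>.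
\<close>

lemma sigma_at_I:
  assumes "A \<in> sets (history N X {0..})"
    and "\<And>t. 0 \<le> t \<Longrightarrow> {\<omega> \<in> A. \<tau> \<omega> < ennreal t} \<in> sets (history N X {0..t})"
  shows "A \<in> sets (sigma_at N X \<tau>)"
  unfolding sets_sigma_at by (intro sigma_sets.Basic CollectI conjI allI impI assms)

lemma sets_sigma_at_subset: "sets (sigma_at N X \<tau>) \<subseteq> sets N"
  unfolding sets_sigma_at
  by (intro sets.sigma_sets_subset subset_trans[OF Collect_restrict sets_history_subset]) simp

lemma countable_rational_times: "countable (\<rat> \<inter> I :: real set)"
  by (rule countable_Int1[OF countable_rat])

lemma climbs_history:
  assumes "I \<subseteq> {0..}" "\<And>s t. t \<in> I \<Longrightarrow> 0 \<le> s \<Longrightarrow> s \<le> t \<Longrightarrow> s \<in> I" "I \<subseteq> T" "0 \<le> d"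
  shows "{\<omega> \<in> space N. climbs I d c z (path \<omega>)} \<in> sets (history N X T)"
proof -
  have eq: "climbs I d c z (path \<omega>) = climbs (\<rat> \<inter> I) d c z (path \<omega>)" if "\<omega> \<in> space N" for \<omega>
    by (rule climbs_rational[symmetric, OF continuous_paths[OF that] assms(1) _ assms(4)]) (rule assms(2))
  have "{\<omega> \<in> space N. climbs I d c z (path \<omega>)} = {\<omega> \<in> space N. climbs (\<rat> \<inter> I) d c z (path \<omega>)}"
    by (rule Collect_cong) (use eq in blast)
  then show ?thesis
    using measurable_climbs[of "\<rat> \<inter> I" X "history N X T" "\<lambda>_. c" d z] countable_rational_times assms(3)
    by (auto intro: measurable_history)
qed

lemma rises_history:
  assumes "I \<subseteq> {0..}" "\<And>s t. t \<in> I \<Longrightarrow> 0 \<le> s \<Longrightarrow> s \<le> t \<Longrightarrow> s \<in> I" "I \<subseteq> T"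
  shows "{\<omega> \<in> space N. rises I y a (path \<omega>)} \<in> sets (history N X T)"
proof -
  have eq: "rises I y a (path \<omega>) = rises (\<rat> \<inter> I) y a (path \<omega>)" if "\<omega> \<in> space N" for \<omega>
    by (rule rises_rational[symmetric, OF continuous_paths[OF that] assms(1)]) (rule assms(2))
  have "{\<omega> \<in> space N. rises I y a (path \<omega>)} = {\<omega> \<in> space N. rises (\<rat> \<inter> I) y a (path \<omega>)}"
    by (rule Collect_cong) (use eq in blast)
  then show ?thesis
    using measurable_rises[of "\<rat> \<inter> I" X "history N X T" y a] countable_rational_times assms(3)
    by (auto intro: measurable_history)
qed

lemma drops_history:
  assumes "I \<subseteq> {0..}" "\<And>s t. t \<in> I \<Longrightarrow> 0 \<le> s \<Longrightarrow> s \<le> t \<Longrightarrow> s \<in> I" "I \<subseteq> T" "0 \<le> d"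
  shows "{\<omega> \<in> space N. drops I d (path \<omega>)} \<in> sets (history N X T)"
proof -
  have eq: "drops I d (path \<omega>) = drops (\<rat> \<inter> I) d (path \<omega>)" if "\<omega> \<in> space N" for \<omega>
    by (rule drops_rational[symmetric, OF continuous_paths[OF that] assms(1) _ assms(4)]) (rule assms(2))
  have "{\<omega> \<in> space N. drops I d (path \<omega>)} = {\<omega> \<in> space N. drops (\<rat> \<inter> I) d (path \<omega>)}"
    by (rule Collect_cong) (use eq in blast)
  then show ?thesis
    using measurable_drops[of "\<rat> \<inter> I" X "history N X T" d] countable_rational_times assms(3)
    by (auto intro: measurable_history)
qed

lemma sets_N_path_events:
  shows climbs_sets: "0 \<le> d \<Longrightarrow> {\<omega> \<in> space N. climbs {0..} d c z (path \<omega>)} \<in> sets N"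
    and rises_sets: "{\<omega> \<in> space N. rises {0..} y a (path \<omega>)} \<in> sets N"
    and drops_sets: "0 \<le> d \<Longrightarrow> {\<omega> \<in> space N. drops {0..} d (path \<omega>)} \<in> sets N"
  using sets_history_subset[of "{0..}"] climbs_history[of "{0..}" "{0..}"]
    rises_history[of "{0..}" "{0..}"] drops_history[of "{0..}" "{0..}"] by auto

lemma borel_measurable_markov_time:
  assumes "markov_time N X \<tau>"
  shows "\<tau> \<in> borel_measurable N"
proof (rule borel_measurableI_less)
  have less: "{\<omega> \<in> space N. \<tau> \<omega> < ennreal t} \<in> sets N" if "0 \<le> t" for t
    using assms that sets_history_subset[of "{0..t}"] unfolding markov_time_def by auto
  fix c
  show "{\<omega> \<in> space N. \<tau> \<omega> < c} \<in> sets N"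
  proof (cases c)
    case (real t)
    then show ?thesis using less by simp
  next
    case top
    have "{\<omega> \<in> space N. \<tau> \<omega> < top} = (\<Union>n::nat. {\<omega> \<in> space N. \<tau> \<omega> < ennreal (real n)})"
      using ennreal_Ex_less_of_nat[of "\<tau> _"]
      by (auto simp: ennreal_of_nat_eq_real_of_nat intro: less_trans[OF _ ennreal_less_top])
    then show ?thesis using less top by auto
  qed
qed

text \<open>
Rounding \<open>\<sigma>\<close> up to multiples of \<open>1 / 2 ^ n\<close> gives random times with countably many values, and
by continuity the values of the path converge.
\<close>

lemma measurable_at_random_time:
  assumes \<sigma>: "\<sigma> \<in> borel_measurable N" "\<And>\<omega>. 0 \<le> \<sigma> \<omega>"
  shows "(\<lambda>\<omega>. X (\<sigma> \<omega>) \<omega>) \<in> borel_measurable N"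
proof -
  define \<sigma>' where "\<sigma>' n \<omega> = real (nat \<lceil>\<sigma> \<omega> * 2 ^ n\<rceil>) / 2 ^ n" for n :: nat and \<omega>
  have "(\<lambda>\<omega>. limsup (\<lambda>n. X (\<sigma>' n \<omega>) \<omega>)) \<in> borel_measurable N"
  proof (rule borel_measurable_limsup)
    fix n
    note [measurable] = \<sigma>(1)
    show "(\<lambda>\<omega>. X (\<sigma>' n \<omega>) \<omega>) \<in> borel_measurable N"
      unfolding \<sigma>'_def
      by (rule measurable_compose_countable[where g = "\<lambda>\<omega>. nat \<lceil>\<sigma> \<omega> * 2 ^ n\<rceil>"])
         (auto intro: measurable_X)
  qed
  also have "?this \<longleftrightarrow> ?thesis"
  proof (rule measurable_cong)
    fix \<omega> assume \<omega>: "\<omega> \<in> space N"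
    have "(\<lambda>n. \<sigma>' n \<omega>) \<longlonglongrightarrow> \<sigma> \<omega>"
    proof (rule tendsto_sandwich[of "\<lambda>_. \<sigma> \<omega>" _ _ "\<lambda>n. \<sigma> \<omega> + 1 / 2 ^ n"])
      have r: "\<sigma> \<omega> * 2 ^ n \<le> real (nat \<lceil>\<sigma> \<omega> * 2 ^ n\<rceil>)" "real (nat \<lceil>\<sigma> \<omega> * 2 ^ n\<rceil>) \<le> \<sigma> \<omega> * 2 ^ n + 1" for n :: nat
        using \<sigma>(2)[of \<omega>] by (auto simp: real_nat_ceiling_ge)
      show "eventually (\<lambda>n. \<sigma> \<omega> \<le> \<sigma>' n \<omega>) sequentially"
        "eventually (\<lambda>n. \<sigma>' n \<omega> \<le> \<sigma> \<omega> + 1 / 2 ^ n) sequentially"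
        using r by (auto simp: \<sigma>'_def field_simps intro!: always_eventually)
      have "(\<lambda>n. \<sigma> \<omega> + (1 / 2) ^ n) \<longlonglongrightarrow> \<sigma> \<omega> + 0"
        by (intro tendsto_intros LIMSEQ_power_zero) auto
      then show "(\<lambda>n. \<sigma> \<omega> + 1 / 2 ^ n) \<longlonglongrightarrow> \<sigma> \<omega>" by (simp add: power_one_over)
    qed auto
    moreover have "0 \<le> \<sigma>' n \<omega>" for n by (simp add: \<sigma>'_def del: of_nat_nat)
    ultimately have "(\<lambda>n. X (\<sigma>' n \<omega>) \<omega>) \<longlonglongrightarrow> X (\<sigma> \<omega>) \<omega>"
      using \<sigma>(2)[of \<omega>]
      by (intro continuous_on_tendsto_compose[OF continuous_paths[OF \<omega>]]) auto
    then show "limsup (\<lambda>n. X (\<sigma>' n \<omega>) \<omega>) = X (\<sigma> \<omega>) \<omega>"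
      by (intro lim_imp_Limsup) auto
  qed
  finally show ?thesis .
qed

lemma measurable_path_from:
  assumes "\<tau> \<in> borel_measurable N"
  shows "(\<lambda>\<omega>. path_from X (enn2real (\<tau> \<omega>)) \<omega>) \<in> N \<rightarrow>\<^sub>M Pi\<^sub>M {0..} (\<lambda>_. borel)"
  unfolding path_from_def using assms
  by (intro measurable_restrict measurable_at_random_time) auto

text \<open>
The first time above \<open>y\<close>, rather than the hitting time of \<open>y\<close>: the half line is open, so passage
before time \<open>t\<close> is seen at a rational time before \<open>t\<close>.
\<close>

definition passage_time :: "real \<Rightarrow> 'w \<Rightarrow> ennreal" where
  "passage_time y \<omega> = Inf (ennreal ` {t. 0 \<le> t \<and> ereal y < X t \<omega>})"

lemma passage_time_less_iff:
  "0 \<le> t \<Longrightarrow> passage_time y \<omega> < ennreal t \<longleftrightarrow> (\<exists>s. 0 \<le> s \<and> s < t \<and> ereal y < X s \<omega>)"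
  unfolding passage_time_def Inf_less_iff by (auto simp: ennreal_less_iff)

lemma passage_time_finite_iff:
  "passage_time y \<omega> < \<infinity> \<longleftrightarrow> (\<exists>s. 0 \<le> s \<and> ereal y < X s \<omega>)"
  unfolding passage_time_def Inf_less_iff by auto

lemma passage_time_le: "0 \<le> s \<Longrightarrow> ereal y < X s \<omega> \<Longrightarrow> enn2real (passage_time y \<omega>) \<le> s"
  unfolding passage_time_def by (intro enn2real_leI INF_lower) auto

lemma below_until_passage:
  assumes \<omega>: "\<omega> \<in> space N" and x: "X 0 \<omega> \<le> ereal y" and fin: "passage_time y \<omega> < \<infinity>"
    and s: "0 \<le> s" "s \<le> enn2real (passage_time y \<omega>)"
  shows "X s \<omega> \<le> ereal y"
proof (rule ccontr)
  assume "\<not> X s \<omega> \<le> ereal y"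
  then have less: "ereal y < X s \<omega>" by simp
  then have "0 < s" using x s by (cases "s = 0") auto
  obtain q where q: "0 < q" "q < s" "ereal y < X q \<omega>"
    using rational_time_after[OF continuous_paths[OF \<omega>] open_greaterThan, of s "ereal y" 0] less \<open>0 < s\<close> by auto
  then show False using passage_time_le[of q y \<omega>] s by auto
qed

lemma at_passage:
  assumes \<omega>: "\<omega> \<in> space N" and x: "X 0 \<omega> \<le> ereal y" and fin: "passage_time y \<omega> < \<infinity>"
  shows "X (enn2real (passage_time y \<omega>)) \<omega> = ereal y"
proof (rule antisym)
  let ?T = "enn2real (passage_time y \<omega>)"
  show "X ?T \<omega> \<le> ereal y" by (rule below_until_passage[OF assms]) auto
  show "ereal y \<le> X ?T \<omega>"
  proof (rule ccontr)
    assume "\<not> ereal y \<le> X ?T \<omega>"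
    then obtain e where e: "e > 0" "\<And>s. ?T \<le> s \<Longrightarrow> s < ?T + e \<Longrightarrow> X s \<omega> < ereal y"
      using persists_after[OF continuous_paths[OF \<omega>] open_lessThan, of ?T "ereal y"]
      by (auto simp: not_le)
    have "passage_time y \<omega> < ennreal (?T + e)"
    proof -
      have "passage_time y \<omega> = ennreal ?T" using fin by (simp add: less_top)
      also have "\<dots> < ennreal (?T + e)" using e(1) by (intro ennreal_lessI) (auto intro: add_nonneg_pos)
      finally show ?thesis .
    qed
    then obtain s where s: "0 \<le> s" "s < ?T + e" "ereal y < X s \<omega>"
      using passage_time_less_iff[of "?T + e" y \<omega>] e(1) by (auto intro: add_nonneg_nonneg)
    then show False using passage_time_le[of s y \<omega>] e(2)[of s] by auto
  qed
qed

lemma markov_time_passage: "markov_time N X (passage_time y)"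
  unfolding markov_time_def
proof (intro allI impI)
  fix t :: real assume t: "0 \<le> t"
  have "{\<omega> \<in> space N. passage_time y \<omega> < ennreal t} =
        {\<omega> \<in> space N. \<exists>s\<in>\<rat> \<inter> {0..<t}. ereal y < X s \<omega>}"
  proof (intro Collect_cong conj_cong refl)
    fix \<omega> assume \<omega>: "\<omega> \<in> space N"
    show "passage_time y \<omega> < ennreal t \<longleftrightarrow> (\<exists>s\<in>\<rat> \<inter> {0..<t}. ereal y < X s \<omega>)"
    proof
      assume "passage_time y \<omega> < ennreal t"
      then obtain s where s: "0 \<le> s" "s < t" "ereal y < X s \<omega>"
        using passage_time_less_iff[OF t] by auto
      then obtain q where "q \<in> \<rat>" "0 \<le> q" "q \<le> s" "ereal y < X q \<omega>"
        using rational_time_before[OF continuous_paths[OF \<omega>] open_greaterThan, of s "ereal y"] by auto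
      with s show "\<exists>s\<in>\<rat> \<inter> {0..<t}. ereal y < X s \<omega>" by (intro bexI[of _ q]) auto
    qed (use passage_time_less_iff[OF t] in auto)
  qed
  also have "\<dots> \<in> sets (history N X {0..t})"
  proof -
    have "{\<omega> \<in> space (history N X {0..t}). ereal y < X s \<omega>} \<in> sets (history N X {0..t})"
      if "s \<in> \<rat> \<inter> {0..<t}" for s
      using that by (intro borel_measurable_less borel_measurable_const measurable_history) auto
    from sets.sets_Collect_countable_Ex'[OF this countable_rational_times] show ?thesis by simp
  qed
  finally show "{\<omega> \<in> space N. passage_time y \<omega> < ennreal t} \<in> sets (history N X {0..t})" .
qed

text \<open>
If the level is exceeded before \<open>t\<close> and also at the end of a stretch without a value below \<open>a\<close>,
the earlier of the two times ends such a stretch before \<open>t\<close>.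
\<close>

lemma rises_before_iff:
  assumes t: "0 \<le> t"
  shows "rises {0..<t} y a (path \<omega>) \<longleftrightarrow> rises {0..} y a (path \<omega>) \<and> passage_time y \<omega> < ennreal t"
proof
  assume "rises {0..<t} y a (path \<omega>)"
  then show "rises {0..} y a (path \<omega>) \<and> passage_time y \<omega> < ennreal t"
    unfolding passage_time_less_iff[OF t] rises_def by fastforce
next
  assume "rises {0..} y a (path \<omega>) \<and> passage_time y \<omega> < ennreal t"
  then obtain q s where q: "0 \<le> q" "ereal y < X q \<omega>" "\<And>s. 0 \<le> s \<Longrightarrow> s \<le> q \<Longrightarrow> ereal a \<le> X s \<omega>"
      and s: "0 \<le> s" "s < t" "ereal y < X s \<omega>"
    unfolding passage_time_less_iff[OF t] rises_def by auto
  then show "rises {0..<t} y a (path \<omega>)"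
    unfolding rises_def by (intro bexI[of _ "min q s"]) (auto simp: min_def)
qed

lemma rises_sigma_at: "{\<omega> \<in> space N. rises {0..} y a (path \<omega>)} \<in> sets (sigma_at N X (passage_time y))"
proof (rule sigma_at_I)
  show "{\<omega> \<in> space N. rises {0..} y a (path \<omega>)} \<in> sets (history N X {0..})"
    by (rule rises_history) auto
  fix t :: real assume t: "0 \<le> t"
  have "{\<omega> \<in> {\<omega> \<in> space N. rises {0..} y a (path \<omega>)}. passage_time y \<omega> < ennreal t} =
      {\<omega> \<in> space N. rises {0..<t} y a (path \<omega>)}"
    using rises_before_iff[OF t] by auto
  also have "\<dots> \<in> sets (history N X {0..t})" by (rule rises_history) auto
  finally show "{\<omega> \<in> {\<omega> \<in> space N. rises {0..} y a (path \<omega>)}. passage_time y \<omega> < ennreal t}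
    \<in> sets (history N X {0..t})" .
qed

lemma passage_finite_if_rises: "rises {0..} y a (path \<omega>) \<Longrightarrow> passage_time y \<omega> < \<infinity>"
  unfolding passage_time_finite_iff rises_def by auto

text \<open>
A path that starts at or below \<open>y\<close> is exactly at \<open>y\<close> at its passage time, so the law of the future
does not depend on the past and the strong Markov property becomes a product formula.
\<close>

lemma markov_at_passage:
  assumes xy: "x \<le> y" and B: "B \<in> sets (Pi\<^sub>M {0..} (\<lambda>_. borel))"
  shows "{\<omega> \<in> space N. rises {0..} y a (path \<omega>) \<and> path_from X (enn2real (passage_time y \<omega>)) \<omega> \<in> B} \<in> sets N"
      (is "?E \<in> sets N")
    and "emeasure (P x) {\<omega> \<in> space N. rises {0..} y a (path \<omega>) \<and> path_from X (enn2real (passage_time y \<omega>)) \<omega> \<in> B} =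
      emeasure (P x) {\<omega> \<in> space N. rises {0..} y a (path \<omega>)} * emeasure (P y) {\<omega> \<in> space N. path_from X 0 \<omega> \<in> B}"
      (is "_ = _ * ?b")
proof -
  let ?A = "{\<omega> \<in> space N. rises {0..} y a (path \<omega>)}"
  let ?T = "\<lambda>\<omega>. enn2real (passage_time y \<omega>)"
  note \<tau>[measurable] = borel_measurable_markov_time[OF markov_time_passage, of y]
  note [measurable] = rises_sets[of y a] measurable_path_from[OF \<tau>] B
    measurable_at_random_time[of ?T]
  have eq: "?E = ?A \<inter> ((\<lambda>\<omega>. path_from X (?T \<omega>) \<omega>) -` B \<inter> space N)" by auto
  show E: "?E \<in> sets N" unfolding eq by measurable
  have C: "{\<omega> \<in> ?A. passage_time y \<omega> < \<infinity> \<and> \<bar>X (?T \<omega>) \<omega>\<bar> \<noteq> \<infinity>} \<in> sets N"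
  proof -
    have "{\<omega> \<in> ?A. passage_time y \<omega> < \<infinity> \<and> \<bar>X (?T \<omega>) \<omega>\<bar> \<noteq> \<infinity>} =
      ?A \<inter> {\<omega> \<in> space N. passage_time y \<omega> < \<infinity> \<and> \<bar>X (?T \<omega>) \<omega>\<bar> \<noteq> \<infinity>}" by auto
    also have "\<dots> \<in> sets N" by measurable auto
    finally show ?thesis .
  qed
  have start: "passage_time y \<omega> < \<infinity> \<and> X (?T \<omega>) \<omega> = ereal y"
    if "\<omega> \<in> ?A" "X 0 \<omega> = ereal x" for \<omega>
    using passage_finite_if_rises[of y a \<omega>] at_passage[of \<omega> y] that xy by auto
  \<comment> \<open>The strong Markov property is stated for paths at a finite position; almost surely the rising
    paths are at y when they pass it.\<close>
  have "emeasure (P x) ?E =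
     emeasure (P x) {\<omega> \<in> ?A. passage_time y \<omega> < \<infinity> \<and> \<bar>X (?T \<omega>) \<omega>\<bar> \<noteq> \<infinity> \<and> path_from X (?T \<omega>) \<omega> \<in> B}"
  proof (rule emeasure_eq_AE)
    have "{\<omega> \<in> ?A. passage_time y \<omega> < \<infinity> \<and> \<bar>X (?T \<omega>) \<omega>\<bar> \<noteq> \<infinity> \<and> path_from X (?T \<omega>) \<omega> \<in> B} =
       ?E \<inter> {\<omega> \<in> ?A. passage_time y \<omega> < \<infinity> \<and> \<bar>X (?T \<omega>) \<omega>\<bar> \<noteq> \<infinity>}" by auto
    then show "{\<omega> \<in> ?A. passage_time y \<omega> < \<infinity> \<and> \<bar>X (?T \<omega>) \<omega>\<bar> \<noteq> \<infinity> \<and> path_from X (?T \<omega>) \<omega> \<in> B} \<in> sets (P x)"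
      using E C by simp
  qed (use E start in \<open>auto intro!: AE_P_I\<close>)
  also have "\<dots> = (\<integral>\<^sup>+\<omega>. indicator {\<omega> \<in> ?A. passage_time y \<omega> < \<infinity> \<and> \<bar>X (?T \<omega>) \<omega>\<bar> \<noteq> \<infinity>} \<omega> *
           emeasure (P (real_of_ereal (X (?T \<omega>) \<omega>))) {\<omega>' \<in> space N. path_from X 0 \<omega>' \<in> B} \<partial>P x)"
    by (rule strong_markov[OF markov_time_passage rises_sigma_at B])
  also have "\<dots> = (\<integral>\<^sup>+\<omega>. ?b * indicator ?A \<omega> \<partial>P x)"
  proof (rule nn_integral_cong_AE, rule AE_P_I)
    fix \<omega> assume "\<omega> \<in> space N" "X 0 \<omega> = ereal x"
    then show "indicator {\<omega> \<in> ?A. passage_time y \<omega> < \<infinity> \<and> \<bar>X (?T \<omega>) \<omega>\<bar> \<noteq> \<infinity>} \<omega> *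
           emeasure (P (real_of_ereal (X (?T \<omega>) \<omega>))) {\<omega>' \<in> space N. path_from X 0 \<omega>' \<in> B} = ?b * indicator ?A \<omega>"
      using start[of \<omega>] by (cases "\<omega> \<in> ?A") (auto simp: indicator_def)
  qed
  also have "\<dots> = emeasure (P x) ?A * ?b"
    by (subst nn_integral_cmult_indicator) (auto simp: mult.commute rises_sets)
  finally show "emeasure (P x) ?E = emeasure (P x) ?A * ?b" .
qed

end

locale diffusion_with_scale = regular_diffusion +
  fixes S :: "real \<Rightarrow> real"
  assumes scale: "scale_function P X S"
begin

lemma S_less_iff [simp]: "S x < S y \<longleftrightarrow> x < y"
  using scale unfolding scale_function_def by (auto simp: strict_mono_less)

lemma S_le_iff [simp]: "S x \<le> S y \<longleftrightarrow> x \<le> y"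
  using scale unfolding scale_function_def by (auto simp: strict_mono_less_eq)

lemma S_eq_iff [simp]: "S x = S y \<longleftrightarrow> x = y"
  using scale unfolding scale_function_def by (auto simp: strict_mono_eq)

lemma S_cont: "continuous_on A S"
  using scale unfolding scale_function_def by (auto intro: continuous_on_subset)

lemma S_isCont: "isCont S x"
  using S_cont[of UNIV] by (simp add: continuous_on_eq_continuous_at)

lemma hit_up_first:
  assumes "a < x" "x < b"
  shows "measure (P x) {\<omega> \<in> space N. hitting_time X b \<omega> < hitting_time X a \<omega>} = (S x - S a) / (S b - S a)"
    and "measure (P x) {\<omega> \<in> space N. hitting_time X a \<omega> < hitting_time X b \<omega>} = (S b - S x) / (S b - S a)"
  using scale assms unfolding scale_function_def by simp_all

lemma hit_up_first_sets:
  assumes "a < x" "x < b"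
  shows "{\<omega> \<in> space N. hitting_time X b \<omega> < hitting_time X a \<omega>} \<in> sets N"
proof (rule ccontr)
  assume "{\<omega> \<in> space N. hitting_time X b \<omega> < hitting_time X a \<omega>} \<notin> sets N"
  \<comment> \<open>A set that is not measurable has measure 0 by convention, but the scale function assigns
    this one a positive value.\<close>
  then have "measure (P x) {\<omega> \<in> space N. hitting_time X b \<omega> < hitting_time X a \<omega>} = 0"
    by (intro measure_notin_sets) simp
  moreover have "0 < (S x - S a) / (S b - S a)"
    using assms by (intro divide_pos_pos) auto
  ultimately show False using hit_up_first(1)[OF assms] by linarith
qed

lemma rises_if_hit:
  assumes \<omega>: "\<omega> \<in> space N" and x: "X 0 \<omega> = ereal x" "a < x" "y < b"
    and hit: "hitting_time X b \<omega> < hitting_time X a \<omega>"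
  shows "rises {0..} y a (path \<omega>)"
proof -
  obtain t where t: "0 \<le> t" "X t \<omega> = ereal b" "ennreal t < hitting_time X a \<omega>"
    using hit unfolding hitting_time_def[of X b] Inf_less_iff by auto
  have "ereal a \<le> X s \<omega>" if s: "0 \<le> s" "s \<le> t" for s
  proof (rule ccontr)
    assume "\<not> ereal a \<le> X s \<omega>"
    then have "\<exists>r\<ge>0. r \<le> s \<and> X r \<omega> = ereal a"
      using x s by (intro IVT2' continuous_on_subset[OF continuous_paths[OF \<omega>]]) auto
    then obtain r where r: "0 \<le> r" "r \<le> s" "X r \<omega> = ereal a" by blast
    then have "hitting_time X a \<omega> \<le> ennreal r" unfolding hitting_time_def by (intro INF_lower) auto
    also have "\<dots> \<le> ennreal t" using r s by (intro ennreal_leI) auto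
    finally show False using t(3) by simp
  qed
  then show ?thesis
    unfolding rises_def using t x(3) by (intro bexI[of _ t]) auto
qed

lemma hit_if_rises:
  assumes \<omega>: "\<omega> \<in> space N" and x: "X 0 \<omega> = ereal x" "x \<le> y" "a' < a"
    and rise: "rises {0..} y a (path \<omega>)"
  shows "hitting_time X y \<omega> < hitting_time X a' \<omega>"
proof -
  obtain q where q: "0 \<le> q" "ereal y < X q \<omega>" "\<And>s. 0 \<le> s \<Longrightarrow> s \<le> q \<Longrightarrow> ereal a \<le> X s \<omega>"
    using rise unfolding rises_def by auto
  have "\<exists>t\<ge>0. t \<le> q \<and> X t \<omega> = ereal y"
    using x q by (intro IVT' continuous_on_subset[OF continuous_paths[OF \<omega>]]) auto
  then obtain t where t: "0 \<le> t" "t \<le> q" "X t \<omega> = ereal y" by blast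
  have "t \<noteq> q" using q(2) t(3) by auto
  then have "t < q" using t by simp
  have "hitting_time X y \<omega> \<le> ennreal t" unfolding hitting_time_def using t by (intro INF_lower) auto
  also have "\<dots> < ennreal q" using \<open>t < q\<close> t by (intro ennreal_lessI) auto
  also have "\<dots> \<le> hitting_time X a' \<omega>"
    unfolding hitting_time_def
  proof (rule INF_greatest)
    fix s assume s: "s \<in> {t. 0 \<le> t \<and> X t \<omega> = ereal a'}"
    then have "\<not> s \<le> q" using q(3)[of s] x(3) by auto
    then show "ennreal q \<le> ennreal s" by (intro ennreal_leI) simp
  qed
  finally show ?thesis .
qed

text \<open>
To exceed \<open>y\<close> without a value below \<open>a\<close> is implied by hitting \<open>b > y\<close> before \<open>a\<close>, and it
implies hitting \<open>y\<close> before \<open>a' < a\<close>.  Both bounds tend to the same value because \<open>S\<close> is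
continuous.
\<close>

lemma prob_rises:
  assumes a: "a < x" "x \<le> y"
  shows "measure (P x) {\<omega> \<in> space N. rises {0..} y a (path \<omega>)} = (S x - S a) / (S y - S a)"
    (is "measure _ ?R = _")
proof (rule antisym)
  interpret prob_space "P x" by (rule prob_space_P)
  have [simp]: "?R \<in> events" using rises_sets by simp
  show "(S x - S a) / (S y - S a) \<le> prob ?R"
  proof (rule tendsto_upperbound)
    show "((\<lambda>b. (S x - S a) / (S b - S a)) \<longlongrightarrow> (S x - S a) / (S y - S a)) (at_right y)"
      using S_isCont[of y] a by (intro tendsto_intros) (auto simp: isCont_def filterlim_at_split less_imp_neq)
    show "eventually (\<lambda>b. (S x - S a) / (S b - S a) \<le> prob ?R) (at_right y)"
      unfolding eventually_at_right_field
    proof (intro exI[of _ "y + 1"] conjI allI impI)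
      fix b assume b: "y < b"
      have ab: "a < x" "x < b" using a b by auto
      have "prob {\<omega> \<in> space N. hitting_time X b \<omega> < hitting_time X a \<omega>} \<le> prob ?R"
        by (rule finite_measure_mono_AE) (auto intro!: AE_P_I rises_if_hit[OF _ _ ab(1) b] rises_sets)
      then show "(S x - S a) / (S b - S a) \<le> prob ?R" using hit_up_first(1)[OF ab] by simp
    qed simp
  qed simp
  show "prob ?R \<le> (S x - S a) / (S y - S a)"
  proof (cases "x = y")
    case True
    then show ?thesis using a prob_le_1[of ?R] by simp
  next
    case False
    with a have "x < y" by simp
    show ?thesis
    proof (rule tendsto_lowerbound)
      show "((\<lambda>a'. (S x - S a') / (S y - S a')) \<longlongrightarrow> (S x - S a) / (S y - S a)) (at_left a)"
        using S_isCont[of a] a by (intro tendsto_intros) (auto simp: isCont_def filterlim_at_split less_imp_neq)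
      show "eventually (\<lambda>a'. prob ?R \<le> (S x - S a') / (S y - S a')) (at_left a)"
        unfolding eventually_at_left_field
      proof (intro exI[of _ "a - 1"] conjI allI impI)
        fix a' assume a': "a' < a"
        have ab: "a' < x" using a a' by auto
        have "prob ?R \<le> prob {\<omega> \<in> space N. hitting_time X y \<omega> < hitting_time X a' \<omega>}"
          using hit_up_first_sets[OF ab \<open>x < y\<close>]
          by (intro finite_measure_mono_AE AE_P_I) (auto intro!: hit_if_rises[OF _ _ a(2) a'])
        then show "prob ?R \<le> (S x - S a') / (S y - S a')" using hit_up_first(1)[OF ab \<open>x < y\<close>] by simp
      qed simp
    qed simp
  qed
qed

end

section \<open>Climbing without a drawdown\<close>

context regular_diffusion
begin

text \<open>
The passage time separates two stretches without a large drawdown, and none is created by joining them: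
up to the passage the path lies in \<open>[y - \<delta>, y]\<close>, and after it the path starts at \<open>y\<close>
and so never falls below \<open>y - \<delta>\<close>.
\<close>

lemma no_drop_across_passage:
  assumes \<omega>: "\<omega> \<in> space N" and x: "X 0 \<omega> \<le> ereal y"
    and rise: "rises {0..} y (y - \<delta>) (path \<omega>)"
  defines "T \<equiv> enn2real (passage_time y \<omega>)"
  assumes post: "\<And>s r. 0 \<le> r \<Longrightarrow> r \<le> s \<Longrightarrow> s \<le> t \<Longrightarrow> X (T + r) \<omega> \<le> X (T + s) \<omega> + ereal \<delta>"
    and s: "0 \<le> s" "s \<le> T + t"
  shows "ereal y \<le> X s \<omega> + ereal \<delta>"
    and "0 \<le> r \<Longrightarrow> r \<le> s \<Longrightarrow> X r \<omega> \<le> X s \<omega> + ereal \<delta>"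
proof -
  have fin: "passage_time y \<omega> < \<infinity>" by (rule passage_finite_if_rises[OF rise])
  note below = below_until_passage[OF \<omega> x fin, folded T_def] and at = at_passage[OF \<omega> x fin, folded T_def]
  obtain q where q: "0 \<le> q" "ereal y < X q \<omega>" "\<And>s. 0 \<le> s \<Longrightarrow> s \<le> q \<Longrightarrow> ereal (y - \<delta>) \<le> X s \<omega>"
    using rise unfolding rises_def by auto
  have "T \<le> q" unfolding T_def using q by (intro passage_time_le) auto
  show level: "ereal y \<le> X s \<omega> + ereal \<delta>"
  proof (cases "s \<le> T")
    case True
    then show ?thesis using q(3)[of s] s \<open>T \<le> q\<close> by (cases "X s \<omega>") auto
  next
    case False
    then show ?thesis using post[of 0 "s - T"] s at by simp
  qed
  assume r: "0 \<le> r" "r \<le> s"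
  show "X r \<omega> \<le> X s \<omega> + ereal \<delta>"
  proof (cases "r \<le> T")
    case True
    then have "X r \<omega> \<le> ereal y" using below r by simp
    then show ?thesis using level by (rule order_trans)
  next
    case False
    then show ?thesis using post[of "r - T" "s - T"] r s by simp
  qed
qed

lemma climbs_if_climbs_after_passage:
  assumes \<omega>: "\<omega> \<in> space N" and x: "X 0 \<omega> \<le> ereal y" and c: "c \<le> ereal y"
    and rise: "rises {0..} y (y - \<delta>) (path \<omega>)"
    and climb: "climbs {0..} \<delta> (- \<infinity>) z (path_from X (enn2real (passage_time y \<omega>)) \<omega>)"
  shows "climbs {0..} \<delta> c z (path \<omega>)"
proof -
  define T where "T = enn2real (passage_time y \<omega>)"
  obtain t where t: "0 \<le> t" "ereal z < X (T + t) \<omega>"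
      and post: "\<And>s r. 0 \<le> r \<Longrightarrow> r \<le> s \<Longrightarrow> s \<le> t \<Longrightarrow> X (T + r) \<omega> \<le> X (T + s) \<omega> + ereal \<delta>"
    using climb unfolding climbs_def T_def[symmetric] by (auto simp: max_def)
  have "c \<le> X s \<omega> + ereal \<delta> \<and> (0 \<le> r \<longrightarrow> r \<le> s \<longrightarrow> X r \<omega> \<le> X s \<omega> + ereal \<delta>)"
    if "0 \<le> s" "s \<le> T + t" for r s
    using no_drop_across_passage(1)[OF \<omega> x rise, folded T_def, of t s, OF post that]
      no_drop_across_passage(2)[OF \<omega> x rise, folded T_def, of t s r, OF post that] order_trans[OF c] by blast
  then show ?thesis
    unfolding climbs_def using t by (intro bexI[of _ "T + t"] conjI ballI impI max.boundedI) (auto simp: T_def)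
qed

lemma drops_after_passage_if_drops:
  assumes \<omega>: "\<omega> \<in> space N" and x: "X 0 \<omega> \<le> ereal y"
    and rise: "rises {0..} y (y - \<delta>) (path \<omega>)"
    and drop: "drops {0..} \<delta> (path \<omega>)"
  shows "drops {0..} \<delta> (path_from X (enn2real (passage_time y \<omega>)) \<omega>)"
proof (rule ccontr)
  define T where "T = enn2real (passage_time y \<omega>)"
  assume "\<not> drops {0..} \<delta> (path_from X (enn2real (passage_time y \<omega>)) \<omega>)"
  then have post: "X (T + r) \<omega> \<le> X (T + s) \<omega> + ereal \<delta>" if "0 \<le> r" "r \<le> s" for r s
    using that unfolding drops_def T_def[symmetric] by (fastforce simp: not_less)
  obtain s r where sr: "0 \<le> r" "r \<le> s" "X s \<omega> + ereal \<delta> < X r \<omega>"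
    using drop unfolding drops_def by auto
  have "X r \<omega> \<le> X s \<omega> + ereal \<delta>"
    using no_drop_across_passage(2)[OF \<omega> x rise, folded T_def, of s s r, OF post] sr by (simp add: T_def)
  with sr(3) show False by simp
qed

text \<open>
The converse direction has a weaker lower barrier: on its way to \<open>y\<close> the path is only known to stay
above its starting point and the floor, each minus \<open>\<delta>\<close>.  The discrepancy between the barriers
\<open>max c x - \<delta>\<close> and \<open>y - \<delta>\<close> disappears as \<open>x\<close> approaches \<open>y\<close>, and at once if
\<open>c = y\<close>.
\<close>

lemma passage_if_climbs:
  assumes \<omega>: "\<omega> \<in> space N" and x: "X 0 \<omega> = ereal x" "x \<le> y" "y \<le> z" and \<delta>: "0 \<le> \<delta>"
    and climb: "climbs {0..} \<delta> (ereal c) z (path \<omega>)"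
  shows "rises {0..} y (max c x - \<delta>) (path \<omega>)"
    and "climbs {0..} \<delta> (- \<infinity>) z (path_from X (enn2real (passage_time y \<omega>)) \<omega>)"
proof -
  define T where "T = enn2real (passage_time y \<omega>)"
  obtain t where t: "0 \<le> t" "ereal z < X t \<omega>"
      and c: "\<And>s r. 0 \<le> r \<Longrightarrow> r \<le> s \<Longrightarrow> s \<le> t \<Longrightarrow> max (ereal c) (X r \<omega>) \<le> X s \<omega> + ereal \<delta>"
    using climb unfolding climbs_def by auto
  have "ereal y \<le> ereal z" using x by simp
  then have yt: "ereal y < X t \<omega>" using t(2) by (rule le_less_trans)
  have "ereal (max c x - \<delta>) \<le> X s \<omega>" if "0 \<le> s" "s \<le> t" for s
    using c[of 0 s] that x(1) by (cases "X s \<omega>") (auto simp: max_def split: if_splits)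
  then show rise: "rises {0..} y (max c x - \<delta>) (path \<omega>)"
    unfolding rises_def using t(1) yt by (intro bexI[of _ t]) auto
  have "T \<le> t" unfolding T_def using t yt by (intro passage_time_le) auto
  have T: "0 \<le> T" by (simp add: T_def)
  have "X (T + r) \<omega> \<le> X (T + s) \<omega> + ereal \<delta>" if "0 \<le> r" "r \<le> s" "s \<le> t - T" for r s
    using c[of "T + r" "T + s"] that T by simp
  then show "climbs {0..} \<delta> (- \<infinity>) z (path_from X (enn2real (passage_time y \<omega>)) \<omega>)"
    unfolding climbs_def T_def[symmetric] using t \<open>T \<le> t\<close>
    by (intro bexI[of _ "t - T"] conjI ballI impI) auto
qed

lemma climbs_if_rises_beyond:
  assumes \<omega>: "\<omega> \<in> space N" and x: "X 0 \<omega> \<le> ereal y" and zy: "z < y" and \<delta>: "0 \<le> \<delta>"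
    and rise: "rises {0..} y (y - \<delta>) (path \<omega>)"
  shows "climbs {0..} \<delta> (- \<infinity>) z (path \<omega>)"
proof (rule climbs_if_climbs_after_passage[OF \<omega> x _ rise])
  define T where "T = enn2real (passage_time y \<omega>)"
  have "X T \<omega> = ereal y" unfolding T_def by (rule at_passage[OF \<omega> x passage_finite_if_rises[OF rise]])
  then show "climbs {0..} \<delta> (- \<infinity>) z (path_from X (enn2real (passage_time y \<omega>)) \<omega>)"
    unfolding climbs_def T_def[symmetric] using zy \<delta> by (intro bexI[of _ 0]) auto
qed simp

text \<open>
A set of arbitrary, not necessarily continuous paths; hence the rational times.  The floor may depend on
the path.
\<close>

definition climb_set :: "real \<Rightarrow> ((real \<Rightarrow> ereal) \<Rightarrow> ereal) \<Rightarrow> real \<Rightarrow> (real \<Rightarrow> ereal) set" where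
  "climb_set \<delta> c z =
    {w \<in> space (Pi\<^sub>M {0..} (\<lambda>_. borel)). climbs (\<rat> \<inter> {0..}) \<delta> (c w) z w}"

lemma climb_set_sets:
  assumes c: "c \<in> borel_measurable (Pi\<^sub>M {0..} (\<lambda>_. borel))"
  shows "climb_set \<delta> c z \<in> sets (Pi\<^sub>M {0..} (\<lambda>_. borel))"
proof -
  have "(\<lambda>w::real \<Rightarrow> ereal. w t) \<in> borel_measurable (Pi\<^sub>M {0..} (\<lambda>_. borel))" if "t \<in> \<rat> \<inter> {0..}" for t
    using that by (intro measurable_component_singleton) auto
  from measurable_climbs[of "\<rat> \<inter> {0..}" "\<lambda>t w. w t", OF this c countable_rational_times]
  show ?thesis unfolding climb_set_def .
qed

lemma path_from_in_climb_set:
  assumes "\<omega> \<in> space N" "0 \<le> s" "0 \<le> \<delta>"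
  shows "path_from X s \<omega> \<in> climb_set \<delta> c z \<longleftrightarrow>
    climbs {0..} \<delta> (c (path_from X s \<omega>)) z (path_from X s \<omega>)"
proof -
  have "climbs (\<rat> \<inter> {0..}) \<delta> c' z (path_from X s \<omega>) \<longleftrightarrow> climbs {0..} \<delta> c' z (path_from X s \<omega>)" for c'
    by (rule climbs_rational[OF continuous_path_from[OF assms(1,2)]]) (use assms(3) in auto)
  moreover have "path_from X s \<omega> \<in> space (Pi\<^sub>M {0..} (\<lambda>_. borel))"
    by (simp add: space_PiM path_from_def)
  ultimately show ?thesis unfolding climb_set_def by simp
qed

lemma climbs_path_from_0 [simp]: "climbs {0..} \<delta> c z (path_from X 0 \<omega>) \<longleftrightarrow> climbs {0..} \<delta> c z (path \<omega>)"
  unfolding climbs_def by (simp cong: conj_cong)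

end

context diffusion_with_scale
begin

definition climb_prob :: "real \<Rightarrow> real \<Rightarrow> real \<Rightarrow> real" where
  "climb_prob \<delta> x z = measure (P x) {\<omega> \<in> space N. climbs {0..} \<delta> (- \<infinity>) z (path \<omega>)}"

lemma prob_rise_then_climb:
  assumes a: "a < x" "x \<le> y" and \<delta>: "0 \<le> \<delta>"
  shows "{\<omega> \<in> space N. rises {0..} y a (path \<omega>) \<and>
        climbs {0..} \<delta> (- \<infinity>) z (path_from X (enn2real (passage_time y \<omega>)) \<omega>)} \<in> sets N" (is "?E \<in> _")
    and "measure (P x) {\<omega> \<in> space N. rises {0..} y a (path \<omega>) \<and>
        climbs {0..} \<delta> (- \<infinity>) z (path_from X (enn2real (passage_time y \<omega>)) \<omega>)} =
      (S x - S a) / (S y - S a) * climb_prob \<delta> y z"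
proof -
  let ?B = "climb_set \<delta> (\<lambda>_. - \<infinity>) z"
  have B: "?B \<in> sets (Pi\<^sub>M {0..} (\<lambda>_. borel))" by (rule climb_set_sets) simp
  have E: "?E = {\<omega> \<in> space N. rises {0..} y a (path \<omega>) \<and> path_from X (enn2real (passage_time y \<omega>)) \<omega> \<in> ?B}"
    by (rule Collect_cong) (simp add: path_from_in_climb_set \<delta> cong: conj_cong)
  have E0: "{\<omega> \<in> space N. path_from X 0 \<omega> \<in> ?B} = {\<omega> \<in> space N. climbs {0..} \<delta> (- \<infinity>) z (path \<omega>)}"
    by (rule Collect_cong) (simp add: path_from_in_climb_set \<delta> cong: conj_cong)
  show "?E \<in> sets N" unfolding E by (rule markov_at_passage(1)[OF a(2) B])
  have "measure (P x) ?E = measure (P x) {\<omega> \<in> space N. rises {0..} y a (path \<omega>)} * climb_prob \<delta> y z"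
    unfolding climb_prob_def measure_def E markov_at_passage(2)[OF a(2) B] E0 by (simp add: enn2real_mult)
  then show "measure (P x) ?E = (S x - S a) / (S y - S a) * climb_prob \<delta> y z"
    using prob_rises[OF a] by simp
qed

lemma climb_prob_bounds:
  assumes xy: "x \<le> y" "y \<le> z" "y - \<delta> < x" "0 < \<delta>" "c \<le> y" "c - \<delta> < x"
  shows "(S x - S (y - \<delta>)) / (S y - S (y - \<delta>)) * climb_prob \<delta> y z
      \<le> measure (P x) {\<omega> \<in> space N. climbs {0..} \<delta> (ereal c) z (path \<omega>)}" (is "?l \<le> measure _ ?C")
    and "measure (P x) {\<omega> \<in> space N. climbs {0..} \<delta> (ereal c) z (path \<omega>)}
      \<le> (S x - S (max c x - \<delta>)) / (S y - S (max c x - \<delta>)) * climb_prob \<delta> y z"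
proof -
  interpret prob_space "P x" by (rule prob_space_P)
  have d: "0 \<le> \<delta>" using xy by simp
  let ?E = "\<lambda>a. {\<omega> \<in> space N. rises {0..} y a (path \<omega>) \<and>
        climbs {0..} \<delta> (- \<infinity>) z (path_from X (enn2real (passage_time y \<omega>)) \<omega>)}"
  have "measure (P x) (?E (y - \<delta>)) \<le> measure (P x) ?C"
  proof (rule finite_measure_mono_AE)
    show "AE \<omega> in P x. \<omega> \<in> ?E (y - \<delta>) \<longrightarrow> \<omega> \<in> ?C"
    proof (rule AE_P_I, intro impI CollectI conjI; elim CollectE conjE)
      fix \<omega> assume \<omega>: "\<omega> \<in> space N" "X 0 \<omega> = ereal x"
      assume "rises {0..} y (y - \<delta>) (path \<omega>)"
        "climbs {0..} \<delta> (- \<infinity>) z (path_from X (enn2real (passage_time y \<omega>)) \<omega>)"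
      from climbs_if_climbs_after_passage[OF \<omega>(1) _ _ this] show "climbs {0..} \<delta> (ereal c) z (path \<omega>)"
        using xy \<omega>(2) by simp
    qed
  qed (use climbs_sets[OF d] in simp)
  then show "?l \<le> measure (P x) ?C" unfolding prob_rise_then_climb(2)[OF xy(3,1) d] .
  have m: "max c x - \<delta> < x" using xy by auto
  have "measure (P x) ?C \<le> measure (P x) (?E (max c x - \<delta>))"
  proof (rule finite_measure_mono_AE)
    show "AE \<omega> in P x. \<omega> \<in> ?C \<longrightarrow> \<omega> \<in> ?E (max c x - \<delta>)"
    proof (rule AE_P_I, intro impI CollectI; elim CollectE conjE)
      fix \<omega> assume \<omega>: "\<omega> \<in> space N" "X 0 \<omega> = ereal x" "climbs {0..} \<delta> (ereal c) z (path \<omega>)"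
      show "\<omega> \<in> space N \<and> rises {0..} y (max c x - \<delta>) (path \<omega>) \<and>
          climbs {0..} \<delta> (- \<infinity>) z (path_from X (enn2real (passage_time y \<omega>)) \<omega>)"
        using passage_if_climbs[OF \<omega>(1,2) xy(1,2) d \<omega>(3)] \<omega>(1) by (intro conjI)
    qed
  qed (use prob_rise_then_climb(1)[OF m xy(1) d] in simp)
  then show "measure (P x) ?C \<le> (S x - S (max c x - \<delta>)) / (S y - S (max c x - \<delta>)) * climb_prob \<delta> y z"
    unfolding prob_rise_then_climb(2)[OF m xy(1) d] .
qed

text \<open>
With the floor \<open>y\<close> both bounds use the barrier \<open>y - \<delta>\<close> and coincide.
\<close>

lemma climb_prob_from_below:
  assumes "x < y" "y \<le> z" "y - \<delta> < x" "0 < \<delta>"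
  shows "measure (P x) {\<omega> \<in> space N. climbs {0..} \<delta> (ereal y) z (path \<omega>)} =
    (S x - S (y - \<delta>)) / (S y - S (y - \<delta>)) * climb_prob \<delta> y z"
  using climb_prob_bounds[of x y z \<delta> y] assms by (simp add: max_def)

text \<open>
The starting point is always part of the path, so the floor \<open>x\<close> is the same as no floor.
\<close>

lemma climb_prob_ratio:
  assumes xy: "x \<le> y" "y \<le> z" "y - \<delta> < x" "0 < \<delta>"
  shows "(S x - S (y - \<delta>)) / (S y - S (y - \<delta>)) * climb_prob \<delta> y z \<le> climb_prob \<delta> x z"
    and "climb_prob \<delta> x z \<le> (S x - S (x - \<delta>)) / (S y - S (x - \<delta>)) * climb_prob \<delta> y z"
proof -
  interpret prob_space "P x" by (rule prob_space_P)
  have d: "0 \<le> \<delta>" using xy by simp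
  have "AE \<omega> in P x. \<omega> \<in> {\<omega> \<in> space N. climbs {0..} \<delta> (ereal x) z (path \<omega>)} \<longleftrightarrow>
      \<omega> \<in> {\<omega> \<in> space N. climbs {0..} \<delta> (- \<infinity>) z (path \<omega>)}"
  proof (rule AE_P_I)
    fix \<omega> assume \<omega>: "\<omega> \<in> space N" "X 0 \<omega> = ereal x"
    have "climbs {0..} \<delta> (ereal x) z (path \<omega>) \<longleftrightarrow> climbs {0..} \<delta> (- \<infinity>) z (path \<omega>)"
      unfolding climbs_def \<omega>(2)[symmetric] by (intro bex_cong refl conj_cong) force
    then show "\<omega> \<in> {\<omega> \<in> space N. climbs {0..} \<delta> (ereal x) z (path \<omega>)} \<longleftrightarrow>
      \<omega> \<in> {\<omega> \<in> space N. climbs {0..} \<delta> (- \<infinity>) z (path \<omega>)}" by simp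
  qed
  then have "measure (P x) {\<omega> \<in> space N. climbs {0..} \<delta> (ereal x) z (path \<omega>)} = climb_prob \<delta> x z"
    unfolding climb_prob_def by (intro measure_eq_AE) (use climbs_sets[OF d] in auto)
  then show "(S x - S (y - \<delta>)) / (S y - S (y - \<delta>)) * climb_prob \<delta> y z \<le> climb_prob \<delta> x z"
    "climb_prob \<delta> x z \<le> (S x - S (x - \<delta>)) / (S y - S (x - \<delta>)) * climb_prob \<delta> y z"
    using climb_prob_bounds[of x y z \<delta> x] xy by simp_all
qed

text \<open>
From \<open>z\<close> the path exceeds any \<open>y > z\<close> close to \<open>z\<close> without a drawdown with probability
close to 1, by the formula for \<open>rises\<close>.
\<close>

lemma climb_prob_self:
  assumes \<delta>: "0 < \<delta>"
  shows "climb_prob \<delta> z z = 1"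
proof (rule antisym)
  interpret prob_space "P z" by (rule prob_space_P)
  show "climb_prob \<delta> z z \<le> 1" unfolding climb_prob_def by (rule prob_le_1)
  show "1 \<le> climb_prob \<delta> z z"
  proof (rule tendsto_upperbound)
    have "((\<lambda>y. (S z - S (y - \<delta>)) / (S y - S (y - \<delta>))) \<longlongrightarrow> (S z - S (z - \<delta>)) / (S z - S (z - \<delta>))) (at z)"
      using \<delta> by (intro tendsto_intros isCont_tendsto_compose[OF S_isCont]) auto
    then show "((\<lambda>y. (S z - S (y - \<delta>)) / (S y - S (y - \<delta>))) \<longlongrightarrow> 1) (at_right z)"
      using \<delta> by (auto simp: filterlim_at_split)
    show "eventually (\<lambda>y. (S z - S (y - \<delta>)) / (S y - S (y - \<delta>)) \<le> climb_prob \<delta> z z) (at_right z)"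
      unfolding eventually_at_right_field
    proof (intro exI[of _ "z + \<delta>"] conjI allI impI)
      fix y assume y: "z < y" "y < z + \<delta>"
      have "prob {\<omega> \<in> space N. rises {0..} y (y - \<delta>) (path \<omega>)} \<le> climb_prob \<delta> z z"
        unfolding climb_prob_def
      proof (rule finite_measure_mono_AE)
        show "AE \<omega> in P z. \<omega> \<in> {\<omega> \<in> space N. rises {0..} y (y - \<delta>) (path \<omega>)} \<longrightarrow>
            \<omega> \<in> {\<omega> \<in> space N. climbs {0..} \<delta> (- \<infinity>) z (path \<omega>)}"
        proof (rule AE_P_I, intro impI CollectI conjI; elim CollectE conjE)
          fix \<omega> assume \<omega>: "\<omega> \<in> space N" "X 0 \<omega> = ereal z" "rises {0..} y (y - \<delta>) (path \<omega>)"
          show "climbs {0..} \<delta> (- \<infinity>) z (path \<omega>)"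
            by (rule climbs_if_rises_beyond[OF \<omega>(1) _ y(1) _ \<omega>(3)]) (use y \<delta> \<omega>(2) in auto)
        qed
      qed (use climbs_sets \<delta> in simp)
      then show "(S z - S (y - \<delta>)) / (S y - S (y - \<delta>)) \<le> climb_prob \<delta> z z"
        using prob_rises[of "y - \<delta>" z y] y by simp
    qed (use \<delta> in simp)
  qed simp
qed

end

section \<open>The exponential formula for the climbing probability\<close>

text \<open>
The estimates for the ratio of climbing probabilities, rewritten for their increment.
\<close>

lemma increment_bounds:
  fixes a b c p q :: real
  assumes "c < a" "c < b"
  shows "(a - c) / (b - c) * q \<le> p \<Longrightarrow> q - p \<le> p * (b - a) / (a - c)"
    and "p \<le> (a - c) / (b - c) * q \<Longrightarrow> p * (b - a) / (a - c) \<le> q - p"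
  using assms by (simp_all add: field_simps)

locale smooth_diffusion = diffusion_with_scale +
  assumes S_C1: "S C1_differentiable_on UNIV"
begin

lemma S_deriv: "(S has_real_derivative deriv S x) (at x)"
  and continuous_deriv_S: "continuous_on A (deriv S)"
proof -
  obtain D where D: "\<And>x. (S has_vector_derivative D x) (at x)" "continuous_on UNIV D"
    using S_C1 unfolding C1_differentiable_on_def by auto
  then have "(S has_real_derivative D x) (at x)" for x
    by (simp add: has_real_derivative_iff_has_vector_derivative)
  then have d: "(S has_real_derivative D x) (at x)" "deriv S x = D x" for x
    by (auto intro: DERIV_imp_deriv)
  then show "(S has_real_derivative deriv S x) (at x)" by simp
  have "deriv S = D" using d(2) by auto
  then show "continuous_on A (deriv S)" using D(2) by (auto intro: continuous_on_subset)
qed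

lemma deriv_S_nonneg: "0 \<le> deriv S x"
proof (rule ccontr)
  assume "\<not> 0 \<le> deriv S x"
  then obtain d where "d > 0" "\<And>h. 0 < h \<Longrightarrow> h < d \<Longrightarrow> S (x + h) < S x"
    using DERIV_neg_dec_right[OF S_deriv, of x] by auto
  from this(2)[of "d / 2"] \<open>d > 0\<close> show False by simp
qed

text \<open>
The intensity, per unit of increase of the maximum, with which excursions below the maximum reach depth
\<open>\<delta>\<close>.
\<close>

definition rate :: "real \<Rightarrow> real \<Rightarrow> real" where
  "rate \<delta> t = deriv S t / (S t - S (t - \<delta>))"

lemma rate_nonneg: "0 < \<delta> \<Longrightarrow> 0 \<le> rate \<delta> t"
  unfolding rate_def by (intro divide_nonneg_pos deriv_S_nonneg) simp

lemma continuous_rate: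
  assumes "0 < \<delta>" shows "continuous_on A (rate \<delta>)"
  unfolding rate_def using assms
  by (intro continuous_intros continuous_deriv_S S_cont continuous_on_compose2[OF S_cont[of UNIV]]) auto

lemma borel_rate: "0 < \<delta> \<Longrightarrow> rate \<delta> \<in> borel_measurable borel"
  by (intro borel_measurable_continuous_onI continuous_rate)

lemma rate_mono: "0 < \<rho> \<Longrightarrow> \<rho> \<le> \<delta> \<Longrightarrow> rate \<delta> t \<le> rate \<rho> t"
  unfolding rate_def by (intro divide_left_mono deriv_S_nonneg mult_pos_pos) auto

text \<open>
An antiderivative on the whole line.  Only its differences matter, and using it instead of integrals from
\<open>y\<close> to \<open>z\<close> avoids case distinctions about the order of the end points.
\<close>

definition cumulative_rate :: "real \<Rightarrow> real \<Rightarrow> real" where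
  "cumulative_rate \<delta> = (SOME K. \<forall>t. (K has_real_derivative rate \<delta> t) (at t))"

lemma cumulative_rate_deriv:
  assumes \<delta>: "0 < \<delta>"
  shows "(cumulative_rate \<delta> has_real_derivative rate \<delta> t) (at t)"
proof -
  have "\<exists>K. \<forall>t. (K has_real_derivative rate \<delta> t) (at t)"
    using einterval_antiderivative[of "- \<infinity>" \<infinity> "rate \<delta>"] continuous_rate[OF \<delta>, of UNIV]
    by (simp add: has_real_derivative_iff_has_vector_derivative continuous_on_eq_continuous_at)
  from someI_ex[OF this] show ?thesis unfolding cumulative_rate_def by blast
qed

lemma continuous_cumulative_rate: "0 < \<delta> \<Longrightarrow> continuous_on A (cumulative_rate \<delta>)"
  by (intro DERIV_continuous_on) (auto intro: has_field_derivative_at_within[OF cumulative_rate_deriv])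

lemma integral_rate:
  assumes "0 < \<delta>" "y \<le> z"
  shows "(\<integral>t. rate \<delta> t * indicator {y..z} t \<partial>lborel) = cumulative_rate \<delta> z - cumulative_rate \<delta> y"
  using assms cumulative_rate_deriv continuous_rate[OF assms(1), of UNIV]
  by (intro integral_FTC_Icc_real) (auto simp: continuous_on_eq_continuous_at)

text \<open>
On either side of \<open>x\<close> the difference quotient lies between the two expressions \<open>A\<close> and \<open>B\<close>
below, which differ only in the barrier \<open>x - \<delta>\<close> or \<open>y - \<delta>\<close>.  The order of \<open>A\<close> and
\<open>B\<close> changes with the sign of \<open>y - x\<close>, which is why minimum and maximum are used.
\<close>

lemma climb_prob_deriv:
  assumes \<delta>: "0 < \<delta>" and xz: "x \<le> z"
  shows "((\<lambda>x. climb_prob \<delta> x z) has_real_derivative climb_prob \<delta> x z * rate \<delta> x) (at x within {..z})"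
proof -
  define h where "h x = climb_prob \<delta> x z" for x
  define slope where "slope y = (S y - S x) / (y - x)" for y
  define A where "A y = h x * slope y / (S x - S (x - \<delta>))" for y
  define B where "B y = h x * slope y / (S x - S (y - \<delta>))" for y
  have slope: "(slope \<longlongrightarrow> deriv S x) (at x within {..z})"
    using has_field_derivative_at_within[OF S_deriv, of x "{..z}"] unfolding has_field_derivative_iff slope_def by simp
  have "((\<lambda>y. S (y - \<delta>)) \<longlongrightarrow> S (x - \<delta>)) (at x within {..z})"
    by (intro isCont_tendsto_compose[OF S_isCont] tendsto_intros)
  with slope have AB: "(A \<longlongrightarrow> h x * rate \<delta> x) (at x within {..z})" "(B \<longlongrightarrow> h x * rate \<delta> x) (at x within {..z})"
    unfolding A_def B_def rate_def using \<delta> by (auto intro!: tendsto_eq_intros)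
  have "((\<lambda>y. (h y - h x) / (y - x)) \<longlongrightarrow> h x * rate \<delta> x) (at x within {..z})"
  proof (rule tendsto_sandwich)
    show "((\<lambda>y. min (A y) (B y)) \<longlongrightarrow> h x * rate \<delta> x) (at x within {..z})"
      using tendsto_min[OF AB] by simp
    show "((\<lambda>y. max (A y) (B y)) \<longlongrightarrow> h x * rate \<delta> x) (at x within {..z})"
      using tendsto_max[OF AB] by simp
    have near: "eventually (\<lambda>y. y \<in> {..z} \<and> y \<noteq> x \<and> dist y x < \<delta>) (at x within {..z})"
      unfolding eventually_at using \<delta> by auto
    have bounds: "(A y \<le> (h y - h x) / (y - x) \<and> (h y - h x) / (y - x) \<le> B y) \<or>
        (B y \<le> (h y - h x) / (y - x) \<and> (h y - h x) / (y - x) \<le> A y)"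
      if y: "y \<in> {..z} \<and> y \<noteq> x \<and> dist y x < \<delta>" for y
    proof (cases "x < y")
      case True
      have *: "y \<le> z" "y - \<delta> < x" using y True by (auto simp: dist_real_def)
      note r = climb_prob_ratio[of x y z \<delta>, folded h_def]
      have "h x * (S y - S x) / (S x - S (x - \<delta>)) \<le> h y - h x"
        using True * \<delta> by (intro increment_bounds(2) r) auto
      moreover have "h y - h x \<le> h x * (S y - S x) / (S x - S (y - \<delta>))"
        using True * \<delta> by (intro increment_bounds(1) r) auto
      ultimately have "A y \<le> (h y - h x) / (y - x) \<and> (h y - h x) / (y - x) \<le> B y"
        using True unfolding A_def B_def slope_def
        by (auto simp: pos_le_divide_eq pos_divide_le_eq mult.commute)
      then show ?thesis ..
    next
      case False
      then have yx: "y < x" and *: "x - \<delta> < y" using y by (auto simp: dist_real_def)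
      note r = climb_prob_ratio[of y x z \<delta>, folded h_def]
      have pos: "0 < S x - S (x - \<delta>)" "0 < S x - S (y - \<delta>)" using yx \<delta> by auto
      have "(S y - S (x - \<delta>)) / (S x - S (x - \<delta>)) * h x \<le> h y"
        "h y \<le> (S y - S (y - \<delta>)) / (S x - S (y - \<delta>)) * h x"
        using r yx * \<delta> xz by auto
      then have "h x * (S y - S x) / (S x - S (x - \<delta>)) \<le> h y - h x"
        "h y - h x \<le> h x * (S y - S x) / (S x - S (y - \<delta>))"
        using pos by (auto simp: field_simps)
      then have "B y \<le> (h y - h x) / (y - x) \<and> (h y - h x) / (y - x) \<le> A y"
        using yx unfolding A_def B_def slope_def
        by (auto simp: neg_le_divide_eq neg_divide_le_eq mult.commute)
      then show ?thesis ..
    qed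
    show "eventually (\<lambda>y. min (A y) (B y) \<le> (h y - h x) / (y - x)) (at x within {..z})"
      using near by eventually_elim (use bounds in \<open>force simp: min_le_iff_disj\<close>)
    show "eventually (\<lambda>y. (h y - h x) / (y - x) \<le> max (A y) (B y)) (at x within {..z})"
      using near by eventually_elim (use bounds in \<open>force simp: le_max_iff_disj\<close>)
  qed
  then show ?thesis unfolding has_field_derivative_iff h_def .
qed

theorem climb_prob_eq:
  assumes \<delta>: "0 < \<delta>" and xz: "x \<le> z"
  shows "climb_prob \<delta> x z = exp (cumulative_rate \<delta> x - cumulative_rate \<delta> z)"
proof -
  let ?K = "cumulative_rate \<delta>"
  let ?g = "\<lambda>x. climb_prob \<delta> x z * exp (- ?K x)"
  have "(?g has_real_derivative 0) (at t within {..z})" if "t \<in> {..z}" for t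
    using that \<delta>
    by (auto intro!: derivative_eq_intros climb_prob_deriv has_field_derivative_at_within[OF cumulative_rate_deriv])
  then have "\<exists>c. \<forall>t\<in>{..z}. ?g t = c"
    by (intro has_field_derivative_zero_constant) auto
  then have "?g x = ?g z" using xz by auto
  then show ?thesis
    using climb_prob_self[OF \<delta>, of z] by (simp add: exp_minus exp_diff field_simps)
qed

end

section \<open>The law of the maximum at the drawdown time\<close>

context regular_diffusion
begin

text \<open>
A climb ends before the first drawdown, so on \<open>\<theta>\<^sub>\<delta> < t\<close> it is decided by the path up to \<open>t\<close>.
\<close>

lemma climbs_before_drop_iff:
  assumes "drops {0..<t} \<delta> (path \<omega>)"
  shows "climbs {0..<t} \<delta> c z (path \<omega>) \<longleftrightarrow> climbs {0..} \<delta> c z (path \<omega>)"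
proof
  assume "climbs {0..<t} \<delta> c z (path \<omega>)"
  then obtain u where u: "u \<in> {0..<t}" "ereal z < X u \<omega>"
      "\<forall>s\<in>{0..<t}. \<forall>r\<in>{0..<t}. r \<le> s \<longrightarrow> s \<le> u \<longrightarrow> max c (X r \<omega>) \<le> X s \<omega> + ereal \<delta>"
    unfolding climbs_def by blast
  have "max c (X r \<omega>) \<le> X s \<omega> + ereal \<delta>" if "0 \<le> r" "r \<le> s" "s \<le> u" for r s
    using u(1) that by (intro u(3)[rule_format]) auto
  then show "climbs {0..} \<delta> c z (path \<omega>)"
    unfolding climbs_def using u by (intro bexI[of _ u] conjI ballI impI) auto
next
  obtain s r where sr: "0 \<le> r" "r \<le> s" "s < t" "X s \<omega> + ereal \<delta> < X r \<omega>"
    using assms unfolding drops_def by auto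
  assume "climbs {0..} \<delta> c z (path \<omega>)"
  then obtain u where u: "0 \<le> u" "ereal z < X u \<omega>"
      "\<And>s r. 0 \<le> s \<Longrightarrow> 0 \<le> r \<Longrightarrow> r \<le> s \<Longrightarrow> s \<le> u \<Longrightarrow> max c (X r \<omega>) \<le> X s \<omega> + ereal \<delta>"
    unfolding climbs_def by auto
  have "u < s"
  proof (rule ccontr)
    assume "\<not> u < s"
    then have "max c (X r \<omega>) \<le> X s \<omega> + ereal \<delta>" using sr by (intro u(3)) auto
    then have "X r \<omega> \<le> X s \<omega> + ereal \<delta>" by simp
    with sr(4) show False by simp
  qed
  then show "climbs {0..<t} \<delta> c z (path \<omega>)"
    unfolding climbs_def using u sr by (intro bexI[of _ u] conjI ballI impI) simp_all
qed

text \<open>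
Here \<open>enn2real\<close> sends the infinite drawdown time to 0, and the maximum at time 0 is the starting point.
\<close>

lemma max_at_drawdown_if_infinite:
  assumes "\<not> drawdown_time X \<delta> \<omega> < \<infinity>"
  shows "max_at_drawdown X \<delta> \<omega> = real_of_ereal (X 0 \<omega>)"
  using assms by (simp add: max_at_drawdown_def running_max_def top.not_eq_extremum[symmetric])

lemma measurable_max_at_drawdown:
  assumes \<delta>: "0 < \<delta>"
  shows "max_at_drawdown X \<delta> \<in> borel_measurable (sigma_at N X (drawdown_time X \<delta>))"
  unfolding borel_measurable_iff_greater space_sigma_at
proof
  fix z
  have eq: "{\<omega> \<in> space N. z < max_at_drawdown X \<delta> \<omega>} =
      {\<omega> \<in> space N. drops {0..} \<delta> (path \<omega>)} \<inter> {\<omega> \<in> space N. climbs {0..} \<delta> (- \<infinity>) z (path \<omega>)} \<union>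
      ({\<omega> \<in> space N. z < real_of_ereal (X 0 \<omega>)} - {\<omega> \<in> space N. drops {0..} \<delta> (path \<omega>)})"
  proof (intro set_eqI)
    fix \<omega>
    show "\<omega> \<in> {\<omega> \<in> space N. z < max_at_drawdown X \<delta> \<omega>} \<longleftrightarrow> \<omega> \<in>
      {\<omega> \<in> space N. drops {0..} \<delta> (path \<omega>)} \<inter> {\<omega> \<in> space N. climbs {0..} \<delta> (- \<infinity>) z (path \<omega>)} \<union>
      ({\<omega> \<in> space N. z < real_of_ereal (X 0 \<omega>)} - {\<omega> \<in> space N. drops {0..} \<delta> (path \<omega>)})"
      using less_max_at_drawdown_iff[of \<omega> \<delta> z] max_at_drawdown_if_infinite[of \<delta> \<omega>] \<delta>
      unfolding drawdown_time_finite_iff by (cases "drops {0..} \<delta> (path \<omega>)") auto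
  qed
  show "{\<omega> \<in> space N. z < max_at_drawdown X \<delta> \<omega>} \<in> sets (sigma_at N X (drawdown_time X \<delta>))"
  proof (rule sigma_at_I)
    have [measurable]: "X 0 \<in> borel_measurable (history N X {0..})" by (rule measurable_history) simp
    have "{\<omega> \<in> space (history N X {0..}). z < real_of_ereal (X 0 \<omega>)} \<in> sets (history N X {0..})"
      by measurable
    then show "{\<omega> \<in> space N. z < max_at_drawdown X \<delta> \<omega>} \<in> sets (history N X {0..})"
      unfolding eq using \<delta>
      by (intro sets.Un sets.Int sets.Diff drops_history climbs_history) auto
    fix t :: real assume t: "0 \<le> t"
    have "{\<omega> \<in> {\<omega> \<in> space N. z < max_at_drawdown X \<delta> \<omega>}. drawdown_time X \<delta> \<omega> < ennreal t} =
        {\<omega> \<in> space N. drops {0..<t} \<delta> (path \<omega>)} \<inter> {\<omega> \<in> space N. climbs {0..<t} \<delta> (- \<infinity>) z (path \<omega>)}"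
    proof (rule set_eqI)
      fix \<omega>
      have "z < max_at_drawdown X \<delta> \<omega> \<longleftrightarrow> climbs {0..<t} \<delta> (- \<infinity>) z (path \<omega>)"
        if "\<omega> \<in> space N" "drops {0..<t} \<delta> (path \<omega>)"
      proof -
        have "drawdown_time X \<delta> \<omega> < ennreal t" using that(2) drawdown_time_less_iff[OF t] by simp
        then have "drawdown_time X \<delta> \<omega> < \<infinity>" by (rule less_trans) simp
        then show ?thesis using less_max_at_drawdown_iff[OF that(1) \<delta>] climbs_before_drop_iff[OF that(2)] by simp
      qed
      then show "\<omega> \<in> {\<omega> \<in> {\<omega> \<in> space N. z < max_at_drawdown X \<delta> \<omega>}. drawdown_time X \<delta> \<omega> < ennreal t} \<longleftrightarrow>
        \<omega> \<in> {\<omega> \<in> space N. drops {0..<t} \<delta> (path \<omega>)} \<inter> {\<omega> \<in> space N. climbs {0..<t} \<delta> (- \<infinity>) z (path \<omega>)}"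
        unfolding drawdown_time_less_iff[OF t] by blast
    qed
    also have "\<dots> \<in> sets (history N X {0..t})"
      using \<delta> by (intro sets.Int drops_history climbs_history) auto
    finally show "{\<omega> \<in> {\<omega> \<in> space N. z < max_at_drawdown X \<delta> \<omega>}. drawdown_time X \<delta> \<omega> < ennreal t}
      \<in> sets (history N X {0..t})" .
  qed
qed

lemma borel_measurable_max_at_drawdown:
  assumes "0 < \<delta>" shows "max_at_drawdown X \<delta> \<in> borel_measurable N"
  using measurable_sets[OF measurable_max_at_drawdown[OF assms]] sets_sigma_at_subset
  by (intro measurableI) auto

lemma markov_time_drawdown:
  assumes "0 < \<delta>" shows "markov_time N X (drawdown_time X \<delta>)"
  unfolding markov_time_def
proof (intro allI impI)
  fix t :: real assume "0 \<le> t"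
  then show "{\<omega> \<in> space N. drawdown_time X \<delta> \<omega> < ennreal t} \<in> sets (history N X {0..t})"
    unfolding drawdown_time_less_iff[OF \<open>0 \<le> t\<close>] by (intro drops_history) (use assms in auto)
qed

lemma AE_start_le_max:
  assumes \<delta>: "0 < \<delta>"
  shows "AE \<omega> in P x. x \<le> max_at_drawdown X \<delta> \<omega>"
proof (rule AE_P_I)
  fix \<omega> assume \<omega>: "\<omega> \<in> space N" "X 0 \<omega> = ereal x"
  show "x \<le> max_at_drawdown X \<delta> \<omega>"
  proof (cases "drawdown_time X \<delta> \<omega> < \<infinity>")
    case True
    then show ?thesis
      using le_max_at_drawdown[OF \<omega>(1) \<delta> True, of 0] drawdown_time_eq(2)[OF \<omega>(1) \<delta> True] \<omega>(2) by simp
  next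
    case False
    then show ?thesis using max_at_drawdown_if_infinite[OF False] \<omega>(2) by simp
  qed
qed

end

context diffusion_with_scale
begin

text \<open>
If \<open>y - \<delta> < x\<close>, a path from \<open>x\<close> reaches \<open>y\<close> without falling below \<open>y - \<delta>\<close> with
positive probability.  If a path from \<open>y\<close> failed to have a drawdown with positive probability, so
would the concatenated path from \<open>x\<close>.
\<close>

lemma drawdown_finite_step:
  assumes fin: "AE \<omega> in P x. drawdown_time X \<delta> \<omega> < \<infinity>" and xy: "x \<le> y" "y - \<delta> < x"
  shows "AE \<omega> in P y. drawdown_time X \<delta> \<omega> < \<infinity>"
proof -
  have \<delta>: "0 \<le> \<delta>" using xy by simp
  define B where "B = {w \<in> space (Pi\<^sub>M {0..} (\<lambda>_. borel)). \<not> drops (\<rat> \<inter> {0..}) \<delta> w}"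
  have "(\<lambda>w::real \<Rightarrow> ereal. w t) \<in> borel_measurable (Pi\<^sub>M {0..} (\<lambda>_. borel))" if "t \<in> \<rat> \<inter> {0..}" for t
    using that by (intro measurable_component_singleton) auto
  from sets.sets_Collect_neg[OF measurable_drops[of "\<rat> \<inter> {0..}" "\<lambda>t w. w t", OF this countable_rational_times]]
  have B: "B \<in> sets (Pi\<^sub>M {0..} (\<lambda>_. borel))" unfolding B_def .
  have in_B: "path_from X s \<omega> \<in> B \<longleftrightarrow> \<not> drops {0..} \<delta> (path_from X s \<omega>)"
    if "\<omega> \<in> space N" "0 \<le> s" for s \<omega>
  proof -
    have "drops (\<rat> \<inter> {0..}) \<delta> (path_from X s \<omega>) \<longleftrightarrow> drops {0..} \<delta> (path_from X s \<omega>)"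
      by (rule drops_rational[OF continuous_path_from[OF that]]) (use \<delta> in auto)
    moreover have "path_from X s \<omega> \<in> space (Pi\<^sub>M {0..} (\<lambda>_. borel))"
      by (simp add: space_PiM path_from_def)
    ultimately show ?thesis unfolding B_def by simp
  qed
  let ?E = "{\<omega> \<in> space N. rises {0..} y (y - \<delta>) (path \<omega>) \<and> path_from X (enn2real (passage_time y \<omega>)) \<omega> \<in> B}"
  have "AE \<omega> in P x. \<not> (rises {0..} y (y - \<delta>) (path \<omega>) \<and> path_from X (enn2real (passage_time y \<omega>)) \<omega> \<in> B)"
    using fin AE_space start
  proof eventually_elim
    case (elim \<omega>)
    then have \<omega>: "\<omega> \<in> space N" "X 0 \<omega> \<le> ereal y" "drops {0..} \<delta> (path \<omega>)"
      using xy elim(1)[unfolded drawdown_time_finite_iff] by auto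
    show ?case
      using drops_after_passage_if_drops[OF \<omega>(1,2) _ \<omega>(3)] in_B[OF \<omega>(1) enn2real_nonneg] by blast
  qed
  then have "emeasure (P x) ?E = 0"
    using markov_at_passage(1)[OF xy(1) B] by (subst (asm) AE_iff_measurable[where N = ?E]) auto
  then have "emeasure (P x) {\<omega> \<in> space N. rises {0..} y (y - \<delta>) (path \<omega>)} *
      emeasure (P y) {\<omega> \<in> space N. path_from X 0 \<omega> \<in> B} = 0"
    unfolding markov_at_passage(2)[OF xy(1) B] .
  moreover have "0 < measure (P x) {\<omega> \<in> space N. rises {0..} y (y - \<delta>) (path \<omega>)}"
    using xy unfolding prob_rises[OF xy(2,1)] by (intro divide_pos_pos) auto
  ultimately have null: "emeasure (P y) {\<omega> \<in> space N. path_from X 0 \<omega> \<in> B} = 0"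
    by (auto simp: measure_def)
  have drops0: "drops {0..} \<delta> (path_from X 0 \<omega>) \<longleftrightarrow> drops {0..} \<delta> (path \<omega>)" for \<omega>
    unfolding drops_def by simp
  have eq: "{\<omega> \<in> space N. path_from X 0 \<omega> \<in> B} = {\<omega> \<in> space N. \<not> drops {0..} \<delta> (path \<omega>)}"
    by (rule Collect_cong) (simp add: in_B drops0 cong: conj_cong)
  show ?thesis
    unfolding drawdown_time_finite_iff
    using null sets.sets_Collect_neg[OF drops_sets[OF \<delta>]] unfolding eq
    by (subst AE_iff_measurable[where N = "{\<omega> \<in> space N. \<not> drops {0..} \<delta> (path \<omega>)}"]) auto
qed

lemma drawdown_finite_above:
  assumes fin: "AE \<omega> in P x. drawdown_time X \<delta> \<omega> < \<infinity>" and \<delta>: "0 < \<delta>" and xy: "x \<le> y"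
  shows "AE \<omega> in P y. drawdown_time X \<delta> \<omega> < \<infinity>"
proof -
  \<comment> \<open>Each step must be shorter than \<delta>; half of it will do.\<close>
  have "\<forall>y. x \<le> y \<longrightarrow> y \<le> x + real n * (\<delta> / 2) \<longrightarrow> (AE \<omega> in P y. drawdown_time X \<delta> \<omega> < \<infinity>)" for n
  proof (induction n)
    case 0
    then show ?case using fin by (auto simp: antisym)
  next
    case (Suc n)
    show ?case
    proof (intro allI impI)
      fix y assume y: "x \<le> y" "y \<le> x + real (Suc n) * (\<delta> / 2)"
      have "AE \<omega> in P (max x (y - \<delta> / 2)). drawdown_time X \<delta> \<omega> < \<infinity>"
      proof (rule Suc.IH[rule_format])
        have "0 \<le> real n * (\<delta> / 2)" "y - \<delta> / 2 \<le> x + real n * (\<delta> / 2)"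
          using y \<delta> by (simp_all add: algebra_simps add_divide_distrib)
        then show "max x (y - \<delta> / 2) \<le> x + real n * (\<delta> / 2)" by simp
      qed simp
      then show "AE \<omega> in P y. drawdown_time X \<delta> \<omega> < \<infinity>"
        by (rule drawdown_finite_step) (use y \<delta> in auto)
    qed
  qed
  moreover obtain n :: nat where "(y - x) / (\<delta> / 2) \<le> real n" using real_arch_simple by blast
  ultimately show ?thesis using xy \<delta> by (auto simp: field_simps)
qed

lemma prob_max_at_drawdown_greater:
  assumes \<delta>: "0 < \<delta>" and fin: "AE \<omega> in P x. drawdown_time X \<delta> \<omega> < \<infinity>"
  shows "measure (P x) {\<omega> \<in> space N. z < max_at_drawdown X \<delta> \<omega>} = climb_prob \<delta> x z"
  unfolding climb_prob_def
proof (rule measure_eq_AE)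
  show "AE \<omega> in P x. \<omega> \<in> {\<omega> \<in> space N. z < max_at_drawdown X \<delta> \<omega>} \<longleftrightarrow>
      \<omega> \<in> {\<omega> \<in> space N. climbs {0..} \<delta> (- \<infinity>) z (path \<omega>)}"
    using fin by eventually_elim (use less_max_at_drawdown_iff[OF _ \<delta>] in auto)
  show "{\<omega> \<in> space N. z < max_at_drawdown X \<delta> \<omega>} \<in> sets (P x)"
    using borel_measurable_less[OF borel_measurable_const borel_measurable_max_at_drawdown[OF \<delta>]] by simp
qed (use climbs_sets \<delta> in simp)

end

context smooth_diffusion
begin

definition exit_density :: "real \<Rightarrow> real \<Rightarrow> real \<Rightarrow> real" where
  "exit_density \<delta> y z =
    indicator {y<..} z * (rate \<delta> z * exp (cumulative_rate \<delta> y - cumulative_rate \<delta> z))"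

lemma exit_density_nonneg: "0 < \<delta> \<Longrightarrow> 0 \<le> exit_density \<delta> y z"
  unfolding exit_density_def by (simp add: rate_nonneg)

lemma borel_exit_density:
  assumes "0 < \<delta>" shows "exit_density \<delta> y \<in> borel_measurable borel"
proof -
  note [measurable] = borel_rate[OF assms] borel_measurable_continuous_onI[OF continuous_cumulative_rate[OF assms]]
  show ?thesis unfolding exit_density_def[abs_def] by measurable
qed

text \<open>
The tail of the law is the climbing probability.  The density integrates to the same tails provided that
they vanish at infinity, and they do because the maximum is a real random variable.
\<close>

lemma distr_max_at_drawdown:
  assumes \<delta>: "0 < \<delta>" and fin: "AE \<omega> in P y. drawdown_time X \<delta> \<omega> < \<infinity>"
  shows "distr (P y) borel (max_at_drawdown X \<delta>) = density lborel (\<lambda>z. ennreal (exit_density \<delta> y z))"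
proof -
  let ?K = "cumulative_rate \<delta>" and ?M = "max_at_drawdown X \<delta>"
  let ?D = "distr (P y) borel ?M" and ?L = "density lborel (\<lambda>z. ennreal (exit_density \<delta> y z))"
  interpret prob_space "P y" by (rule prob_space_P)
  have M[measurable]: "?M \<in> borel_measurable (P y)" using borel_measurable_max_at_drawdown[OF \<delta>] by simp
  note [measurable] = borel_exit_density[OF \<delta>]
  have D: "real_distribution ?D"
    by (intro real_distribution.intro prob_space_distr M real_distribution_axioms.intro) simp_all
  then interpret D: real_distribution ?D .
  have tail: "measure ?D {z<..} = exp (?K y - ?K (max y z))" for z
  proof -
    have "measure ?D {z<..} = measure (P y) {\<omega> \<in> space N. z < ?M \<omega>}"
      by (subst measure_distr) (auto intro!: arg_cong[where f = "measure (P y)"])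
    also have "\<dots> = climb_prob \<delta> y z" by (rule prob_max_at_drawdown_greater[OF \<delta> fin])
    also have "\<dots> = exp (?K y - ?K (max y z))"
    proof (cases "y \<le> z")
      case True
      then show ?thesis using climb_prob_eq[OF \<delta> True] by (simp add: max_def)
    next
      case False
      then have "climb_prob \<delta> y y \<le> climb_prob \<delta> y z"
        unfolding prob_max_at_drawdown_greater[OF \<delta> fin, symmetric]
        by (intro finite_measure_mono) (auto simp: borel_measurable_max_at_drawdown[OF \<delta>])
      moreover have "climb_prob \<delta> y z \<le> 1" unfolding climb_prob_def by (rule prob_le_1)
      ultimately show ?thesis using climb_prob_self[OF \<delta>] False by (simp add: max_def)
    qed
    finally show ?thesis .
  qed
  have cdf_tail: "cdf ?D z = 1 - exp (?K y - ?K (max y z))" for z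
  proof -
    have "cdf ?D z = 1 - measure ?D {z<..}"
      unfolding cdf_def using D.prob_compl[of "{z<..}"] by (simp add: Compl_eq_Diff_UNIV[symmetric] not_less Compl_greaterThan)
    then show ?thesis using tail by simp
  qed
  have "((\<lambda>z. 1 - cdf ?D z) \<longlongrightarrow> 1 - 1) at_top"
    by (intro tendsto_intros D.cdf_lim_at_top_prob)
  then have "((\<lambda>z. exp (?K y - ?K (max y z))) \<longlongrightarrow> 0) at_top" by (simp add: cdf_tail)
  then have lim: "((\<lambda>z. exp (?K y - ?K z)) \<longlongrightarrow> 0) at_top"
    by (rule Lim_transform_eventually) (use eventually_ge_at_top[of y] in eventually_elim, simp add: max_def)
  have L_tail: "emeasure ?L {z<..} = ennreal (exp (?K y - ?K (max y z)))" for z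
  proof -
    let ?m = "max y z"
    have "emeasure ?L {z<..} = (\<integral>\<^sup>+t. ennreal (exit_density \<delta> y t) * indicator {z<..} t \<partial>lborel)"
      by (subst emeasure_density) auto
    also have "\<dots> = (\<integral>\<^sup>+t. ennreal (rate \<delta> t * exp (?K y - ?K t)) * indicator {?m..} t \<partial>lborel)"
      using AE_lborel_singleton[of ?m]
      by (intro nn_integral_cong_AE) (auto simp: exit_density_def indicator_def)
    also have "\<dots> = 0 - (- exp (?K y - ?K ?m))"
    proof (rule nn_integral_FTC_atLeast)
      show "((\<lambda>t. - exp (?K y - ?K t)) \<longlongrightarrow> 0) at_top" using tendsto_minus[OF lim] by simp
      show "((\<lambda>t. - exp (?K y - ?K t)) has_real_derivative rate \<delta> t * exp (?K y - ?K t)) (at t)" for t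
        by (auto intro!: derivative_eq_intros cumulative_rate_deriv[OF \<delta>])
      show "(\<lambda>t. rate \<delta> t * exp (?K y - ?K t)) \<in> borel_measurable borel"
        by (intro borel_measurable_continuous_onI continuous_intros continuous_rate continuous_cumulative_rate \<delta>)
    qed (use rate_nonneg[OF \<delta>] in auto)
    finally show ?thesis by simp
  qed
  have below_y: "emeasure ?L {..y} = 0"
  proof -
    have "emeasure ?L {..y} = (\<integral>\<^sup>+t. ennreal (exit_density \<delta> y t) * indicator {..y} t \<partial>lborel)"
      by (subst emeasure_density) auto
    also have "\<dots> = (\<integral>\<^sup>+t. 0 \<partial>(lborel :: real measure))"
      by (intro nn_integral_cong) (auto simp: exit_density_def indicator_def)
    finally show ?thesis by simp
  qed
  have "emeasure ?L UNIV = emeasure ?L ({..y} \<union> {y<..})"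
    by (intro arg_cong[where f = "emeasure ?L"]) auto
  also have "\<dots> = emeasure ?L {..y} + emeasure ?L {y<..}" by (intro plus_emeasure[symmetric]) auto
  finally have "emeasure ?L UNIV = 1" using below_y L_tail[of y] by simp
  then have "prob_space ?L" by (intro prob_spaceI) simp
  then have L: "real_distribution ?L"
    by (intro real_distribution.intro real_distribution_axioms.intro) simp_all
  then interpret L: real_distribution ?L .
  have "cdf ?L z = 1 - measure ?L {z<..}" for z
    unfolding cdf_def using L.prob_compl[of "{z<..}"] by (simp add: Compl_eq_Diff_UNIV[symmetric] Compl_greaterThan)
  then have "cdf ?L z = cdf ?D z" for z using L_tail cdf_tail by (simp add: measure_def)
  then show "?D = ?L" by (intro cdf_unique[OF D L]) auto
qed

end

section \<open>The strong Markov property at the drawdown time\<close>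

context diffusion_with_scale
begin

text \<open>
The probability of hitting \<open>y\<close> before \<open>y - \<delta>\<close> when starting from \<open>y - \<rho>\<close>.
\<close>

definition recovery_prob :: "real \<Rightarrow> real \<Rightarrow> real \<Rightarrow> real" where
  "recovery_prob \<rho> \<delta> y = (S (y - \<rho>) - S (y - \<delta>)) / (S y - S (y - \<delta>))"

lemma recovery_prob_bounds:
  assumes "0 < \<rho>" "\<rho> < \<delta>"
  shows "0 \<le> recovery_prob \<rho> \<delta> y" "recovery_prob \<rho> \<delta> y \<le> 1"
proof -
  have *: "S (y - \<delta>) < S (y - \<rho>)" "S (y - \<rho>) < S y" using assms by auto
  then show "0 \<le> recovery_prob \<rho> \<delta> y" unfolding recovery_prob_def by (intro divide_nonneg_pos) linarith+
  show "recovery_prob \<rho> \<delta> y \<le> 1" unfolding recovery_prob_def using * by (simp add: pos_divide_le_eq)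
qed

lemma borel_recovery_prob:
  assumes "0 < \<rho>" "\<rho> < \<delta>"
  shows "recovery_prob \<rho> \<delta> \<in> borel_measurable borel"
proof -
  have [measurable]: "S \<in> borel_measurable borel" by (intro borel_measurable_continuous_onI S_cont)
  show ?thesis unfolding recovery_prob_def[abs_def] by measurable
qed

lemma Q_eq:
  assumes "0 < \<rho>" "\<rho> < \<delta>"
  shows "Q P X \<rho> \<delta> y f = f y * (1 - recovery_prob \<rho> \<delta> y) +
    (\<integral>\<omega>. f (max_at_drawdown X \<delta> \<omega>) \<partial>P y) * recovery_prob \<rho> \<delta> y"
proof -
  have *: "y - \<delta> < y - \<rho>" "y - \<rho> < y" "y - \<delta> < y" using assms by auto
  have "S y - S (y - \<delta>) \<noteq> 0" using * by simp
  then have "(S y - S (y - \<rho>)) / (S y - S (y - \<delta>)) = 1 - recovery_prob \<rho> \<delta> y"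
    unfolding recovery_prob_def by (simp add: field_simps)
  then show ?thesis
    unfolding Q_def using hit_up_first[OF *(1,2)] by (simp add: recovery_prob_def)
qed

lemma kernel_subprob: "P \<in> borel \<rightarrow>\<^sub>M subprob_algebra N"
  by (rule measurable_prob_algebraD[OF kernel])

lemma borel_Q:
  assumes \<rho>: "0 < \<rho>" "\<rho> < \<delta>" and f: "f \<in> borel_measurable borel"
  shows "(\<lambda>y. Q P X \<rho> \<delta> y f) \<in> borel_measurable borel"
proof -
  have "0 < \<delta>" using \<rho> by simp
  note [measurable] = f borel_recovery_prob[OF \<rho>] kernel_subprob borel_measurable_max_at_drawdown[OF this]
  show ?thesis unfolding Q_eq[OF \<rho>] by measurable
qed

text \<open>
The conditional law of the maximum at \<open>\<theta>\<^sub>\<delta>\<close>, given that the maximum at \<open>\<theta>\<^sub>\<rho>\<close> is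
\<open>y\<close>.
\<close>

definition exit_kernel :: "real \<Rightarrow> real \<Rightarrow> real \<Rightarrow> real set \<Rightarrow> ennreal" where
  "exit_kernel \<rho> \<delta> y B = ennreal (1 - recovery_prob \<rho> \<delta> y) * indicator B y +
    ennreal (recovery_prob \<rho> \<delta> y) * emeasure (P y) {\<omega> \<in> space N. max_at_drawdown X \<delta> \<omega> \<in> B}"

lemma max_in_sets:
  assumes "0 < \<delta>" "B \<in> sets borel"
  shows "{\<omega> \<in> space N. max_at_drawdown X \<delta> \<omega> \<in> B} \<in> sets N"
  using measurable_sets[OF borel_measurable_max_at_drawdown[OF assms(1)] assms(2)]
  by (simp add: vimage_def Int_def conj_commute)

lemma borel_exit_kernel:
  assumes \<rho>: "0 < \<rho>" "\<rho> < \<delta>" and B: "B \<in> sets borel"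
  shows "(\<lambda>y. exit_kernel \<rho> \<delta> y B) \<in> borel_measurable borel"
proof -
  have "0 < \<delta>" using \<rho> by simp
  note [measurable] = B borel_recovery_prob[OF \<rho>] kernel_subprob max_in_sets[OF this B]
  show ?thesis unfolding exit_kernel_def by measurable
qed

lemma exit_kernel_add_compl:
  assumes \<rho>: "0 < \<rho>" "\<rho> < \<delta>" and B: "B \<in> sets borel"
  shows "exit_kernel \<rho> \<delta> y B + exit_kernel \<rho> \<delta> y (UNIV - B) = 1"
proof -
  interpret prob_space "P y" by (rule prob_space_P)
  have \<delta>: "0 < \<delta>" using \<rho> by simp
  let ?p = "recovery_prob \<rho> \<delta> y"
  let ?m = "\<lambda>B. emeasure (P y) {\<omega> \<in> space N. max_at_drawdown X \<delta> \<omega> \<in> B}"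
  have "?m B + ?m (UNIV - B) =
      emeasure (P y) ({\<omega> \<in> space N. max_at_drawdown X \<delta> \<omega> \<in> B} \<union> {\<omega> \<in> space N. max_at_drawdown X \<delta> \<omega> \<in> UNIV - B})"
    using max_in_sets[OF \<delta>] B by (intro plus_emeasure) auto
  also have "\<dots> = emeasure (P y) (space (P y))" by (intro arg_cong[where f = "emeasure (P y)"]) auto
  finally have m: "?m B + ?m (UNIV - B) = 1" using emeasure_space_1 by simp
  have i: "indicator B y + indicator (UNIV - B) y = (1::ennreal)" by (simp add: indicator_def)
  have "exit_kernel \<rho> \<delta> y B + exit_kernel \<rho> \<delta> y (UNIV - B) =
      ennreal (1 - ?p) * (indicator B y + indicator (UNIV - B) y) + ennreal ?p * (?m B + ?m (UNIV - B))"
    unfolding exit_kernel_def by (simp only: distrib_left add_ac)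
  also have "\<dots> = ennreal (1 - ?p) + ennreal ?p" unfolding m i by simp
  also have "\<dots> = 1" using recovery_prob_bounds[OF \<rho>, of y] by (simp flip: ennreal_plus)
  finally show ?thesis .
qed

lemma exit_kernel_UN:
  assumes \<rho>: "0 < \<rho>" "\<rho> < \<delta>" and B: "disjoint_family B" "range B \<subseteq> sets borel"
  shows "exit_kernel \<rho> \<delta> y (\<Union>i::nat. B i) = (\<Sum>i. exit_kernel \<rho> \<delta> y (B i))"
proof -
  have \<delta>: "0 < \<delta>" using \<rho> by simp
  have "(\<Sum>i. emeasure (P y) {\<omega> \<in> space N. max_at_drawdown X \<delta> \<omega> \<in> B i}) =
      emeasure (P y) (\<Union>i. {\<omega> \<in> space N. max_at_drawdown X \<delta> \<omega> \<in> B i})"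
  proof (rule suminf_emeasure)
    show "range (\<lambda>i. {\<omega> \<in> space N. max_at_drawdown X \<delta> \<omega> \<in> B i}) \<subseteq> sets (P y)"
      using max_in_sets[OF \<delta>] B(2) by auto
    show "disjoint_family (\<lambda>i. {\<omega> \<in> space N. max_at_drawdown X \<delta> \<omega> \<in> B i})"
      using B(1) unfolding disjoint_family_on_def by blast
  qed
  moreover have "(\<Union>i. {\<omega> \<in> space N. max_at_drawdown X \<delta> \<omega> \<in> B i}) =
      {\<omega> \<in> space N. max_at_drawdown X \<delta> \<omega> \<in> (\<Union>i. B i)}" by auto
  ultimately show ?thesis
    unfolding exit_kernel_def using B(1)
    by (simp add: suminf_add[symmetric] suminf_indicator)
qed

text \<open>
The future paths \<open>w\<close> after \<open>\<theta>\<^sub>\<rho>\<close> for which the maximum at \<open>\<theta>\<^sub>\<delta>\<close> exceeds \<open>z\<close>.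
The past enters through \<open>w 0 + \<rho>\<close>, which is the maximum at \<open>\<theta>\<^sub>\<rho>\<close>.
\<close>

definition continuation_set :: "real \<Rightarrow> real \<Rightarrow> real \<Rightarrow> (real \<Rightarrow> ereal) set" where
  "continuation_set \<rho> \<delta> z = climb_set \<delta> (\<lambda>w. w 0 + ereal \<rho>) z \<union>
    {w \<in> space (Pi\<^sub>M {0..} (\<lambda>_. borel)). ereal z < w 0 + ereal \<rho>}"

lemma continuation_set_sets: "continuation_set \<rho> \<delta> z \<in> sets (Pi\<^sub>M {0..} (\<lambda>_. borel))"
proof -
  have "(\<lambda>w::real \<Rightarrow> ereal. w 0 + ereal \<rho>) \<in> borel_measurable (Pi\<^sub>M {0..} (\<lambda>_. borel))"
    by (intro borel_measurable_ereal_add measurable_component_singleton borel_measurable_const) auto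
  then show ?thesis
    unfolding continuation_set_def
    by (intro sets.Un climb_set_sets borel_measurable_less borel_measurable_const)
qed

lemma path_from_in_continuation_set:
  assumes \<omega>: "\<omega> \<in> space N" and s: "0 \<le> s" and \<delta>: "0 \<le> \<delta>" and X: "X s \<omega> = ereal (y - \<rho>)"
  shows "path_from X s \<omega> \<in> continuation_set \<rho> \<delta> z \<longleftrightarrow>
    z < y \<or> climbs {0..} \<delta> (ereal y) z (path_from X s \<omega>)"
proof -
  have w: "path_from X s \<omega> \<in> space (Pi\<^sub>M {0..} (\<lambda>_. borel))"
    by (simp add: space_PiM path_from_def)
  have w0: "path_from X s \<omega> 0 + ereal \<rho> = ereal y" using X by simp
  show ?thesis
    using path_from_in_climb_set[OF \<omega> s \<delta>, of "\<lambda>w. w 0 + ereal \<rho>" z] w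
    unfolding continuation_set_def Un_iff mem_Collect_eq w0 by auto
qed

text \<open>
For \<open>z < y\<close> both sides are 1.  For \<open>y \<le> z\<close> the path has to regain \<open>y\<close> and then to climb
beyond \<open>z\<close>, and the probabilities multiply.
\<close>

lemma exit_kernel_tail:
  assumes \<rho>: "0 < \<rho>" "\<rho> < \<delta>" and fin: "AE \<omega> in P y. drawdown_time X \<delta> \<omega> < \<infinity>"
  shows "emeasure (P (y - \<rho>)) {\<omega> \<in> space N. path_from X 0 \<omega> \<in> continuation_set \<rho> \<delta> z} =
    exit_kernel \<rho> \<delta> y {z<..}" (is "emeasure _ ?V = _")
proof -
  have \<delta>: "0 < \<delta>" using \<rho> by simp
  interpret Py: prob_space "P y" by (rule prob_space_P)
  interpret Px: prob_space "P (y - \<rho>)" by (rule prob_space_P)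
  have in_V: "\<omega> \<in> ?V \<longleftrightarrow> z < y \<or> climbs {0..} \<delta> (ereal y) z (path \<omega>)"
    if "\<omega> \<in> space N" "X 0 \<omega> = ereal (y - \<rho>)" for \<omega>
    using path_from_in_continuation_set[of \<omega> 0 \<delta> y \<rho> z] that \<delta> by simp
  have V: "?V \<in> sets N"
    using measurable_sets[OF measurable_path_from[of "\<lambda>_. 0"] continuation_set_sets]
    by (simp add: vimage_def Int_def conj_commute)
  let ?p = "recovery_prob \<rho> \<delta> y"
  note p = recovery_prob_bounds[OF \<rho>, of y]
  show ?thesis
  proof (cases "z < y")
    case True
    have "AE \<omega> in P (y - \<rho>). \<omega> \<in> ?V" by (rule AE_P_I) (use in_V True in blast)
    then have "emeasure (P (y - \<rho>)) ?V = 1" using V by (intro Px.emeasure_eq_1_AE) auto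
    moreover have "emeasure (P y) {\<omega> \<in> space N. max_at_drawdown X \<delta> \<omega> \<in> {z<..}} = 1"
      using AE_start_le_max[OF \<delta>, of y] AE_space[of "P y"] True max_in_sets[OF \<delta>, of "{z<..}"]
      by (intro Py.emeasure_eq_1_AE) auto
    ultimately show ?thesis
      using True p by (simp add: exit_kernel_def flip: ennreal_plus)
  next
    case False
    have "measure (P (y - \<rho>)) ?V = measure (P (y - \<rho>)) {\<omega> \<in> space N. climbs {0..} \<delta> (ereal y) z (path \<omega>)}"
    proof (rule measure_eq_AE)
      show "AE \<omega> in P (y - \<rho>). \<omega> \<in> ?V \<longleftrightarrow> \<omega> \<in> {\<omega> \<in> space N. climbs {0..} \<delta> (ereal y) z (path \<omega>)}"
      proof (rule AE_P_I)
        fix \<omega> assume \<omega>: "\<omega> \<in> space N" "X 0 \<omega> = ereal (y - \<rho>)"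
        show "\<omega> \<in> ?V \<longleftrightarrow> \<omega> \<in> {\<omega> \<in> space N. climbs {0..} \<delta> (ereal y) z (path \<omega>)}"
          unfolding in_V[OF \<omega>] using False \<omega>(1) by simp
      qed
    qed (use V climbs_sets \<delta> in auto)
    also have "\<dots> = ?p * climb_prob \<delta> y z"
      unfolding recovery_prob_def using False \<rho> by (intro climb_prob_from_below) auto
    also have "climb_prob \<delta> y z = measure (P y) {\<omega> \<in> space N. z < max_at_drawdown X \<delta> \<omega>}"
      by (rule prob_max_at_drawdown_greater[OF \<delta> fin, symmetric])
    finally show ?thesis
      using False p by (simp add: exit_kernel_def Px.emeasure_eq_measure Py.emeasure_eq_measure ennreal_mult)
  qed
qed

lemma markov_at_drawdown_tail:
  assumes \<rho>: "0 < \<rho>" "\<rho> < \<delta>" and fin: "\<And>d. 0 < d \<Longrightarrow> AE \<omega> in P x. drawdown_time X d \<omega> < \<infinity>"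
    and A: "A \<in> sets (sigma_at N X (drawdown_time X \<rho>))"
  shows "emeasure (P x) {\<omega> \<in> A. max_at_drawdown X \<delta> \<omega> \<in> {z<..}} =
    (\<integral>\<^sup>+\<omega>. indicator A \<omega> * exit_kernel \<rho> \<delta> (max_at_drawdown X \<rho> \<omega>) {z<..} \<partial>P x)"
proof -
  have \<delta>: "0 < \<delta>" using \<rho> by simp
  define \<tau> where "\<tau> = drawdown_time X \<rho>"
  define T where "T \<omega> = enn2real (\<tau> \<omega>)" for \<omega>
  define y where "y = max_at_drawdown X \<rho>"
  let ?B = "continuation_set \<rho> \<delta> z"
  note B = continuation_set_sets[of \<rho> \<delta> z]
  have AN: "A \<in> sets N" using A sets_sigma_at_subset by auto
  then have A_space: "\<omega> \<in> space N" if "\<omega> \<in> A" for \<omega> using sets.sets_into_space that by blast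
  have \<tau>: "\<tau> \<in> borel_measurable N"
    unfolding \<tau>_def by (rule borel_measurable_markov_time[OF markov_time_drawdown[OF \<rho>(1)]])
  have at: "\<tau> \<omega> < \<infinity> \<Longrightarrow> \<omega> \<in> space N \<Longrightarrow> X (T \<omega>) \<omega> = ereal (y \<omega> - \<rho>)" for \<omega>
    using at_drawdown_time(2)[OF _ \<rho>(1), of \<omega>] unfolding T_def \<tau>_def y_def by simp
  have in_B: "path_from X (T \<omega>) \<omega> \<in> ?B \<longleftrightarrow> z < max_at_drawdown X \<delta> \<omega>"
    if "\<omega> \<in> space N" "\<tau> \<omega> < \<infinity>" "drawdown_time X \<delta> \<omega> < \<infinity>" for \<omega>
  proof -
    have "path_from X (T \<omega>) \<omega> \<in> ?B \<longleftrightarrow> z < y \<omega> \<or> climbs {0..} \<delta> (ereal (y \<omega>)) z (path_from X (T \<omega>) \<omega>)"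
      using path_from_in_continuation_set[OF that(1), of "T \<omega>" \<delta> "y \<omega>" \<rho> z] at[OF that(2,1)] \<delta>
      by (simp add: T_def)
    also have "\<dots> \<longleftrightarrow> z < max_at_drawdown X \<delta> \<omega>"
      using less_later_max_iff[OF that(1) \<rho>(1), of \<delta> z] that \<rho> unfolding T_def \<tau>_def y_def by simp
    finally show ?thesis .
  qed
  have E: "{\<omega> \<in> A. \<tau> \<omega> < \<infinity> \<and> \<bar>X (T \<omega>) \<omega>\<bar> \<noteq> \<infinity> \<and> path_from X (T \<omega>) \<omega> \<in> ?B} \<in> sets N"
  proof -
    have "{\<omega> \<in> A. \<tau> \<omega> < \<infinity> \<and> \<bar>X (T \<omega>) \<omega>\<bar> \<noteq> \<infinity> \<and> path_from X (T \<omega>) \<omega> \<in> ?B} =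
      A \<inter> (\<tau> -` {..<\<infinity>} \<inter> space N) \<inter> ((\<lambda>\<omega>. path_from X (T \<omega>) \<omega>) -` ?B \<inter> space N)"
    proof (rule set_eqI)
      fix \<omega>
      show "\<omega> \<in> {\<omega> \<in> A. \<tau> \<omega> < \<infinity> \<and> \<bar>X (T \<omega>) \<omega>\<bar> \<noteq> \<infinity> \<and> path_from X (T \<omega>) \<omega> \<in> ?B} \<longleftrightarrow>
        \<omega> \<in> A \<inter> (\<tau> -` {..<\<infinity>} \<inter> space N) \<inter> ((\<lambda>\<omega>. path_from X (T \<omega>) \<omega>) -` ?B \<inter> space N)"
        using A_space[of \<omega>] at[of \<omega>] by (cases "\<omega> \<in> A"; cases "\<tau> \<omega> < \<infinity>") simp_all
    qed
    also have "\<dots> \<in> sets N"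
      unfolding T_def by (intro sets.Int AN measurable_sets[OF \<tau>] measurable_sets[OF measurable_path_from[OF \<tau>] B]) simp
    finally show ?thesis .
  qed
  have D: "{\<omega> \<in> A. max_at_drawdown X \<delta> \<omega> \<in> {z<..}} \<in> sets N"
  proof -
    have "{\<omega> \<in> A. max_at_drawdown X \<delta> \<omega> \<in> {z<..}} = A \<inter> {\<omega> \<in> space N. max_at_drawdown X \<delta> \<omega> \<in> {z<..}}"
      using A_space by auto
    then show ?thesis using AN max_in_sets[OF \<delta>, of "{z<..}"] by simp
  qed
  have "emeasure (P x) {\<omega> \<in> A. max_at_drawdown X \<delta> \<omega> \<in> {z<..}} =
      emeasure (P x) {\<omega> \<in> A. \<tau> \<omega> < \<infinity> \<and> \<bar>X (T \<omega>) \<omega>\<bar> \<noteq> \<infinity> \<and> path_from X (T \<omega>) \<omega> \<in> ?B}"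
  proof (rule emeasure_eq_AE)
    show "AE \<omega> in P x. \<omega> \<in> {\<omega> \<in> A. max_at_drawdown X \<delta> \<omega> \<in> {z<..}} \<longleftrightarrow>
      \<omega> \<in> {\<omega> \<in> A. \<tau> \<omega> < \<infinity> \<and> \<bar>X (T \<omega>) \<omega>\<bar> \<noteq> \<infinity> \<and> path_from X (T \<omega>) \<omega> \<in> ?B}"
      using fin[OF \<rho>(1), folded \<tau>_def] fin[OF \<delta>] AE_space
    proof eventually_elim
      case (elim \<omega>)
      then have "\<omega> \<in> space N" by simp
      note \<omega> = in_B[OF this elim(1,2)] at[OF elim(1) this]
      show ?case unfolding mem_Collect_eq \<omega>(1) using elim(1) \<omega>(2) by simp
    qed
  qed (use D E in auto)
  also have "\<dots> = (\<integral>\<^sup>+\<omega>. indicator {\<omega> \<in> A. \<tau> \<omega> < \<infinity> \<and> \<bar>X (T \<omega>) \<omega>\<bar> \<noteq> \<infinity>} \<omega> *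
           emeasure (P (real_of_ereal (X (T \<omega>) \<omega>))) {\<omega>' \<in> space N. path_from X 0 \<omega>' \<in> ?B} \<partial>P x)"
    unfolding T_def \<tau>_def
    by (rule strong_markov[OF markov_time_drawdown[OF \<rho>(1)] A B])
  also have "\<dots> = (\<integral>\<^sup>+\<omega>. indicator A \<omega> * exit_kernel \<rho> \<delta> (y \<omega>) {z<..} \<partial>P x)"
  proof (rule nn_integral_cong_AE)
    show "AE \<omega> in P x. indicator {\<omega> \<in> A. \<tau> \<omega> < \<infinity> \<and> \<bar>X (T \<omega>) \<omega>\<bar> \<noteq> \<infinity>} \<omega> *
           emeasure (P (real_of_ereal (X (T \<omega>) \<omega>))) {\<omega>' \<in> space N. path_from X 0 \<omega>' \<in> ?B} =
        indicator A \<omega> * exit_kernel \<rho> \<delta> (y \<omega>) {z<..}"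
      using fin[OF \<rho>(1), folded \<tau>_def] AE_space AE_start_le_max[OF \<rho>(1), of x, folded y_def]
    proof eventually_elim
      case (elim \<omega>)
      then have "\<omega> \<in> space N" by simp
      note X_T = at[OF elim(1) this]
      have "AE \<omega> in P (y \<omega>). drawdown_time X \<delta> \<omega> < \<infinity>"
        by (rule drawdown_finite_above[OF fin[OF \<delta>] \<delta> elim(3)])
      from exit_kernel_tail[OF \<rho> this, of z] show ?case
        using elim(1) X_T by (simp add: indicator_def)
    qed
  qed
  finally show ?thesis unfolding y_def .
qed

text \<open>
Half lines determine the law: they are stable under intersection and generate the Borel sets, and the
equation is preserved under complements and countable disjoint unions.
\<close>

lemma markov_at_drawdown:
  assumes \<rho>: "0 < \<rho>" "\<rho> < \<delta>" and fin: "\<And>d. 0 < d \<Longrightarrow> AE \<omega> in P x. drawdown_time X d \<omega> < \<infinity>"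
    and A: "A \<in> sets (sigma_at N X (drawdown_time X \<rho>))" and B: "B \<in> sets borel"
  shows "emeasure (P x) {\<omega> \<in> A. max_at_drawdown X \<delta> \<omega> \<in> B} =
    (\<integral>\<^sup>+\<omega>. indicator A \<omega> * exit_kernel \<rho> \<delta> (max_at_drawdown X \<rho> \<omega>) B \<partial>P x)"
proof -
  interpret prob_space "P x" by (rule prob_space_P)
  have \<delta>: "0 < \<delta>" using \<rho> by simp
  define y where "y = max_at_drawdown X \<rho>"
  have AN: "A \<in> sets N" using A sets_sigma_at_subset by auto
  have y[measurable]: "y \<in> borel_measurable (P x)"
    unfolding y_def using borel_measurable_max_at_drawdown[OF \<rho>(1)] by simp
  have W: "(\<lambda>\<omega>. indicator A \<omega> * exit_kernel \<rho> \<delta> (y \<omega>) B) \<in> borel_measurable (P x)" if "B \<in> sets borel" for B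
    using AN by (intro borel_measurable_times_ennreal borel_measurable_indicator
        measurable_compose[OF y borel_exit_kernel[OF \<rho> that]]) simp
  have D: "{\<omega> \<in> A. max_at_drawdown X \<delta> \<omega> \<in> B} \<in> sets (P x)" if "B \<in> sets borel" for B
  proof -
    have "{\<omega> \<in> A. max_at_drawdown X \<delta> \<omega> \<in> B} = A \<inter> {\<omega> \<in> space N. max_at_drawdown X \<delta> \<omega> \<in> B}"
      using sets.sets_into_space[OF AN] by auto
    then show ?thesis using AN max_in_sets[OF \<delta> that] by simp
  qed
  have borel: "sigma_sets UNIV (range greaterThan) = sets (borel :: real measure)"
    by (simp add: borel_Ioi sets_measure_of)
  have "Int_stable (range (greaterThan :: real \<Rightarrow> real set))"
  proof (rule Int_stableI_image)
    fix i j :: real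
    show "\<exists>k\<in>UNIV. {i<..} \<inter> {j<..} = {k<..}" by (intro bexI[of _ "max i j"]) auto
  qed
  moreover have "range (greaterThan :: real \<Rightarrow> real set) \<subseteq> Pow UNIV" by simp
  moreover have "B \<in> sigma_sets UNIV (range greaterThan)" using B unfolding borel .
  ultimately have "emeasure (P x) {\<omega> \<in> A. max_at_drawdown X \<delta> \<omega> \<in> B} =
    (\<integral>\<^sup>+\<omega>. indicator A \<omega> * exit_kernel \<rho> \<delta> (y \<omega>) B \<partial>P x)"
  proof (induction rule: sigma_sets_induct_disjoint)
    case (basic B)
    then show ?case using markov_at_drawdown_tail[OF \<rho> fin A] unfolding y_def by auto
  next
    case empty
    then show ?case by (simp add: exit_kernel_def)
  next
    case (compl B)
    then have B: "B \<in> sets borel" using borel by simp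
    then have B': "UNIV - B \<in> sets borel" by simp
    let ?e = "\<lambda>B. emeasure (P x) {\<omega> \<in> A. max_at_drawdown X \<delta> \<omega> \<in> B}"
    let ?i = "\<lambda>B. \<integral>\<^sup>+\<omega>. indicator A \<omega> * exit_kernel \<rho> \<delta> (y \<omega>) B \<partial>P x"
    have "?e B + ?e (UNIV - B) =
        emeasure (P x) ({\<omega> \<in> A. max_at_drawdown X \<delta> \<omega> \<in> B} \<union> {\<omega> \<in> A. max_at_drawdown X \<delta> \<omega> \<in> UNIV - B})"
      using D[OF B] D[OF B'] by (intro plus_emeasure) auto
    also have "\<dots> = emeasure (P x) A" by (intro arg_cong[where f = "emeasure (P x)"]) auto
    also have "\<dots> = (\<integral>\<^sup>+\<omega>. indicator A \<omega> * exit_kernel \<rho> \<delta> (y \<omega>) B + indicator A \<omega> * exit_kernel \<rho> \<delta> (y \<omega>) (UNIV - B) \<partial>P x)"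
      using AN by (simp add: distrib_left[symmetric] exit_kernel_add_compl[OF \<rho> B])
    also have "\<dots> = ?i B + ?i (UNIV - B)" by (rule nn_integral_add[OF W[OF B] W[OF B']])
    finally have "?e B + ?e (UNIV - B) = ?e B + ?i (UNIV - B)" using compl by simp
    then show ?case by (simp add: ennreal_add_left_cancel)
  next
    case (union B)
    then have B: "range B \<subseteq> sets borel" using borel by simp
    have "emeasure (P x) {\<omega> \<in> A. max_at_drawdown X \<delta> \<omega> \<in> (\<Union>i. B i)} =
        emeasure (P x) (\<Union>i. {\<omega> \<in> A. max_at_drawdown X \<delta> \<omega> \<in> B i})"
      by (intro arg_cong[where f = "emeasure (P x)"]) auto
    also have "\<dots> = (\<Sum>i. emeasure (P x) {\<omega> \<in> A. max_at_drawdown X \<delta> \<omega> \<in> B i})"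
    proof (rule suminf_emeasure[symmetric])
      show "range (\<lambda>i. {\<omega> \<in> A. max_at_drawdown X \<delta> \<omega> \<in> B i}) \<subseteq> sets (P x)" using D B by blast
      show "disjoint_family (\<lambda>i. {\<omega> \<in> A. max_at_drawdown X \<delta> \<omega> \<in> B i})"
        using union(1) unfolding disjoint_family_on_def by blast
    qed
    also have "\<dots> = (\<Sum>i. \<integral>\<^sup>+\<omega>. indicator A \<omega> * exit_kernel \<rho> \<delta> (y \<omega>) (B i) \<partial>P x)"
      using union by simp
    also have "\<dots> = (\<integral>\<^sup>+\<omega>. (\<Sum>i. indicator A \<omega> * exit_kernel \<rho> \<delta> (y \<omega>) (B i)) \<partial>P x)"
      using W B by (intro nn_integral_suminf[symmetric]) blast
    also have "\<dots> = (\<integral>\<^sup>+\<omega>. indicator A \<omega> * exit_kernel \<rho> \<delta> (y \<omega>) (\<Union>i. B i) \<partial>P x)"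
      by (simp add: exit_kernel_UN[OF \<rho> union(1) B])
    finally show ?case .
  qed
  then show ?thesis unfolding y_def .
qed

end

section \<open>The conditional expectation\<close>

context diffusion_with_scale
begin

text \<open>
Extension from indicator functions, where \<open>E\<close> is the kernel of the previous section, to nonnegative
functions by linearity and monotone convergence.
\<close>

lemma nn_integral_markov_at_drawdown:
  assumes \<rho>: "0 < \<rho>" "\<rho> < \<delta>" and fin: "\<And>d. 0 < d \<Longrightarrow> AE \<omega> in P x. drawdown_time X d \<omega> < \<infinity>"
    and A: "A \<in> sets (sigma_at N X (drawdown_time X \<rho>))"
    and f: "f \<in> borel_measurable borel"
  defines "E \<equiv> \<lambda>f y. ennreal (1 - recovery_prob \<rho> \<delta> y) * f y +
      ennreal (recovery_prob \<rho> \<delta> y) * (\<integral>\<^sup>+\<omega>. f (max_at_drawdown X \<delta> \<omega>) \<partial>P y)"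
  shows "(\<integral>\<^sup>+\<omega>. indicator A \<omega> * f (max_at_drawdown X \<delta> \<omega>) \<partial>P x) =
    (\<integral>\<^sup>+\<omega>. indicator A \<omega> * E f (max_at_drawdown X \<rho> \<omega>) \<partial>P x)"
proof -
  have \<delta>: "0 < \<delta>" using \<rho> by simp
  let ?M = "max_at_drawdown X \<delta>" and ?y = "max_at_drawdown X \<rho>"
  have AN[measurable]: "A \<in> sets N" using A sets_sigma_at_subset by auto
  note [measurable] = borel_measurable_max_at_drawdown[OF \<delta>] borel_measurable_max_at_drawdown[OF \<rho>(1)]
    borel_recovery_prob[OF \<rho>] kernel_subprob
  have E[measurable]: "E f \<in> borel_measurable borel" if [measurable]: "f \<in> borel_measurable borel" for f
    unfolding E_def by measurable
  show ?thesis
    using f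
  proof (induction rule: borel_measurable_induct)
    case (cong f g)
    then have "f = g" by auto
    then show ?case using cong by simp
  next
    case (set B)
    have "(\<integral>\<^sup>+\<omega>. indicator A \<omega> * indicator B (?M \<omega>) \<partial>P x) = (\<integral>\<^sup>+\<omega>. indicator {\<omega> \<in> A. ?M \<omega> \<in> B} \<omega> \<partial>P x)"
      by (intro nn_integral_cong) (auto simp: indicator_def)
    also have "\<dots> = emeasure (P x) {\<omega> \<in> A. ?M \<omega> \<in> B}"
    proof (rule nn_integral_indicator)
      have "{\<omega> \<in> A. ?M \<omega> \<in> B} = A \<inter> {\<omega> \<in> space N. ?M \<omega> \<in> B}"
        using sets.sets_into_space[OF AN] by auto
      then show "{\<omega> \<in> A. ?M \<omega> \<in> B} \<in> sets (P x)" using AN max_in_sets[OF \<delta> set] by simp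
    qed
    also have "\<dots> = (\<integral>\<^sup>+\<omega>. indicator A \<omega> * exit_kernel \<rho> \<delta> (?y \<omega>) B \<partial>P x)"
      by (rule markov_at_drawdown[OF \<rho> fin A set])
    also have "(\<lambda>y. exit_kernel \<rho> \<delta> y B) = E (indicator B)"
    proof
      fix y
      have "(\<integral>\<^sup>+\<omega>. indicator B (?M \<omega>) \<partial>P y) = (\<integral>\<^sup>+\<omega>. indicator {\<omega> \<in> space N. ?M \<omega> \<in> B} \<omega> \<partial>P y)"
        by (intro nn_integral_cong) (auto simp: indicator_def)
      also have "\<dots> = emeasure (P y) {\<omega> \<in> space N. ?M \<omega> \<in> B}"
        by (rule nn_integral_indicator) (simp add: max_in_sets[OF \<delta> set])
      finally show "exit_kernel \<rho> \<delta> y B = E (indicator B) y" by (simp add: exit_kernel_def E_def)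
    qed
    finally show ?case .
  next
    case (mult u c)
    note [measurable] = mult.hyps(2)
    have "E (\<lambda>x. c * u x) = (\<lambda>y. c * E u y)"
      unfolding E_def by (simp add: nn_integral_cmult distrib_left mult_ac)
    then show ?case using mult.IH by (simp add: nn_integral_cmult mult.left_commute[of _ c])
  next
    case (add u v)
    note [measurable] = add.hyps(1,3)
    have "(\<integral>\<^sup>+\<omega>. v (?M \<omega>) + u (?M \<omega>) \<partial>P y) = (\<integral>\<^sup>+\<omega>. v (?M \<omega>) \<partial>P y) + (\<integral>\<^sup>+\<omega>. u (?M \<omega>) \<partial>P y)" for y
      by (rule nn_integral_add) measurable
    then have "E (\<lambda>x. v x + u x) = (\<lambda>y. E v y + E u y)"
      unfolding E_def by (simp only: distrib_left add_ac)
    then show ?case using add.IH by (simp add: nn_integral_add distrib_left)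
  next
    case (seq U)
    note [measurable] = seq.hyps(1)
    have inc: "incseq (\<lambda>i. U i t)" for t using seq.hyps(3) by (auto simp: mono_def le_fun_def)
    have inc_M: "incseq (\<lambda>i \<omega>. U i (?M \<omega>))" using seq.hyps(3) by (auto simp: mono_def le_fun_def)
    have inc_I: "incseq (\<lambda>i. \<integral>\<^sup>+\<omega>. U i (?M \<omega>) \<partial>P y)" for y
      using seq.hyps(3) by (auto simp: mono_def le_fun_def intro!: nn_integral_mono)
    have inc_E: "incseq (\<lambda>i. E (U i) y)" for y
      unfolding E_def using inc inc_I
      by (auto simp: mono_def intro!: add_mono mult_left_mono)
    have E_SUP: "E (SUP i. U i) y = (SUP i. E (U i) y)" for y
    proof -
      have I: "(\<integral>\<^sup>+\<omega>. (SUP i. U i (?M \<omega>)) \<partial>P y) = (SUP i. \<integral>\<^sup>+\<omega>. U i (?M \<omega>) \<partial>P y)"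
        using nn_integral_monotone_convergence_SUP[OF inc_M, of "P y"] by simp
      show ?thesis
        unfolding E_def SUP_apply I SUP_mult_left_ennreal
        using inc inc_I by (intro ennreal_SUP_add[symmetric]) (auto simp: mono_def intro!: mult_left_mono)
    qed
    have "(\<integral>\<^sup>+\<omega>. indicator A \<omega> * (SUP i. U i) (?M \<omega>) \<partial>P x) = (\<integral>\<^sup>+\<omega>. (SUP i. indicator A \<omega> * U i (?M \<omega>)) \<partial>P x)"
      by (simp add: SUP_mult_left_ennreal image_comp)
    also have "\<dots> = (SUP i. \<integral>\<^sup>+\<omega>. indicator A \<omega> * U i (?M \<omega>) \<partial>P x)"
      using inc by (intro nn_integral_monotone_convergence_SUP) (auto simp: mono_def le_fun_def intro!: mult_left_mono)
    also have "\<dots> = (SUP i. \<integral>\<^sup>+\<omega>. indicator A \<omega> * E (U i) (?y \<omega>) \<partial>P x)" using seq.IH by simp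
    also have "\<dots> = (\<integral>\<^sup>+\<omega>. (SUP i. indicator A \<omega> * E (U i) (?y \<omega>)) \<partial>P x)"
      using inc_E by (intro nn_integral_monotone_convergence_SUP[symmetric]) (auto simp: mono_def le_fun_def intro!: mult_left_mono)
    also have "\<dots> = (\<integral>\<^sup>+\<omega>. indicator A \<omega> * E (SUP i. U i) (?y \<omega>) \<partial>P x)"
      by (simp add: SUP_mult_left_ennreal E_SUP)
    finally show ?case .
  qed
qed

text \<open>
Integrability from all starting points above \<open>x\<close> is what lets the nonnegative integral inside \<open>E\<close> be
read as the Lebesgue integral inside \<open>Q\<close>, which would be 0 by convention if it diverged.
\<close>

lemma cond_exp_nonneg:
  assumes \<rho>: "0 < \<rho>" "\<rho> < \<delta>" and fin: "\<And>d. 0 < d \<Longrightarrow> AE \<omega> in P x. drawdown_time X d \<omega> < \<infinity>"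
    and f: "f \<in> borel_measurable borel" "\<And>y. 0 \<le> f y"
    and int: "\<And>y. x \<le> y \<Longrightarrow> integrable (P y) (\<lambda>\<omega>. f (max_at_drawdown X \<delta> \<omega>))"
  shows "AE \<omega> in P x. real_cond_exp (P x) (sigma_at N X (drawdown_time X \<rho>)) (\<lambda>\<omega>. f (max_at_drawdown X \<delta> \<omega>)) \<omega>
        = Q P X \<rho> \<delta> (max_at_drawdown X \<rho> \<omega>) f"
proof -
  have \<delta>: "0 < \<delta>" using \<rho> by simp
  let ?F = "sigma_at N X (drawdown_time X \<rho>)"
  let ?M = "max_at_drawdown X \<delta>" and ?y = "max_at_drawdown X \<rho>"
  let ?g = "\<lambda>\<omega>. Q P X \<rho> \<delta> (?y \<omega>) f"
  interpret prob_space "P x" by (rule prob_space_P)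
  interpret finite_measure_subalgebra "P x" ?F
    by unfold_locales (simp add: subalgebra_def sets_sigma_at_subset)
  note [measurable] = f(1) borel_measurable_max_at_drawdown[OF \<delta>] borel_measurable_max_at_drawdown[OF \<rho>(1)]
    borel_Q[OF \<rho> f(1)]
  note p = recovery_prob_bounds[OF \<rho>]
  have g_nonneg: "0 \<le> Q P X \<rho> \<delta> y f" for y
    unfolding Q_eq[OF \<rho>] using p f(2) by (intro add_nonneg_nonneg mult_nonneg_nonneg integral_nonneg_AE) auto
  have Q: "ennreal (Q P X \<rho> \<delta> y f) = ennreal (1 - recovery_prob \<rho> \<delta> y) * ennreal (f y) +
      ennreal (recovery_prob \<rho> \<delta> y) * (\<integral>\<^sup>+\<omega>. ennreal (f (?M \<omega>)) \<partial>P y)" if "x \<le> y" for y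
  proof -
    let ?p = "recovery_prob \<rho> \<delta> y" and ?I = "\<integral>\<omega>. f (?M \<omega>) \<partial>P y"
    have I: "0 \<le> ?I" using f(2) by (intro integral_nonneg_AE) auto
    have "(\<integral>\<^sup>+\<omega>. ennreal (f (?M \<omega>)) \<partial>P y) = ennreal ?I"
      using int[OF that] f(2) by (intro nn_integral_eq_integral) auto
    moreover have "ennreal (f y * (1 - ?p) + ?I * ?p) = ennreal ((1 - ?p) * f y) + ennreal (?p * ?I)"
      unfolding mult.commute[of "f y"] mult.commute[of ?I]
      by (intro ennreal_plus mult_nonneg_nonneg) (use p[of y] f(2) I in auto)
    moreover have "ennreal ((1 - ?p) * f y) = ennreal (1 - ?p) * ennreal (f y)"
      "ennreal (?p * ?I) = ennreal ?p * ennreal ?I"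
      by (intro ennreal_mult; use p[of y] f(2) I in auto)+
    ultimately show ?thesis unfolding Q_eq[OF \<rho>] by simp
  qed
  have nn: "(\<integral>\<^sup>+\<omega>. indicator A \<omega> * ennreal (f (?M \<omega>)) \<partial>P x) = (\<integral>\<^sup>+\<omega>. indicator A \<omega> * ennreal (?g \<omega>) \<partial>P x)"
    if A: "A \<in> sets ?F" for A
  proof -
    have "AE \<omega> in P x. ennreal (?g \<omega>) = ennreal (1 - recovery_prob \<rho> \<delta> (?y \<omega>)) * ennreal (f (?y \<omega>)) +
      ennreal (recovery_prob \<rho> \<delta> (?y \<omega>)) * (\<integral>\<^sup>+\<omega>. ennreal (f (?M \<omega>)) \<partial>P (?y \<omega>))"
      using AE_start_le_max[OF \<rho>(1), of x] by eventually_elim (rule Q)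
    then have "(\<integral>\<^sup>+\<omega>. indicator A \<omega> * ennreal (?g \<omega>) \<partial>P x) =
      (\<integral>\<^sup>+\<omega>. indicator A \<omega> * (ennreal (1 - recovery_prob \<rho> \<delta> (?y \<omega>)) * ennreal (f (?y \<omega>)) +
      ennreal (recovery_prob \<rho> \<delta> (?y \<omega>)) * (\<integral>\<^sup>+\<omega>. ennreal (f (?M \<omega>)) \<partial>P (?y \<omega>))) \<partial>P x)"
      by (intro nn_integral_cong_AE) auto
    then show ?thesis
      using nn_integral_markov_at_drawdown[OF \<rho> fin A, of "\<lambda>t. ennreal (f t)"] by simp
  qed
  have int_f: "integrable (P x) (\<lambda>\<omega>. f (?M \<omega>))" by (rule int) simp
  have "(\<integral>\<^sup>+\<omega>. ennreal (?g \<omega>) \<partial>P x) = (\<integral>\<^sup>+\<omega>. ennreal (f (?M \<omega>)) \<partial>P x)"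
  proof -
    have "(\<integral>\<^sup>+\<omega>. ennreal (?g \<omega>) \<partial>P x) = (\<integral>\<^sup>+\<omega>. indicator (space N) \<omega> * ennreal (?g \<omega>) \<partial>P x)"
      by (intro nn_integral_cong) simp
    also have "\<dots> = (\<integral>\<^sup>+\<omega>. indicator (space N) \<omega> * ennreal (f (?M \<omega>)) \<partial>P x)"
      using nn[of "space N"] sets.top[of ?F] by simp
    also have "\<dots> = (\<integral>\<^sup>+\<omega>. ennreal (f (?M \<omega>)) \<partial>P x)" by (intro nn_integral_cong) simp
    finally show ?thesis .
  qed
  also have "\<dots> < \<infinity>" using int_f f(2) by (simp add: integrable_iff_bounded)
  finally have int_g: "integrable (P x) ?g" using g_nonneg by (intro integrableI_nonneg) auto
  show ?thesis
  proof (rule real_cond_exp_charact[OF _ int_f int_g])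
    show "?g \<in> borel_measurable ?F"
      by (rule measurable_compose[OF measurable_max_at_drawdown[OF \<rho>(1)] borel_Q[OF \<rho> f(1)]])
    fix A assume A: "A \<in> sets ?F"
    then have AN[measurable]: "A \<in> sets N" using sets_sigma_at_subset by auto
    have "(LINT \<omega>:A|P x. h \<omega>) = enn2real (\<integral>\<^sup>+\<omega>. indicator A \<omega> * ennreal (h \<omega>) \<partial>P x)"
      if [measurable]: "h \<in> borel_measurable N" and "\<And>\<omega>. 0 \<le> h \<omega>" for h
      unfolding set_lebesgue_integral_def using that(2)
      by (subst integral_eq_nn_integral) (auto simp: indicator_def intro!: arg_cong[where f = enn2real] nn_integral_cong)
    then show "(LINT \<omega>:A|P x. f (?M \<omega>)) = (LINT \<omega>:A|P x. ?g \<omega>)"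
      using nn[OF A] f(2) g_nonneg by simp
  qed
qed

theorem cond_exp_max_at_drawdown:
  assumes \<rho>: "0 < \<rho>" "\<rho> < \<delta>" and fin: "\<And>d. 0 < d \<Longrightarrow> AE \<omega> in P x. drawdown_time X d \<omega> < \<infinity>"
    and f: "f \<in> borel_measurable borel"
    and int: "\<And>y. x \<le> y \<Longrightarrow> integrable (P y) (\<lambda>\<omega>. f (max_at_drawdown X \<delta> \<omega>))"
  shows "AE \<omega> in P x. real_cond_exp (P x) (sigma_at N X (drawdown_time X \<rho>)) (\<lambda>\<omega>. f (max_at_drawdown X \<delta> \<omega>)) \<omega>
        = Q P X \<rho> \<delta> (max_at_drawdown X \<rho> \<omega>) f"
proof -
  let ?F = "sigma_at N X (drawdown_time X \<rho>)" and ?M = "max_at_drawdown X \<delta>"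
  let ?pos = "\<lambda>t. max 0 (f t)" and ?neg = "\<lambda>t. max 0 (- f t)"
  interpret prob_space "P x" by (rule prob_space_P)
  interpret finite_measure_subalgebra "P x" ?F
    by unfold_locales (simp add: subalgebra_def sets_sigma_at_subset)
  note [measurable] = f
  have int_pos: "integrable (P y) (\<lambda>\<omega>. ?pos (?M \<omega>))" and int_neg: "integrable (P y) (\<lambda>\<omega>. ?neg (?M \<omega>))"
    if "x \<le> y" for y using int[OF that] by auto
  have f_M: "(\<lambda>\<omega>. f (?M \<omega>)) = (\<lambda>\<omega>. ?pos (?M \<omega>) - ?neg (?M \<omega>))" by (auto simp: max_def)
  have "AE \<omega> in P x. real_cond_exp (P x) ?F (\<lambda>\<omega>. f (?M \<omega>)) \<omega> =
      real_cond_exp (P x) ?F (\<lambda>\<omega>. ?pos (?M \<omega>)) \<omega> - real_cond_exp (P x) ?F (\<lambda>\<omega>. ?neg (?M \<omega>)) \<omega>"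
    by (subst f_M) (rule real_cond_exp_diff[OF int_pos int_neg]; simp)
  moreover have "AE \<omega> in P x. real_cond_exp (P x) ?F (\<lambda>\<omega>. ?pos (?M \<omega>)) \<omega> = Q P X \<rho> \<delta> (max_at_drawdown X \<rho> \<omega>) ?pos"
    by (rule cond_exp_nonneg[OF \<rho> fin _ _ int_pos]) auto
  moreover have "AE \<omega> in P x. real_cond_exp (P x) ?F (\<lambda>\<omega>. ?neg (?M \<omega>)) \<omega> = Q P X \<rho> \<delta> (max_at_drawdown X \<rho> \<omega>) ?neg"
    by (rule cond_exp_nonneg[OF \<rho> fin _ _ int_neg]) auto
  moreover have "AE \<omega> in P x. x \<le> max_at_drawdown X \<rho> \<omega>" by (rule AE_start_le_max[OF \<rho>(1)])
  ultimately show ?thesis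
  proof eventually_elim
    case (elim \<omega>)
    let ?y = "max_at_drawdown X \<rho> \<omega>"
    have "(\<integral>\<omega>. f (?M \<omega>) \<partial>P ?y) = (\<integral>\<omega>. ?pos (?M \<omega>) - ?neg (?M \<omega>) \<partial>P ?y)"
      by (intro Bochner_Integration.integral_cong) auto
    also have "\<dots> = (\<integral>\<omega>. ?pos (?M \<omega>) \<partial>P ?y) - (\<integral>\<omega>. ?neg (?M \<omega>) \<partial>P ?y)"
      by (rule Bochner_Integration.integral_diff[OF int_pos[OF elim(4)] int_neg[OF elim(4)]])
    finally have I: "(\<integral>\<omega>. f (?M \<omega>) \<partial>P ?y) = (\<integral>\<omega>. ?pos (?M \<omega>) \<partial>P ?y) - (\<integral>\<omega>. ?neg (?M \<omega>) \<partial>P ?y)" .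
    have f_y: "f ?y = ?pos ?y - ?neg ?y" by (simp add: max_def)
    have alg: "(a - b) * q + (c - d) * p = (a * q + c * p) - (b * q + d * p)" for a b c d p q :: real
      by (simp add: algebra_simps)
    have "Q P X \<rho> \<delta> ?y f = Q P X \<rho> \<delta> ?y ?pos - Q P X \<rho> \<delta> ?y ?neg"
      unfolding Q_eq[OF \<rho>] I alg[symmetric] f_y[symmetric] ..
    then show ?case using elim(1-3) by linarith
  qed
qed

end

section \<open>The limit\<close>

lemma interval_measure_eq_density:
  fixes F F' :: "real \<Rightarrow> real"
  assumes deriv: "\<And>x. (F has_real_derivative F' x) (at x)" and nonneg: "\<And>x. 0 \<le> F' x"
    and F': "F' \<in> borel_measurable borel"
  shows "interval_measure F = density lborel (\<lambda>x. ennreal (F' x))"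
proof (rule measure_eqI_generator_eq)
  let ?E = "range (\<lambda>(a, b). {a<..b::real})"
  have mono: "F a \<le> F b" if "a \<le> b" for a b
    by (rule DERIV_nonneg_imp_nondecreasing[OF that]) (use deriv nonneg in blast)
  have cont: "continuous (at_right a) F" for a
    using DERIV_isCont[OF deriv] by (rule continuous_at_imp_continuous_at_within)
  have im: "emeasure (interval_measure F) {a<..b} = ennreal (F b - F a)" if "a \<le> b" for a b
    using that mono cont by (intro emeasure_interval_measure_Ioc) auto
  show "Int_stable ?E"
    by (rule Int_stableI_image, clarify) (metis (mono_tags, lifting) Int_greaterThanAtMost UNIV_I case_prod_conv)
  show "?E \<subseteq> Pow UNIV" by simp
  show "sets (interval_measure F) = sigma_sets UNIV ?E"
    "sets (density lborel (\<lambda>x. ennreal (F' x))) = sigma_sets UNIV ?E"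
    by (simp_all add: borel_sigma_sets_Ioc)
  show "emeasure (interval_measure F) A = emeasure (density lborel (\<lambda>x. ennreal (F' x))) A" if "A \<in> ?E" for A
  proof -
    obtain a b where A: "A = {a<..b}" using \<open>A \<in> ?E\<close> by auto
    show ?thesis
    proof (cases "a \<le> b")
      case True
      have "emeasure (density lborel (\<lambda>x. ennreal (F' x))) A = (\<integral>\<^sup>+x. ennreal (F' x) * indicator {a<..b} x \<partial>lborel)"
        unfolding A using F' by (subst emeasure_density) auto
      also have "\<dots> = (\<integral>\<^sup>+x. ennreal (F' x) * indicator {a..b} x \<partial>lborel)"
        using AE_lborel_singleton[of a] by (intro nn_integral_cong_AE) (auto simp: indicator_def)
      also have "\<dots> = ennreal (F b - F a)"
        by (rule nn_integral_FTC_Icc) (use F' deriv nonneg True in \<open>auto intro: has_field_derivative_at_within\<close>)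
      finally show ?thesis unfolding A using im[OF True] by simp
    qed (simp add: A)
  qed
  let ?A = "\<lambda>i::nat. {- real i<..real i}"
  show "range ?A \<subseteq> ?E" by auto
  show "(\<Union>i. ?A i) = UNIV"
  proof
    show "UNIV \<subseteq> (\<Union>i. ?A i)"
    proof
      fix x :: real
      obtain n where "\<bar>x\<bar> < real n" using reals_Archimedean2 by blast
      then show "x \<in> (\<Union>i. ?A i)" by (intro UN_I[of n]) auto
    qed
  qed simp
  show "emeasure (interval_measure F) (?A i) \<noteq> \<infinity>" for i using im by simp
qed

context smooth_diffusion
begin

lemma cumulative_rate_mono:
  assumes \<delta>: "0 < \<delta>" and "y \<le> z" shows "cumulative_rate \<delta> y \<le> cumulative_rate \<delta> z"
  by (rule DERIV_nonneg_imp_nondecreasing[OF assms(2)])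
     (use cumulative_rate_deriv[OF \<delta>] rate_nonneg[OF \<delta>] in blast)

context
  fixes y \<delta> :: real and f :: "real \<Rightarrow> real"
  assumes \<delta>: "0 < \<delta>" and fin: "AE \<omega> in P y. drawdown_time X \<delta> \<omega> < \<infinity>"
    and f: "f \<in> borel_measurable borel"
begin

lemma integrable_max_iff:
  "integrable (P y) (\<lambda>\<omega>. f (max_at_drawdown X \<delta> \<omega>)) \<longleftrightarrow> integrable lborel (\<lambda>z. exit_density \<delta> y z * f z)"
proof -
  have M: "max_at_drawdown X \<delta> \<in> measurable (P y) borel" using borel_measurable_max_at_drawdown[OF \<delta>] by simp
  have "integrable (P y) (\<lambda>\<omega>. f (max_at_drawdown X \<delta> \<omega>)) \<longleftrightarrow> integrable (distr (P y) borel (max_at_drawdown X \<delta>)) f"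
    using integrable_distr_eq[OF M f] by simp
  also have "\<dots> \<longleftrightarrow> integrable lborel (\<lambda>z. exit_density \<delta> y z * f z)"
    unfolding distr_max_at_drawdown[OF \<delta> fin]
    using f borel_exit_density[OF \<delta>] exit_density_nonneg[OF \<delta>] by (subst integrable_density) auto
  finally show ?thesis .
qed

lemma integral_max_eq:
  "(\<integral>\<omega>. f (max_at_drawdown X \<delta> \<omega>) \<partial>P y) = (\<integral>z. exit_density \<delta> y z * f z \<partial>lborel)"
proof -
  have M: "max_at_drawdown X \<delta> \<in> measurable (P y) borel" using borel_measurable_max_at_drawdown[OF \<delta>] by simp
  have "(\<integral>\<omega>. f (max_at_drawdown X \<delta> \<omega>) \<partial>P y) = integral\<^sup>L (distr (P y) borel (max_at_drawdown X \<delta>)) f"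
    using integral_distr[OF M f] by simp
  also have "\<dots> = (\<integral>z. exit_density \<delta> y z * f z \<partial>lborel)"
    unfolding distr_max_at_drawdown[OF \<delta> fin]
    using f borel_exit_density[OF \<delta>] exit_density_nonneg[OF \<delta>] by (subst integral_density) auto
  finally show ?thesis .
qed

end

lemma exit_density_mass:
  assumes \<delta>: "0 < \<delta>" and fin: "AE \<omega> in P y. drawdown_time X \<delta> \<omega> < \<infinity>"
  shows "integrable lborel (exit_density \<delta> y)" "(\<integral>z. exit_density \<delta> y z \<partial>lborel) = 1"
proof -
  interpret prob_space "P y" by (rule prob_space_P)
  show "integrable lborel (exit_density \<delta> y)" using integrable_max_iff[OF \<delta> fin, of "\<lambda>_. 1"] by simp
  show "(\<integral>z. exit_density \<delta> y z \<partial>lborel) = 1" using integral_max_eq[OF \<delta> fin, of "\<lambda>_. 1"] prob_space by simp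
qed

text \<open>
By its exponential form the density from \<open>y\<close> is a constant multiple of the density from \<open>x\<close> on
\<open>{y<..}\<close>.
\<close>

lemma integrable_max_above:
  fixes f :: "real \<Rightarrow> real"
  assumes \<delta>: "0 < \<delta>" and fin: "AE \<omega> in P x. drawdown_time X \<delta> \<omega> < \<infinity>" and xy: "x \<le> y"
    and f: "f \<in> borel_measurable borel"
    and int: "integrable (P x) (\<lambda>\<omega>. f (max_at_drawdown X \<delta> \<omega>))"
  shows "integrable (P y) (\<lambda>\<omega>. f (max_at_drawdown X \<delta> \<omega>))"
proof -
  have "integrable lborel (\<lambda>z. exit_density \<delta> x z * f z)"
    using int integrable_max_iff[OF \<delta> fin f] by simp
  then have "integrable lborel (\<lambda>z. exp (cumulative_rate \<delta> y - cumulative_rate \<delta> x) *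
      (indicator {y<..} z *\<^sub>R (exit_density \<delta> x z * f z)))"
    by (intro integrable_mult_right integrable_mult_indicator) auto
  also have "(\<lambda>z. exp (cumulative_rate \<delta> y - cumulative_rate \<delta> x) *
      (indicator {y<..} z *\<^sub>R (exit_density \<delta> x z * f z))) = (\<lambda>z. exit_density \<delta> y z * f z)"
    using xy by (intro ext) (auto simp: exit_density_def indicator_def exp_diff)
  finally show ?thesis
    using integrable_max_iff[OF \<delta> drawdown_finite_above[OF fin \<delta> xy] f] by simp
qed

text \<open>
The term with \<open>f y\<close> can be split off because the density has total mass 1.
\<close>

lemma gen_eq:
  fixes f :: "real \<Rightarrow> real"
  assumes \<rho>: "0 < \<rho>" and fin: "AE \<omega> in P y. drawdown_time X \<rho> \<omega> < \<infinity>"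
    and f: "f \<in> borel_measurable borel" and int: "integrable lborel (\<lambda>z. exit_density \<rho> y z * f z)"
  shows "gen S \<rho> f y = deriv S (y - \<rho>) / (S y - S (y - \<rho>)) *
    ((\<integral>z. exit_density \<rho> y z * f z \<partial>lborel) - f y)"
proof -
  let ?K = "cumulative_rate \<rho>"
  have dS[measurable]: "deriv S \<in> borel_measurable borel"
    by (intro borel_measurable_continuous_onI continuous_deriv_S)
  have S[measurable]: "S \<in> borel_measurable borel" by (intro borel_measurable_continuous_onI S_cont)
  note [measurable] = f borel_measurable_continuous_onI[OF continuous_cumulative_rate[OF \<rho>]]
  have im: "interval_measure S = density lborel (\<lambda>x. ennreal (deriv S x))"
    by (rule interval_measure_eq_density[OF S_deriv deriv_S_nonneg dS])
  have LINT: "(LINT z:A|interval_measure S. h z) = (\<integral>z. deriv S z * (indicator A z * h z) \<partial>lborel)"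
    if [measurable]: "A \<in> sets borel" "h \<in> borel_measurable borel" for A and h :: "real \<Rightarrow> real"
    unfolding set_lebesgue_integral_def im using deriv_S_nonneg by (subst integral_density) auto
  have inner: "(LINT t:{y<..z}|interval_measure S. 1 / (S t - S (t - \<rho>))) = ?K z - ?K y" if "y \<le> z" for z
  proof -
    have "(LINT t:{y<..z}|interval_measure S. 1 / (S t - S (t - \<rho>))) =
        (\<integral>t. deriv S t * (indicator {y<..z} t * (1 / (S t - S (t - \<rho>)))) \<partial>lborel)"
      by (rule LINT) measurable
    also have "\<dots> = (\<integral>t. rate \<rho> t * indicator {y..z} t \<partial>lborel)"
    proof (rule integral_cong_AE)
      note [measurable] = borel_rate[OF \<rho>]
      show "(\<lambda>t. rate \<rho> t * indicator {y..z} t) \<in> borel_measurable lborel" by measurable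
      show "AE t in lborel. deriv S t * (indicator {y<..z} t * (1 / (S t - S (t - \<rho>)))) = rate \<rho> t * indicator {y..z} t"
        using AE_lborel_singleton[of y] by eventually_elim (auto simp: rate_def indicator_def)
    qed measurable
    finally show ?thesis using integral_rate[OF \<rho> that] by simp
  qed
  have "(LINT z:{y<..}|interval_measure S. (f z - f y) / (S z - S (z - \<rho>)) *
        exp (- (LINT t:{y<..z}|interval_measure S. 1 / (S t - S (t - \<rho>))))) =
      (LINT z:{y<..}|interval_measure S. (f z - f y) / (S z - S (z - \<rho>)) * exp (?K y - ?K z))"
    by (intro set_lebesgue_integral_cong) (auto simp: inner)
  also have "\<dots> = (\<integral>z. deriv S z * (indicator {y<..} z * ((f z - f y) / (S z - S (z - \<rho>)) * exp (?K y - ?K z))) \<partial>lborel)"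
    by (rule LINT) measurable
  also have "\<dots> = (\<integral>z. exit_density \<rho> y z * f z - exit_density \<rho> y z * f y \<partial>lborel)"
    by (intro Bochner_Integration.integral_cong) (auto simp: exit_density_def rate_def indicator_def algebra_simps diff_divide_distrib)
  also have "\<dots> = (\<integral>z. exit_density \<rho> y z * f z \<partial>lborel) - f y"
    using int exit_density_mass[OF \<rho> fin] by (subst Bochner_Integration.integral_diff) auto
  finally show ?thesis unfolding gen_def by simp
qed

lemma cumulative_rate_converges:
  assumes \<rho>: "0 < \<rho>" and d: "\<And>n. \<rho> < d n" "d \<longlonglongrightarrow> \<rho>" and yz: "y \<le> z"
  shows "(\<lambda>n. cumulative_rate (d n) z - cumulative_rate (d n) y) \<longlonglongrightarrow> cumulative_rate \<rho> z - cumulative_rate \<rho> y"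
    and rate_converges: "(\<lambda>n. rate (d n) z) \<longlonglongrightarrow> rate \<rho> z"
proof -
  have d0: "0 < d n" for n using \<rho> d(1)[of n] by simp
  have rate: "(\<lambda>n. rate (d n) t) \<longlonglongrightarrow> rate \<rho> t" for t
    unfolding rate_def using \<rho> d(2)
    by (intro tendsto_intros isCont_tendsto_compose[OF S_isCont]) auto
  then show "(\<lambda>n. rate (d n) z) \<longlonglongrightarrow> rate \<rho> z" .
  have "(\<lambda>n. \<integral>t. rate (d n) t * indicator {y..z} t \<partial>lborel) \<longlonglongrightarrow> (\<integral>t. rate \<rho> t * indicator {y..z} t \<partial>lborel)"
  proof (rule integral_dominated_convergence)
    show "(\<lambda>t. rate \<rho> t * indicator {y..z} t) \<in> borel_measurable lborel"
      using borel_rate[OF \<rho>] by (intro borel_measurable_times borel_measurable_indicator) simp_all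
    show "(\<lambda>t. rate (d n) t * indicator {y..z} t) \<in> borel_measurable lborel" for n
      using borel_rate[OF d0[of n]] by (intro borel_measurable_times borel_measurable_indicator) simp_all
    show "integrable lborel (\<lambda>t. rate \<rho> t * indicator {y..z} t)"
      by (rule integrable_FTC_Icc_nonneg[OF borel_rate[OF \<rho>] has_field_derivative_at_within[OF cumulative_rate_deriv[OF \<rho>]]
            rate_nonneg[OF \<rho>] yz])
    show "AE t in lborel. (\<lambda>n. rate (d n) t * indicator {y..z} t) \<longlonglongrightarrow> rate \<rho> t * indicator {y..z} t"
      by (intro AE_I2 tendsto_mult rate tendsto_const)
    show "AE t in lborel. norm (rate (d n) t * indicator {y..z} t) \<le> rate \<rho> t * indicator {y..z} t" for n
      using rate_mono[OF \<rho> less_imp_le[OF d(1)]] rate_nonneg[OF d0] by (auto simp: indicator_def)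
  qed
  then show "(\<lambda>n. cumulative_rate (d n) z - cumulative_rate (d n) y) \<longlonglongrightarrow> cumulative_rate \<rho> z - cumulative_rate \<rho> y"
    using integral_rate[OF \<rho> yz] integral_rate[OF d0 yz] by simp
qed

text \<open>
The function \<open>f\<close> may be unbounded, so its integrability against the law for some \<open>\<delta> > \<rho>\<close> is used:
on the compact support the rate for \<open>\<rho>\<close> is a bounded multiple of that density.  The product bounds
\<open>exit_density d y z * f z\<close> in absolute value for all \<open>d \<ge> \<rho>\<close> at once.
\<close>

lemma integrable_rate_times:
  fixes f :: "real \<Rightarrow> real"
  assumes \<rho>: "0 < \<rho>" "\<rho> < \<delta>" and f: "f \<in> borel_measurable borel" "compact (closure {x. f x \<noteq> 0})"
    and int: "integrable lborel (\<lambda>z. exit_density \<delta> y z * f z)"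
  shows "integrable lborel (\<lambda>z. indicator {y<..} z * rate \<rho> z * f z)"
proof -
  have \<delta>: "0 < \<delta>" using \<rho> by simp
  define r where "r z = (S z - S (z - \<delta>)) / (S z - S (z - \<rho>)) * exp (cumulative_rate \<delta> z - cumulative_rate \<delta> y)" for z
  have "continuous_on A r" for A
    unfolding r_def using \<rho>
    by (intro continuous_intros S_cont continuous_on_compose2[OF S_cont[of UNIV]] continuous_cumulative_rate \<delta>) auto
  then have "bounded (r ` closure {x. f x \<noteq> 0})"
    using f(2) by (intro compact_imp_bounded compact_continuous_image)
  then obtain C where C: "\<And>z. z \<in> closure {x. f x \<noteq> 0} \<Longrightarrow> \<bar>r z\<bar> \<le> C"
    unfolding bounded_iff by auto
  note [measurable] = f(1) borel_rate[OF \<rho>(1)]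
  show ?thesis
  proof (rule Bochner_Integration.integrable_bound)
    show "integrable lborel (\<lambda>z. C * (exit_density \<delta> y z * f z))" using int by simp
    show "(\<lambda>z. indicator {y<..} z * rate \<rho> z * f z) \<in> borel_measurable lborel" by measurable
    show "AE z in lborel. norm (indicator {y<..} z * rate \<rho> z * f z) \<le> norm (C * (exit_density \<delta> y z * f z))"
    proof (rule AE_I2)
      fix z
      have alg: "c * (b / p) * t = a / p * e * (c * (b / a * e') * t)"
        if "a \<noteq> 0" "e * e' = 1" for a b c e e' p t :: real
      proof -
        have "a / p * e * (c * (b / a * e') * t) = e * e' * (c * (b / p) * t)" using that(1) by simp
        then show ?thesis using that(2) by simp
      qed
      have eq: "indicator {y<..} z * rate \<rho> z * f z = r z * (exit_density \<delta> y z * f z)"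
        unfolding r_def exit_density_def rate_def
        by (rule alg) (use \<delta> in \<open>simp_all flip: exp_add\<close>)
      show "norm (indicator {y<..} z * rate \<rho> z * f z) \<le> norm (C * (exit_density \<delta> y z * f z))"
      proof (cases "f z = 0")
        case False
        then have "z \<in> closure {x. f x \<noteq> 0}" using closure_subset[of "{x. f x \<noteq> 0}"] by auto
        then have "\<bar>r z\<bar> \<le> \<bar>C\<bar>" using C[of z] by linarith
        then show ?thesis unfolding eq real_norm_def abs_mult[of "r z"] abs_mult[of C] by (rule mult_right_mono) simp
      qed simp
    qed
  qed
qed

lemma exit_density_le_rate:
  assumes \<rho>: "0 < \<rho>" "\<rho> \<le> \<delta>"
  shows "\<bar>exit_density \<delta> y z * t\<bar> \<le> \<bar>indicator {y<..} z * rate \<rho> z * t\<bar>"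
proof -
  have \<delta>: "0 < \<delta>" using \<rho> by simp
  have "exit_density \<delta> y z \<le> indicator {y<..} z * rate \<rho> z"
  proof (cases "y < z")
    case True
    have "rate \<delta> z * exp (cumulative_rate \<delta> y - cumulative_rate \<delta> z) \<le> rate \<rho> z * 1"
      using cumulative_rate_mono[OF \<delta>, of y z] True rate_mono[OF \<rho>] rate_nonneg \<rho> \<delta>
      by (intro mult_mono) auto
    then show ?thesis using True by (simp add: exit_density_def)
  qed (simp add: exit_density_def)
  then have "\<bar>exit_density \<delta> y z\<bar> \<le> \<bar>indicator {y<..} z * rate \<rho> z\<bar>"
    using exit_density_nonneg[OF \<delta>, of y z] by linarith
  then show ?thesis
    unfolding abs_mult[of _ t] by (intro mult_right_mono) auto
qed

lemma exit_integral_converges: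
  fixes f :: "real \<Rightarrow> real"
  assumes \<rho>: "0 < \<rho>" and f: "f \<in> borel_measurable borel"
    and int: "integrable lborel (\<lambda>z. indicator {y<..} z * rate \<rho> z * f z)"
  shows "((\<lambda>\<delta>. \<integral>z. exit_density \<delta> y z * f z \<partial>lborel) \<longlongrightarrow> (\<integral>z. exit_density \<rho> y z * f z \<partial>lborel)) (at_right \<rho>)"
proof (rule tendsto_at_right_sequentially[of \<rho> "\<rho> + 1"])
  fix d :: "nat \<Rightarrow> real" assume d: "\<And>n. \<rho> < d n" "d \<longlonglongrightarrow> \<rho>"
  have d0: "0 < d n" for n using \<rho> d(1)[of n] by simp
  show "(\<lambda>n. \<integral>z. exit_density (d n) y z * f z \<partial>lborel) \<longlonglongrightarrow> (\<integral>z. exit_density \<rho> y z * f z \<partial>lborel)"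
  proof (rule integral_dominated_convergence)
    show "(\<lambda>z. exit_density \<rho> y z * f z) \<in> borel_measurable lborel"
      using borel_exit_density[OF \<rho>] f by (intro borel_measurable_times) simp_all
    show "(\<lambda>z. exit_density (d n) y z * f z) \<in> borel_measurable lborel" for n
      using borel_exit_density[OF d0[of n]] f by (intro borel_measurable_times) simp_all
    show "integrable lborel (\<lambda>z. \<bar>indicator {y<..} z * rate \<rho> z * f z\<bar>)" using int by simp
    show "AE z in lborel. norm (exit_density (d n) y z * f z) \<le> \<bar>indicator {y<..} z * rate \<rho> z * f z\<bar>" for n
      using exit_density_le_rate[OF \<rho> less_imp_le[OF d(1)]] by simp
    show "AE z in lborel. (\<lambda>n. exit_density (d n) y z * f z) \<longlonglongrightarrow> exit_density \<rho> y z * f z"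
    proof (rule AE_I2)
      fix z
      show "(\<lambda>n. exit_density (d n) y z * f z) \<longlonglongrightarrow> exit_density \<rho> y z * f z"
      proof (cases "y < z")
        case True
        then have yz: "y \<le> z" by simp
        have "(\<lambda>n. rate (d n) z * exp (- (cumulative_rate (d n) z - cumulative_rate (d n) y))) \<longlonglongrightarrow>
            rate \<rho> z * exp (- (cumulative_rate \<rho> z - cumulative_rate \<rho> y))"
          by (intro tendsto_intros cumulative_rate_converges[OF \<rho> d yz])
        then show ?thesis using True by (auto simp: exit_density_def intro: tendsto_mult)
      qed (simp add: exit_density_def)
    qed
  qed
qed simp

text \<open>
The numerator \<open>S (y - \<rho>) - S (y - \<delta>)\<close> vanishes at \<open>\<delta> = \<rho>\<close>, where its derivative in \<open>\<delta>\<close> is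
\<open>S' (y - \<rho>)\<close>.
\<close>

lemma recovery_prob_derivative:
  assumes \<rho>: "0 < \<rho>"
  shows "((\<lambda>\<delta>. recovery_prob \<rho> \<delta> y / (\<delta> - \<rho>)) \<longlongrightarrow> deriv S (y - \<rho>) / (S y - S (y - \<rho>))) (at_right \<rho>)"
proof -
  have "((\<lambda>\<delta>. S (y - \<delta>)) has_real_derivative deriv S (y - \<rho>) * (- 1)) (at \<rho>)"
    by (rule DERIV_chain2[OF S_deriv]) (auto intro!: derivative_eq_intros)
  then have "((\<lambda>\<delta>. S (y - \<delta>)) has_real_derivative - deriv S (y - \<rho>)) (at \<rho>)" by simp
  then have "((\<lambda>\<delta>. (S (y - \<delta>) - S (y - \<rho>)) / (\<delta> - \<rho>)) \<longlongrightarrow> - deriv S (y - \<rho>)) (at_right \<rho>)"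
    unfolding has_field_derivative_iff filterlim_at_split by simp
  then have "((\<lambda>\<delta>. - ((S (y - \<delta>) - S (y - \<rho>)) / (\<delta> - \<rho>)) / (S y - S (y - \<delta>))) \<longlongrightarrow>
      - (- deriv S (y - \<rho>)) / (S y - S (y - \<rho>))) (at_right \<rho>)"
    using \<rho> by (intro tendsto_intros isCont_tendsto_compose[OF S_isCont]) auto
  also have "(\<lambda>\<delta>. - ((S (y - \<delta>) - S (y - \<rho>)) / (\<delta> - \<rho>)) / (S y - S (y - \<delta>))) = (\<lambda>\<delta>. recovery_prob \<rho> \<delta> y / (\<delta> - \<rho>))"
    unfolding recovery_prob_def by (intro ext) (simp add: divide_simps)
  finally show ?thesis by simp
qed

lemma Q_derivative:
  fixes f :: "real \<Rightarrow> real"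
  assumes \<rho>: "0 < \<rho>" and fin: "\<And>d. 0 < d \<Longrightarrow> AE \<omega> in P y. drawdown_time X d \<omega> < \<infinity>"
    and f: "f \<in> borel_measurable borel" "compact (closure {x. f x \<noteq> 0})"
    and int: "\<And>\<delta>. \<rho> < \<delta> \<Longrightarrow> integrable (P y) (\<lambda>\<omega>. f (max_at_drawdown X \<delta> \<omega>))"
  shows "((\<lambda>\<delta>. (Q P X \<rho> \<delta> y f - f y) / (\<delta> - \<rho>)) \<longlongrightarrow> gen S \<rho> f y) (at_right \<rho>)"
proof -
  have "integrable lborel (\<lambda>z. exit_density (\<rho> + 1) y z * f z)"
    using int[of "\<rho> + 1"] integrable_max_iff[OF _ fin f(1), of "\<rho> + 1"] \<rho> by simp
  then have dom: "integrable lborel (\<lambda>z. indicator {y<..} z * rate \<rho> z * f z)"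
    by (rule integrable_rate_times[OF \<rho> _ f, rotated]) simp
  have "integrable lborel (\<lambda>z. exit_density \<rho> y z * f z)"
    using f(1) borel_exit_density[OF \<rho>] exit_density_le_rate[OF \<rho> order_refl]
    by (intro Bochner_Integration.integrable_bound[OF dom]) auto
  note gen = gen_eq[OF \<rho> fin[OF \<rho>] f(1) this]
  have "((\<lambda>\<delta>. recovery_prob \<rho> \<delta> y / (\<delta> - \<rho>) * ((\<integral>z. exit_density \<delta> y z * f z \<partial>lborel) - f y)) \<longlongrightarrow> gen S \<rho> f y) (at_right \<rho>)"
    unfolding gen by (intro tendsto_intros recovery_prob_derivative exit_integral_converges \<rho> f(1) dom)
  moreover have "eventually (\<lambda>\<delta>. recovery_prob \<rho> \<delta> y / (\<delta> - \<rho>) * ((\<integral>z. exit_density \<delta> y z * f z \<partial>lborel) - f y) =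
      (Q P X \<rho> \<delta> y f - f y) / (\<delta> - \<rho>)) (at_right \<rho>)"
    using eventually_at_right_less
  proof eventually_elim
    case (elim \<delta>)
    then have \<delta>: "0 < \<delta>" using \<rho> by simp
    show ?case
      unfolding Q_eq[OF \<rho> elim] integral_max_eq[OF \<delta> fin[OF \<delta>] f(1)] by (simp add: field_simps)
  qed
  ultimately show ?thesis by (rule Lim_transform_eventually)
qed

end

theorem proposition5p4:
  fixes N :: "'w measure" and X :: "real \<Rightarrow> 'w \<Rightarrow> ereal" and P :: "real \<Rightarrow> 'w measure"
    and S v f :: "real \<Rightarrow> real" and m :: "real measure" and \<rho> :: real
  assumes diffusion: "regular_diffusion N X P"
    and scale: "scale_function P X S" "S C1_differentiable_on UNIV"
    and speed: "speed_measure P X S m" "m = density lborel (\<lambda>x. ennreal (v x))"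
      "continuous_on UNIV v" "\<And>x. 0 \<le> v x"
    and long_run:
      "(recurrent P X \<and> filterlim S at_top at_top \<and> filterlim S at_bot at_bot) \<or>
       (transient P X \<and> (\<exists>L. (S \<longlongrightarrow> L) at_top) \<and> filterlim S at_bot at_bot)"
    and drawdown_finite: "\<And>\<delta>. 0 < \<delta> \<Longrightarrow> AE \<omega> in P 0. drawdown_time X \<delta> \<omega> < \<infinity>"
    and rho: "0 < \<rho>"
    and f: "f \<in> borel_measurable borel" "compact (closure {x. f x \<noteq> 0})"
    and f_integrable: "\<And>\<delta>. \<rho> < \<delta> \<Longrightarrow> integrable (P 0) (\<lambda>\<omega>. f (max_at_drawdown X \<delta> \<omega>))"
  shows
    "(\<forall>\<delta>>\<rho>. AE \<omega> in P 0.
        real_cond_exp (P 0) (sigma_at N X (drawdown_time X \<rho>))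
          (\<lambda>\<omega>. f (max_at_drawdown X \<delta> \<omega>)) \<omega>
        = Q P X \<rho> \<delta> (max_at_drawdown X \<rho> \<omega>) f) \<and>
     (AE \<omega> in P 0.
        ((\<lambda>\<delta>. (Q P X \<rho> \<delta> (max_at_drawdown X \<rho> \<omega>) f - f (max_at_drawdown X \<rho> \<omega>)) / (\<delta> - \<rho>))
          \<longlongrightarrow> gen S \<rho> f (max_at_drawdown X \<rho> \<omega>)) (at_right \<rho>))"
proof -
  interpret regular_diffusion N X P by (rule diffusion)
  interpret smooth_diffusion N X P S
    by unfold_locales (rule scale)+
  have int: "integrable (P y) (\<lambda>\<omega>. f (max_at_drawdown X \<delta> \<omega>))" if "\<rho> < \<delta>" "0 \<le> y" for \<delta> y
  proof -
    have "0 < \<delta>" using that rho by simp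
    then show ?thesis
      using integrable_max_above[OF _ drawdown_finite that(2) f(1) f_integrable[OF that(1)]] by simp
  qed
  have cond_exp: "AE \<omega> in P 0. real_cond_exp (P 0) (sigma_at N X (drawdown_time X \<rho>))
          (\<lambda>\<omega>. f (max_at_drawdown X \<delta> \<omega>)) \<omega> = Q P X \<rho> \<delta> (max_at_drawdown X \<rho> \<omega>) f" if "\<rho> < \<delta>" for \<delta>
    by (rule cond_exp_max_at_drawdown[OF rho that drawdown_finite f(1) int[OF that]])
  have "AE \<omega> in P 0. 0 \<le> max_at_drawdown X \<rho> \<omega>" by (rule AE_start_le_max[OF rho])
  then have "AE \<omega> in P 0.
        ((\<lambda>\<delta>. (Q P X \<rho> \<delta> (max_at_drawdown X \<rho> \<omega>) f - f (max_at_drawdown X \<rho> \<omega>)) / (\<delta> - \<rho>))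
          \<longlongrightarrow> gen S \<rho> f (max_at_drawdown X \<rho> \<omega>)) (at_right \<rho>)"
  proof eventually_elim
    case (elim \<omega>)
    show ?case
      by (rule Q_derivative[OF rho drawdown_finite_above[OF drawdown_finite _ elim] f int[OF _ elim]])
  qed
  with cond_exp show ?thesis by blast
qed

end
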